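(* Let $q$ be an indeterminate and for $k\in\mathbb{Z}_{>0}$ put $[k]_q:=1+q+\cdots+q^{k-1}$ (so $[k]_{-q}=1-q+q^2-\cdots+(-q)^{k-1}$, etc.). With the Coxeter groups and homomorphisms $\phi$ described in the context, and with $U^{W}_{\widehat W}(q):=\sum_{w\in\widehat W}q^{\ell_W(\phi(w))}$ where $\ell_W$ is the length function of $W$ with respect to its Coxeter generators, the following hold: \begin{enumerate} \item For $n\ge 1$ and $\phi:B_n\to A_{2n-1}$, $\phi(r_i)=s_is_{2n-i}$ for $i\neq n$, $\phi(r_n)=s_n$: $\displaystyle U_{B_n}^{A_{2n-1}}(q)=\prod_{k=1}^{2n}[k]_{(-1)^kq}$. \item For $n\ge 1$ and $\phi:B_n\to A_{2n}$, $\phi(r_i)=s_is_{2n+1-i}$ for $i\neq n$, $\phi(r_n)=s_ns_{n+1}s_n$: $\displaystyle U_{B_n}^{A_{2n}}(q)=\prod_{k=1}^{2n+1}[k]_{(-1)^kq}$. \item For $n\ge 2$ and $\phi:B_n\to D_{n+1}$, $\phi(r_i)=s_i$ for $i\neq n$, $\phi(r_n)=s_ns_{n+1}$: $\displaystyle U_{B_n}^{D_{n+1}}(q)=[2]_q[3]_{-q}[4]_q\prod_{k=3}^{n}\left([2k+1]_q-q^k\right)$. \item For $\phi:I_2(n+1)\to A_n$ with $\phi(r_1)=\prod_{i \text{ odd},\,1\le i\le n}s_i$ and $\phi(r_2)=\prod_{i\text{ even},\,1\le i\le n}s_i$: if $n=2m$ then $U_{I_2(n+1)}^{A_n}(q)=[2]_{q^m}[n+1]_{q^m}$.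 \item In the same setting as (4), if $n=2m-1$ then $U_{I_2(n+1)}^{A_n}(q)=[2]_{q^{m-1}}[2]_{q^m}[m]_{q^n}$. \end{enumerate}
   Context: Coxeter groups used: $A_N$ ($N\ge1$) is generated by $s_1,\dots,s_N$ with $s_i^2=e$, $(s_is_{i+1})^3=e$, and $(s_is_j)^2=e$ for $|i-j|\ge2$ (the symmetric group $S_{N+1}$). $B_n$ is generated by $r_1,\dots,r_n$ with $r_i^2=e$, $(r_ir_{i+1})^3=e$ for $1\le i<n-1$, $(r_{n-1}r_n)^4=e$, and $(r_ir_j)^2=e$ otherwise (for $n=1$, $B_1=\{e,r_1\}$). $D_{n+1}$ ($n\ge2$) is generated by $s_1,\dots,s_{n+1}$ with $s_i^2=e$, $(s_is_{i+1})^3=e$ for $1\le i\le n-2$, $(s_{n-1}s_n)^3=(s_{n-1}s_{n+1})^3=e$, and all other pairs commuting. $I_2(N)$ is the dihedral group generated by $r_1,r_2$ with $r_1^2=r_2^2=(r_1r_2)^N=e$. In each case the stated assignment on generators extends to an injective group homomorphism $\phi$ (the image is a "folding subgroup"); products of commuting generators are written in any order. *)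

theory Defs
  imports "HOL-Algebra.Group" "HOL-Computational_Algebra.Polynomial"
begin

section \<open>Groups given by generators and relations\<close>

text \<open>The letter \<open>(x, True)\<close> stands for the generator \<open>x\<close> and \<open>(x, False)\<close> for its formal inverse.\<close>

type_synonym 'a gword = "('a \<times> bool) list"

definition gwords :: "'a set \<Rightarrow> 'a gword set" where
  "gwords S = lists (S \<times> UNIV)"

inductive pres_eq :: "'a set \<Rightarrow> 'a gword set \<Rightarrow> 'a gword \<Rightarrow> 'a gword \<Rightarrow> bool"
  for S :: "'a set" and R :: "'a gword set" where
  pres_refl: "pres_eq S R u u"
| pres_sym: "pres_eq S R u v \<Longrightarrow> pres_eq S R v u"
| pres_trans: "pres_eq S R u v \<Longrightarrow> pres_eq S R v w \<Longrightarrow> pres_eq S R u w"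
| pres_cancel: "x \<in> S \<Longrightarrow> pres_eq S R (u @ [(x, b), (x, \<not> b)] @ v) (u @ v)"
| pres_relator: "r \<in> R \<Longrightarrow> pres_eq S R (u @ r @ v) (u @ v)"

definition pres_class :: "'a set \<Rightarrow> 'a gword set \<Rightarrow> 'a gword \<Rightarrow> 'a gword set" where
  "pres_class S R u = {v \<in> gwords S. pres_eq S R u v}"

definition presented_group :: "'a set \<Rightarrow> 'a gword set \<Rightarrow> 'a gword set monoid" where
  "presented_group S R =
    \<lparr> carrier = pres_class S R ` gwords S,
      monoid.mult = (\<lambda>X Y. {w \<in> gwords S. \<exists>u\<in>X. \<exists>v\<in>Y. pres_eq S R (u @ v) w}),
      one = pres_class S R [] \<rparr>"

lemma pres_eq_append_left: "pres_eq S R u v \<Longrightarrow> pres_eq S R (a @ u) (a @ v)"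
proof (induction rule: pres_eq.induct)
  case (pres_cancel x u b v)
  then show ?case using pres_eq.pres_cancel[of x S R "a @ u" b v] by simp
next
  case (pres_relator r u v)
  then show ?case using pres_eq.pres_relator[of r R S "a @ u" v] by simp
qed (auto intro: pres_eq.intros)

lemma pres_eq_append_right: "pres_eq S R u v \<Longrightarrow> pres_eq S R (u @ a) (v @ a)"
proof (induction rule: pres_eq.induct)
  case (pres_cancel x u b v)
  then show ?case using pres_eq.pres_cancel[of x S R u b "v @ a"] by simp
next
  case (pres_relator r u v)
  then show ?case using pres_eq.pres_relator[of r R S u "v @ a"] by simp
qed (auto intro: pres_eq.intros)

lemma pres_eq_append:
  "pres_eq S R u u' \<Longrightarrow> pres_eq S R v v' \<Longrightarrow> pres_eq S R (u @ v) (u' @ v')"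
  by (meson pres_eq_append_left pres_eq_append_right pres_trans)

lemma gwords_append [simp]: "u @ v \<in> gwords S \<longleftrightarrow> u \<in> gwords S \<and> v \<in> gwords S"
  by (auto simp: gwords_def)

lemma gwords_Nil [simp]: "[] \<in> gwords S"
  by (simp add: gwords_def)

lemma pres_class_eq_iff:
  assumes "v \<in> gwords S"
  shows "pres_class S R u = pres_class S R v \<longleftrightarrow> pres_eq S R u v"
proof
  assume "pres_class S R u = pres_class S R v"
  moreover have "v \<in> pres_class S R v"
    using assms by (simp add: pres_class_def pres_refl)
  ultimately have "v \<in> pres_class S R u" by simp
  then show "pres_eq S R u v"
    by (simp add: pres_class_def)
next
  assume "pres_eq S R u v"
  then show "pres_class S R u = pres_class S R v"
    unfolding pres_class_def by (blast intro: pres_sym pres_trans)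
qed

lemma presented_group_mult:
  assumes "u \<in> gwords S" "v \<in> gwords S"
  shows "pres_class S R u \<otimes>\<^bsub>presented_group S R\<^esub> pres_class S R v = pres_class S R (u @ v)"
proof -
  have "pres_eq S R (u @ v) w" if "pres_eq S R u u'" "pres_eq S R v v'" "pres_eq S R (u' @ v') w"
    for u' v' w
    using that pres_eq_append pres_trans by metis
  then show ?thesis
    using assms by (auto simp: presented_group_def pres_class_def intro: pres_refl)
qed

lemma pres_eq_inverse_word:
  "u \<in> gwords S \<Longrightarrow> pres_eq S R (rev (map (apsnd Not) u) @ u) []"
proof (induction u)
  case Nil
  show ?case by (simp add: pres_refl)
next
  case (Cons p u)
  obtain x b where p: "p = (x, b)" by fastforce
  let ?r = "rev (map (apsnd Not) u)"
  have x: "x \<in> S" and u: "u \<in> gwords S" using Cons.prems p by (auto simp: gwords_def)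
  have "pres_eq S R (?r @ [(x, \<not> b), (x, \<not> \<not> b)] @ u) (?r @ u)"
    by (rule pres_cancel[OF x])
  then show ?case using Cons.IH[OF u] p by (auto intro: pres_trans)
qed

lemma group_presented_group: "group (presented_group S R)"
proof (rule groupI)
  let ?G = "presented_group S R"
  have car: "carrier ?G = pres_class S R ` gwords S"
    and one: "\<one>\<^bsub>?G\<^esub> = pres_class S R []"
    by (simp_all add: presented_group_def)
  show "x \<otimes>\<^bsub>?G\<^esub> y \<in> carrier ?G" if "x \<in> carrier ?G" "y \<in> carrier ?G" for x y
    using that by (auto simp: car presented_group_mult)
  show "\<one>\<^bsub>?G\<^esub> \<in> carrier ?G" by (simp add: car one)
  show "x \<otimes>\<^bsub>?G\<^esub> y \<otimes>\<^bsub>?G\<^esub> z = x \<otimes>\<^bsub>?G\<^esub> (y \<otimes>\<^bsub>?G\<^esub> z)"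
    if "x \<in> carrier ?G" "y \<in> carrier ?G" "z \<in> carrier ?G" for x y z
    using that by (auto simp: car presented_group_mult)
  show "\<one>\<^bsub>?G\<^esub> \<otimes>\<^bsub>?G\<^esub> x = x" if "x \<in> carrier ?G" for x
    using that by (auto simp: car one presented_group_mult)
  show "\<exists>y\<in>carrier ?G. y \<otimes>\<^bsub>?G\<^esub> x = \<one>\<^bsub>?G\<^esub>" if x: "x \<in> carrier ?G" for x
  proof -
    obtain u where u: "u \<in> gwords S" "x = pres_class S R u" using x car by auto
    let ?r = "rev (map (apsnd Not) u)"
    have r: "?r \<in> gwords S" using u(1) by (force simp: gwords_def)
    have "pres_class S R ?r \<otimes>\<^bsub>?G\<^esub> x = \<one>\<^bsub>?G\<^esub>"
      using u r pres_eq_inverse_word[OF u(1)]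
      by (simp add: presented_group_mult one pres_class_eq_iff)
    then show ?thesis using r car by blast
  qed
qed


section \<open>Coxeter groups\<close>

text \<open>A Coxeter datum \<open>(S, M)\<close>: relators \<open>(x y)\<^bsup>M x y\<^esup>\<close> for \<open>x, y \<in> S\<close>,
  where \<open>M x x = 1\<close> encodes \<open>x\<^sup>2 = e\<close>.\<close>

type_synonym cox_data = "nat set \<times> (nat \<Rightarrow> nat \<Rightarrow> nat)"

definition cox_relators :: "cox_data \<Rightarrow> nat gword set" where
  "cox_relators X =
    {concat (replicate (snd X x y) [(x, True), (y, True)]) | x y. x \<in> fst X \<and> y \<in> fst X}"

definition cox_group :: "cox_data \<Rightarrow> nat gword set monoid" where
  "cox_group X = presented_group (fst X) (cox_relators X)"

definition cox_gen :: "cox_data \<Rightarrow> nat \<Rightarrow> nat gword set" where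
  "cox_gen X i = pres_class (fst X) (cox_relators X) [(i, True)]"

definition cox_prod :: "cox_data \<Rightarrow> nat list \<Rightarrow> nat gword set" where
  "cox_prod X is = foldr (\<lambda>i g. cox_gen X i \<otimes>\<^bsub>cox_group X\<^esub> g) is \<one>\<^bsub>cox_group X\<^esub>"

definition cox_length :: "cox_data \<Rightarrow> nat gword set \<Rightarrow> nat" where
  "cox_length X w = (LEAST k. \<exists>is \<in> lists (fst X). length is = k \<and> cox_prod X is = w)"

lemma group_cox_group: "group (cox_group X)"
  by (simp add: cox_group_def group_presented_group)

definition cox_A :: "nat \<Rightarrow> cox_data" where
  "cox_A N = ({1..N}, \<lambda>i j. if i = j then 1 else if j = i + 1 \<or> i = j + 1 then 3 else 2)"

definition cox_B :: "nat \<Rightarrow> cox_data" where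
  "cox_B n = ({1..n}, \<lambda>i j. if i = j then 1
      else if j = i + 1 \<or> i = j + 1 then (if max i j = n then 4 else 3) else 2)"

text \<open>In type \<open>D\<^sub>N\<close> the edges are \<open>{i, i + 1}\<close> for \<open>i + 1 < N\<close>, and \<open>{N - 2, N}\<close>.\<close>

definition cox_D :: "nat \<Rightarrow> cox_data" where
  "cox_D N = ({1..N}, \<lambda>i j. if i = j then 1
      else if max i j < N \<and> max i j = min i j + 1 \<or> max i j = N \<and> N = min i j + 2 then 3 else 2)"

definition cox_I2 :: "nat \<Rightarrow> cox_data" where
  "cox_I2 N = ({1, 2}, \<lambda>i j. if i = j then 1 else N)"


section \<open>Foldings and their length generating polynomials\<close>

definition extends_gens ::
    "cox_data \<Rightarrow> cox_data \<Rightarrow> (nat \<Rightarrow> nat gword set) \<Rightarrow> (nat gword set \<Rightarrow> nat gword set) \<Rightarrow> bool" where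
  "extends_gens X' X f \<phi> \<longleftrightarrow>
    \<phi> \<in> hom (cox_group X') (cox_group X) \<and> (\<forall>i \<in> fst X'. \<phi> (cox_gen X' i) = f i)"

abbreviation q_var :: "int poly" where
  "q_var \<equiv> [:0, 1:]"

definition U_poly :: "cox_data \<Rightarrow> cox_data \<Rightarrow> (nat gword set \<Rightarrow> nat gword set) \<Rightarrow> int poly" where
  "U_poly X' X \<phi> = (\<Sum>w \<in> carrier (cox_group X'). q_var ^ cox_length X (\<phi> w))"

definition q_num :: "nat \<Rightarrow> int poly \<Rightarrow> int poly" where
  "q_num k x = (\<Sum>j<k. x ^ j)"

end

(* Types A and D act on finite sets of integers by (signed) permutations, and a word is shortest as
   soon as it creates as many inversions as its length allows.

   For B_n, every element is a unique product of runs, the run for the letters >= L being a prefix of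
   L, L+1, ..., n, ..., L+1, L (coset representatives along the chain of parabolic subgroups).
   Such a run moves the largest value that is still in play one place at a time, first to the
   left up to the centre and then, negated, outwards again; hence each letter meets an ascent,
   lengths of the images add up, and U is the product over j < n of
   [j+1]_{q^a} (1 + q^{aj+b}), where a is the length of the image of r_i (i < n) and b that of r_n:
   (a, b) = (2, 1), (2, 3), (1, 2) in the three cases.

   For I_2(n+1), both alternating words of length n+1 act as the order-reversing permutation, and
   the number of letters in their images is n(n+1)/2, the number of all inversions. So these images
   are reduced, and therefore so are the images of all shorter alternating words. *)

theory Submission
  imports Defs "HOL-Combinatorics.Transposition"
begin

section \<open>Words in the generators of a Coxeter group\<close>

text \<open>The value of \<open>U_poly\<close> and the existence of \<open>\<phi>\<close> make
  different demands. For the value, any \<open>\<phi>\<close> extending the assignment is given; in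
  type B it transports the action on integers back to B_n, so distinct normal forms are told apart
  by their images, and the relations of B_n enter only through \<open>\<phi>\<close>. Existence
  requires the relations of the folded group to hold in the target. In type A this reduces to
  equalities between permutations, because the presented group A_N acts faithfully, which follows
  from the same kind of coset enumeration. In type D the relators are rewritten directly; the only
  long one says that a Coxeter element of A_3 has order 4. Words act by composition, so appending a
  letter changes arguments and not values: whether it creates inversions depends on the values that
  the earlier word takes at the points which the letter moves. Labels placed symmetrically about 0
  turn reversal of the diagram of type A into negation, so that all three targets of B_n share one
  action by odd maps.\<close>

definition cox_eq :: "cox_data \<Rightarrow> nat list \<Rightarrow> nat list \<Rightarrow> bool" where
  "cox_eq X u v \<longleftrightarrow>
    pres_eq (fst X) (cox_relators X) (map (\<lambda>i. (i, True)) u) (map (\<lambda>i. (i, True)) v)"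

definition cox_datum :: "cox_data \<Rightarrow> bool" where
  "cox_datum X \<longleftrightarrow> (\<forall>x\<in>fst X. snd X x x = 1)"

lemma cox_eq_refl [simp]: "cox_eq X u u"
  by (simp add: cox_eq_def pres_refl)

lemma cox_eq_sym: "cox_eq X u v \<Longrightarrow> cox_eq X v u"
  by (simp add: cox_eq_def pres_sym)

lemma cox_eq_trans [trans]: "cox_eq X u v \<Longrightarrow> cox_eq X v w \<Longrightarrow> cox_eq X u w"
  unfolding cox_eq_def by (rule pres_trans)

lemma cox_eq_append: "cox_eq X u u' \<Longrightarrow> cox_eq X v v' \<Longrightarrow> cox_eq X (u @ v) (u' @ v')"
  by (simp add: cox_eq_def pres_eq_append)

lemma cox_eq_subword: "cox_eq X v v' \<Longrightarrow> cox_eq X (u @ v @ w) (u @ v' @ w)"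
  by (simp add: cox_eq_append)

lemma gwords_positive [simp]: "map (\<lambda>i. (i, True)) u \<in> gwords S \<longleftrightarrow> u \<in> lists S"
  by (induction u) (auto simp: gwords_def)

lemma cox_prod_eq_class:
  "u \<in> lists (fst X) \<Longrightarrow>
    cox_prod X u = pres_class (fst X) (cox_relators X) (map (\<lambda>i. (i, True)) u)"
proof (induction u)
  case Nil
  then show ?case by (simp add: cox_prod_def cox_group_def presented_group_def)
next
  case (Cons i u)
  have "cox_prod X (i # u) = cox_gen X i \<otimes>\<^bsub>cox_group X\<^esub> cox_prod X u"
    by (simp add: cox_prod_def)
  moreover have "[(i, True)] \<in> gwords (fst X)" "map (\<lambda>i. (i, True)) u \<in> gwords (fst X)"
    using Cons.prems gwords_positive[of "[i]" "fst X"] by simp_all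
  ultimately show ?case
    using Cons by (simp add: cox_gen_def cox_group_def presented_group_mult)
qed

lemma cox_prod_eq_iff:
  "u \<in> lists (fst X) \<Longrightarrow> v \<in> lists (fst X) \<Longrightarrow> cox_prod X u = cox_prod X v \<longleftrightarrow> cox_eq X u v"
  by (simp add: cox_prod_eq_class pres_class_eq_iff cox_eq_def)

lemma cox_prod_mult:
  "u \<in> lists (fst X) \<Longrightarrow> v \<in> lists (fst X) \<Longrightarrow>
    cox_prod X u \<otimes>\<^bsub>cox_group X\<^esub> cox_prod X v = cox_prod X (u @ v)"
  by (simp add: cox_prod_eq_class presented_group_mult cox_group_def)

lemma cox_prod_in_carrier: "u \<in> lists (fst X) \<Longrightarrow> cox_prod X u \<in> carrier (cox_group X)"
  by (simp add: cox_prod_eq_class cox_group_def presented_group_def)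

lemma cox_eq_relator:
  "x \<in> fst X \<Longrightarrow> y \<in> fst X \<Longrightarrow> cox_eq X (concat (replicate (snd X x y) [x, y])) []"
proof -
  assume "x \<in> fst X" "y \<in> fst X"
  then have "concat (replicate (snd X x y) [(x, True), (y, True)]) \<in> cox_relators X"
    by (auto simp: cox_relators_def)
  from pres_relator[OF this, of "fst X" "[]" "[]"] show ?thesis
    by (simp add: cox_eq_def map_concat)
qed

lemma cox_eq_square:
  assumes "cox_datum X" "x \<in> fst X"
  shows "cox_eq X [x, x] []"
  using cox_eq_relator[of x X x] assms by (simp add: cox_datum_def)

text \<open>A formal inverse equals its generator because \<open>x x\<close> is a relator. Words
  without inverses therefore reach the whole group, and plain lists of letters suffice from here
  on.\<close>

lemma pres_eq_positive:
  assumes X: "cox_datum X"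
  shows "g \<in> gwords (fst X) \<Longrightarrow>
    pres_eq (fst X) (cox_relators X) g (map (\<lambda>i. (i, True)) (map fst g))"
proof (induction g)
  case Nil
  then show ?case by (simp add: pres_refl)
next
  case (Cons p g)
  obtain x b where p: "p = (x, b)" by fastforce
  let ?E = "pres_eq (fst X) (cox_relators X)"
  have x: "x \<in> fst X" and g: "g \<in> gwords (fst X)" using Cons.prems p by (auto simp: gwords_def)
  have "?E [(x, True), (x, True)] []"
    using cox_eq_square[OF X x] by (simp add: cox_eq_def)
  then have "?E ([(x, False)] @ [(x, True), (x, True)]) ([(x, False)] @ [])"
    by (rule pres_eq_append_left)
  moreover have "?E ([] @ [(x, False), (x, \<not> False)] @ [(x, True)]) ([] @ [(x, True)])"
    by (rule pres_cancel[OF x])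
  ultimately have "?E [(x, False)] [(x, True)]"
    using pres_trans[OF pres_sym] by fastforce
  then have "?E [p] [(x, True)]" using p by (cases b) (auto intro: pres_refl)
  from pres_eq_append[OF this Cons.IH[OF g]] show ?case using p by simp
qed

lemma carrier_cox_group:
  assumes X: "cox_datum X"
  shows "carrier (cox_group X) = cox_prod X ` lists (fst X)"
proof
  show "cox_prod X ` lists (fst X) \<subseteq> carrier (cox_group X)"
    using cox_prod_in_carrier by blast
  show "carrier (cox_group X) \<subseteq> cox_prod X ` lists (fst X)"
  proof
    fix w assume "w \<in> carrier (cox_group X)"
    then obtain g where g: "g \<in> gwords (fst X)" "w = pres_class (fst X) (cox_relators X) g"
      by (auto simp: cox_group_def presented_group_def)
    have l: "map fst g \<in> lists (fst X)" using g(1) by (fastforce simp: gwords_def)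
    have "w = cox_prod X (map fst g)"
      unfolding g(2) cox_prod_eq_class[OF l]
      using l pres_eq_positive[OF X g(1)] by (subst pres_class_eq_iff) (simp_all only: gwords_positive)
    then show "w \<in> cox_prod X ` lists (fst X)" using l by blast
  qed
qed

lemma cox_eq_inverse:
  assumes X: "cox_datum X"
  shows "u \<in> lists (fst X) \<Longrightarrow> cox_eq X (u @ rev u) []"
proof (induction u)
  case (Cons x u)
  then have "cox_eq X ([x] @ (u @ rev u) @ [x]) ([x] @ [] @ [x])"
    by (intro cox_eq_subword) auto
  also have "cox_eq X ([x] @ [] @ [x]) []" using cox_eq_square[OF X] Cons.prems by simp
  finally show ?case by simp
qed simp

text \<open>Cutting a relator in the middle with this rule turns it into a commutation or braid
  relation.\<close>

lemma cox_eq_rev_of_append: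
  assumes X: "cox_datum X" and v: "v \<in> lists (fst X)" and e: "cox_eq X (u @ v) []"
  shows "cox_eq X u (rev v)"
proof -
  have "cox_eq X (u @ []) (u @ (v @ rev v))"
    by (intro cox_eq_append cox_eq_refl cox_eq_sym[OF cox_eq_inverse[OF X v]])
  also have "cox_eq X (u @ (v @ rev v)) ([] @ rev v)"
    using cox_eq_append[OF e cox_eq_refl[of X "rev v"]] by simp
  finally show ?thesis by simp
qed

text \<open>Reversal is inversion, since generators are involutions; an identity for ascending words
  thus yields its mirror image for descending ones.\<close>

lemma cox_eq_rev:
  assumes X: "cox_datum X" and u: "u \<in> lists (fst X)" and v: "v \<in> lists (fst X)"
    and e: "cox_eq X u v"
  shows "cox_eq X (rev u) (rev v)"
proof -
  have "cox_eq X (rev v @ u) (rev v @ rev (rev v))"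
    using e by (simp add: cox_eq_append)
  also have "cox_eq X (rev v @ rev (rev v)) []"
    by (rule cox_eq_inverse[OF X]) (use v in auto)
  finally have "cox_eq X (rev v @ u) []" .
  from cox_eq_rev_of_append[OF X u this] show ?thesis by (rule cox_eq_sym)
qed

lemma cox_eq_commute:
  assumes X: "cox_datum X" and "x \<in> fst X" "y \<in> fst X" "snd X x y = 2"
  shows "cox_eq X [x, y] [y, x]"
  using cox_eq_rev_of_append[OF X, of "[x, y]" "[x, y]"] cox_eq_relator[of x X y] assms
  by (simp add: numeral_eq_Suc)

lemma cox_eq_braid3:
  assumes X: "cox_datum X" and "x \<in> fst X" "y \<in> fst X" "snd X x y = 3"
  shows "cox_eq X [x, y, x] [y, x, y]"
  using cox_eq_rev_of_append[OF X, of "[y, x, y]" "[x, y, x]"] cox_eq_relator[of x X y] assms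
  by (simp add: numeral_eq_Suc)

lemma cox_eq_braid4:
  assumes X: "cox_datum X" and "x \<in> fst X" "y \<in> fst X" "snd X x y = 4"
  shows "cox_eq X [x, y, x, y] [y, x, y, x]"
  using cox_eq_rev_of_append[OF X, of "[x, y, x, y]" "[x, y, x, y]"] cox_eq_relator[of x X y] assms
  by (simp add: numeral_eq_Suc)

lemma cox_eq_commute_word:
  assumes X: "cox_datum X" and i: "i \<in> fst X" and "set u \<subseteq> fst X"
    and "\<forall>j\<in>set u. snd X i j = 2"
  shows "cox_eq X (i # u) (u @ [i])"
  using assms(3,4)
proof (induction u)
  case (Cons j u)
  have "cox_eq X ([i, j] @ u) ([j, i] @ u)"
    using Cons.prems X i by (intro cox_eq_append cox_eq_refl cox_eq_commute) auto
  also have "cox_eq X ([j, i] @ u) ([j] @ (u @ [i]))"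
    using Cons cox_eq_append[of X "[j]" "[j]" "i # u" "u @ [i]"] by simp
  finally show ?case by simp
qed simp

section \<open>Homomorphisms between Coxeter groups\<close>

text \<open>The well-definedness part of von Dyck's theorem: under the substitution a cancelling
  pair becomes \<open>g x @ g x\<close> and a relator a power of \<open>g x @ g y\<close>, both
  trivial by assumption.\<close>

lemma cox_eq_substitute:
  assumes X: "cox_datum X" and g: "\<And>x. x \<in> fst X' \<Longrightarrow> g x \<in> lists (fst X)"
    and rel: "\<And>x y. x \<in> fst X' \<Longrightarrow> y \<in> fst X' \<Longrightarrow>
      cox_eq X (concat (replicate (snd X' x y) (g x @ g y))) []"
    and rel2: "\<And>x. x \<in> fst X' \<Longrightarrow> cox_eq X (g x @ g x) []"
    and e: "cox_eq X' u v"
  shows "cox_eq X (concat (map g u)) (concat (map g v))"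
proof -
  let ?h = "\<lambda>w :: nat gword. concat (map (g \<circ> fst) w)"
  have "cox_eq X (?h w) (?h w')"
    if "pres_eq (fst X') (cox_relators X') w w'" for w w'
    using that
  proof (induction rule: pres_eq.induct)
    case (pres_cancel x u b v)
    then show ?case
      using cox_eq_subword[OF rel2[of x], of "?h u" "?h v"] by (simp add: comp_def)
  next
    case (pres_relator r u v)
    then obtain x y where r: "r = concat (replicate (snd X' x y) [(x, True), (y, True)])"
      and xy: "x \<in> fst X'" "y \<in> fst X'"
      by (auto simp: cox_relators_def)
    have "?h (concat (replicate m [(x, True), (y, True)])) =
        concat (replicate m (g x @ g y))" for m
      by (induction m) auto
    with r cox_eq_subword[OF rel[OF xy], of "?h u" "?h v"] show ?case by (simp add: comp_def)
  qed (auto intro: cox_eq_sym cox_eq_trans)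
  from this[OF e[unfolded cox_eq_def]] show ?thesis by (simp add: comp_def)
qed

lemma concat_map_in_lists:
  "(\<And>x. x \<in> S' \<Longrightarrow> g x \<in> lists S) \<Longrightarrow> u \<in> lists S' \<Longrightarrow> concat (map g u) \<in> lists S"
  by (induction u) auto

text \<open>Substitute \<open>g\<close> into some word representing the element;
  \<open>cox_eq_substitute\<close> makes the result independent of the choice.\<close>

lemma extends_gens_exists:
  assumes X: "cox_datum X" and X': "cox_datum X'"
    and g: "\<And>x. x \<in> fst X' \<Longrightarrow> g x \<in> lists (fst X)"
    and f: "\<And>x. x \<in> fst X' \<Longrightarrow> f x = cox_prod X (g x)"
    and rel: "\<And>x y. x \<in> fst X' \<Longrightarrow> y \<in> fst X' \<Longrightarrow>
      cox_eq X (concat (replicate (snd X' x y) (g x @ g y))) []"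
  shows "\<exists>\<phi>. extends_gens X' X f \<phi>"
proof -
  have rel2: "cox_eq X (g x @ g x) []" if "x \<in> fst X'" for x
    using rel[OF that that] X' that by (simp add: cox_datum_def)
  define \<phi> where "\<phi> w = cox_prod X (concat (map g (SOME u. u \<in> lists (fst X') \<and> cox_prod X' u = w)))"
    for w
  have \<phi>: "\<phi> (cox_prod X' u) = cox_prod X (concat (map g u))" if u: "u \<in> lists (fst X')" for u
  proof -
    define v where "v = (SOME v. v \<in> lists (fst X') \<and> cox_prod X' v = cox_prod X' u)"
    have v: "v \<in> lists (fst X') \<and> cox_prod X' v = cox_prod X' u"
      unfolding v_def by (rule someI[of _ u]) (use u in simp)
    then have "cox_eq X' v u" using u cox_prod_eq_iff by blast
    from cox_eq_substitute[OF X g rel rel2 this]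
    have "cox_eq X (concat (map g v)) (concat (map g u))" by blast
    then show ?thesis
      using v u g concat_map_in_lists[of "fst X'" g "fst X"]
      by (simp add: \<phi>_def v_def[symmetric] cox_prod_eq_iff)
  qed
  have "\<phi> \<in> hom (cox_group X') (cox_group X)"
  proof (rule homI)
    show "\<phi> x \<in> carrier (cox_group X)" if x: "x \<in> carrier (cox_group X')" for x
    proof -
      obtain u where "u \<in> lists (fst X')" "x = cox_prod X' u"
        using x by (auto simp: carrier_cox_group[OF X'])
      then show ?thesis
        using \<phi>[of u] concat_map_in_lists[of "fst X'" g "fst X"] g cox_prod_in_carrier by simp
    qed
    show "\<phi> (x \<otimes>\<^bsub>cox_group X'\<^esub> y) = \<phi> x \<otimes>\<^bsub>cox_group X\<^esub> \<phi> y"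
      if xy: "x \<in> carrier (cox_group X')" "y \<in> carrier (cox_group X')" for x y
    proof -
      obtain u v where "u \<in> lists (fst X')" "v \<in> lists (fst X')"
        "x = cox_prod X' u" "y = cox_prod X' v"
        using xy by (auto simp: carrier_cox_group[OF X'])
      then show ?thesis
        using \<phi>[of u] \<phi>[of v] \<phi>[of "u @ v"] concat_map_in_lists[of "fst X'" g "fst X"] g
        by (simp add: cox_prod_mult)
    qed
  qed
  moreover have "\<phi> (cox_gen X' i) = f i" if "i \<in> fst X'" for i
  proof -
    have "cox_gen X' i = cox_prod X' [i]"
      using that by (simp add: cox_gen_def cox_prod_eq_class)
    then show ?thesis using \<phi>[of "[i]"] that f by simp
  qed
  ultimately show ?thesis unfolding extends_gens_def by blast
qed

text \<open>A homomorphism is determined by its values on the generators, so whatever is shown for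
  word substitution holds for every \<open>\<phi>\<close>.\<close>

lemma extends_gens_prod:
  assumes e: "extends_gens X' X f \<phi>"
    and g: "\<And>x. x \<in> fst X' \<Longrightarrow> g x \<in> lists (fst X)"
    and f: "\<And>x. x \<in> fst X' \<Longrightarrow> f x = cox_prod X (g x)"
  shows "u \<in> lists (fst X') \<Longrightarrow> \<phi> (cox_prod X' u) = cox_prod X (concat (map g u))"
proof (induction u)
  case Nil
  have "\<phi> \<one>\<^bsub>cox_group X'\<^esub> = \<one>\<^bsub>cox_group X\<^esub>"
    using e by (simp add: extends_gens_def group_cox_group hom_one)
  then show ?case by (simp add: cox_prod_def)
next
  case (Cons i u)
  have gen: "cox_gen X' i = cox_prod X' [i]"
    using Cons.prems by (simp add: cox_gen_def cox_prod_eq_class)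
  have "\<phi> (cox_prod X' (i # u)) = \<phi> (cox_prod X' [i] \<otimes>\<^bsub>cox_group X'\<^esub> cox_prod X' u)"
    using Cons.prems by (simp add: cox_prod_mult)
  also have "\<dots> = \<phi> (cox_prod X' [i]) \<otimes>\<^bsub>cox_group X\<^esub> \<phi> (cox_prod X' u)"
    using e Cons.prems by (intro hom_mult) (auto simp: extends_gens_def intro!: cox_prod_in_carrier)
  also have "\<phi> (cox_prod X' [i]) = cox_prod X (g i)"
    unfolding gen[symmetric] using e Cons.prems f by (simp add: extends_gens_def)
  also have "\<dots> \<otimes>\<^bsub>cox_group X\<^esub> \<phi> (cox_prod X' u) = cox_prod X (concat (map g (i # u)))"
    using Cons g concat_map_in_lists[of "fst X'" g "fst X"] by (simp add: cox_prod_mult)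
  finally show ?case .
qed

text \<open>\<open>W\<close> is a transversal: with one word per element, the sum over the group
  becomes a sum over words.\<close>

lemma U_poly_eq_sum:
  assumes X': "cox_datum X'" and e: "extends_gens X' X f \<phi>"
    and g: "\<And>x. x \<in> fst X' \<Longrightarrow> g x \<in> lists (fst X)"
    and f: "\<And>x. x \<in> fst X' \<Longrightarrow> f x = cox_prod X (g x)"
    and W: "W \<subseteq> lists (fst X')"
    and inj: "\<And>u v. u \<in> W \<Longrightarrow> v \<in> W \<Longrightarrow> cox_eq X' u v \<Longrightarrow> u = v"
    and all: "\<And>u. u \<in> lists (fst X') \<Longrightarrow> \<exists>v\<in>W. cox_eq X' u v"
  shows "U_poly X' X \<phi> = (\<Sum>u\<in>W. q_var ^ cox_length X (cox_prod X (concat (map g u))))"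
proof -
  have "carrier (cox_group X') = cox_prod X' ` W"
  proof
    show "carrier (cox_group X') \<subseteq> cox_prod X' ` W"
    proof
      fix x assume "x \<in> carrier (cox_group X')"
      then obtain u where u: "u \<in> lists (fst X')" "x = cox_prod X' u"
        by (auto simp: carrier_cox_group[OF X'])
      with all obtain v where "v \<in> W" "cox_eq X' u v" by blast
      then show "x \<in> cox_prod X' ` W" using u W cox_prod_eq_iff[of u X' v] by blast
    qed
    show "cox_prod X' ` W \<subseteq> carrier (cox_group X')" using W cox_prod_in_carrier by blast
  qed
  moreover have "inj_on (cox_prod X') W"
    using W inj cox_prod_eq_iff[of _ X'] by (intro inj_onI) blast
  ultimately have "U_poly X' X \<phi> = (\<Sum>u\<in>W. q_var ^ cox_length X (\<phi> (cox_prod X' u)))"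
    by (simp add: U_poly_def sum.reindex)
  also have "\<dots> = (\<Sum>u\<in>W. q_var ^ cox_length X (cox_prod X (concat (map g u))))"
  proof (intro sum.cong refl)
    fix u assume "u \<in> W"
    with W have "u \<in> lists (fst X')" by blast
    from extends_gens_prod[OF e g f this]
    show "q_var ^ cox_length X (\<phi> (cox_prod X' u)) =
        q_var ^ cox_length X (cox_prod X (concat (map g u)))" by simp
  qed
  finally show ?thesis .
qed

text \<open>A coset enumeration: it suffices to push a single generator through each representative.\<close>

lemma coset_representatives:
  assumes S: "T \<subseteq> fst X" and Q: "[] \<in> Q"
    and step: "\<And>p i. p \<in> Q \<Longrightarrow> i \<in> T \<Longrightarrow> \<exists>v\<in>lists T'. \<exists>p'\<in>Q. cox_eq X (p @ [i]) (v @ p')"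
  shows "u \<in> lists T \<Longrightarrow> \<exists>v\<in>lists T'. \<exists>p\<in>Q. cox_eq X u (v @ p)"
proof (induction u rule: rev_induct)
  case Nil
  show ?case using Q by (intro bexI[of _ "[]"]) auto
next
  case (snoc i u)
  then obtain v p where vp: "v \<in> lists T'" "p \<in> Q" "cox_eq X u (v @ p)" by auto
  obtain v' p' where vp': "v' \<in> lists T'" "p' \<in> Q" "cox_eq X (p @ [i]) (v' @ p')"
    using step[OF vp(2), of i] snoc.prems by auto
  have "cox_eq X (u @ [i]) ((v @ p) @ [i])"
    using vp(3) by (intro cox_eq_append) auto
  also have "cox_eq X ((v @ p) @ [i]) (v @ (v' @ p'))"
    using cox_eq_append[of X v v "p @ [i]" "v' @ p'"] vp'(3) by simp
  finally show ?case using vp(1) vp'(1,2) by (intro bexI[of _ "v @ v'"] bexI[of _ p']) auto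
qed

section \<open>Lengths from inversions\<close>

text \<open>These are pairs of arguments, matching composition on the right. \<open>P\<close>
  selects the pairs that count; type D omits some.\<close>

definition inversions :: "(int \<times> int) set \<Rightarrow> (int \<Rightarrow> int) \<Rightarrow> (int \<times> int) set" where
  "inversions P w = {(x, y) \<in> P. x < y \<and> w y < w x}"

text \<open>The analogue of \<open>cox_eq_substitute\<close> for maps instead of words. It supplies
  the invariants that bound lengths and tell words apart.\<close>

lemma cox_eq_foldr:
  fixes h :: "nat \<Rightarrow> 'b \<Rightarrow> 'b"
  assumes inv: "\<And>x. x \<in> fst X \<Longrightarrow> h x \<circ> h x = id"
    and rel: "\<And>x y. x \<in> fst X \<Longrightarrow> y \<in> fst X \<Longrightarrow> (h x \<circ> h y) ^^ snd X x y = id"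
    and e: "cox_eq X u v"
  shows "foldr h u = foldr h v"
proof -
  let ?h = "\<lambda>w :: nat gword. foldr h (map fst w)"
  have "?h w = ?h w'"
    if "pres_eq (fst X) (cox_relators X) w w'" for w w'
    using that
  proof (induction rule: pres_eq.induct)
    case (pres_cancel x u b v)
    then show ?case using inv by (auto simp: fun_eq_iff)
  next
    case (pres_relator r u v)
    then obtain x y where r: "r = concat (replicate (snd X x y) [(x, True), (y, True)])"
      and xy: "x \<in> fst X" "y \<in> fst X"
      by (auto simp: cox_relators_def)
    have "?h (concat (replicate m [(x, True), (y, True)])) = (h x \<circ> h y) ^^ m" for m
      by (induction m) (auto simp: fun_eq_iff)
    then have "?h r = id" using r rel[OF xy] by simp
    then show ?case by (simp add: fun_eq_iff)
  qed auto
  from this[OF e[unfolded cox_eq_def]] show ?thesis by (simp add: comp_def)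
qed

lemma foldr_concat_replicate: "foldr h (concat (replicate m u)) = foldr h u ^^ m"
  by (induction m) (auto simp: fun_eq_iff)

locale int_action =
  fixes P :: "(int \<times> int) set"
  assumes P_fin: "finite P" and P_sym: "\<And>x y. (x, y) \<in> P \<Longrightarrow> (y, x) \<in> P"
begin

text \<open>Being an involution is built in because only generators, or images of generators, are
  composed on the right.\<close>

definition preserving :: "(int \<Rightarrow> int) \<Rightarrow> bool" where
  "preserving \<beta> \<longleftrightarrow> (\<forall>x. \<beta> (\<beta> x) = x) \<and> (\<forall>x y. (x, y) \<in> P \<longrightarrow> (\<beta> x, \<beta> y) \<in> P)"

lemma inversions_finite [simp]: "finite (inversions P w)"
  by (rule finite_subset[OF _ P_fin]) (auto simp: inversions_def)

lemma card_preimage_inversions: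
  assumes "preserving \<beta>"
  shows "card {(x, y). (\<beta> x, \<beta> y) \<in> inversions P w} = card (inversions P w)"
proof (rule bij_betw_same_card[of "map_prod \<beta> \<beta>"])
  have b: "\<beta> (\<beta> x) = x" for x using assms by (simp add: preserving_def)
  show "bij_betw (map_prod \<beta> \<beta>) {(x, y). (\<beta> x, \<beta> y) \<in> inversions P w} (inversions P w)"
    by (rule bij_betw_byWitness[where f' = "map_prod \<beta> \<beta>"]) (auto simp: b)
qed

lemma finite_preimage_inversions:
  assumes "preserving \<beta>"
  shows "finite {(x, y). (\<beta> x, \<beta> y) \<in> inversions P w}"
proof (rule finite_subset)
  have b: "\<beta> (\<beta> x) = x" for x using assms by (simp add: preserving_def)
  show "{(x, y). (\<beta> x, \<beta> y) \<in> inversions P w} \<subseteq> map_prod \<beta> \<beta> ` inversions P w"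
  proof clarify
    fix x y assume "(\<beta> x, \<beta> y) \<in> inversions P w"
    then show "(x, y) \<in> map_prod \<beta> \<beta> ` inversions P w"
      using b by (intro image_eqI[of _ _ "(\<beta> x, \<beta> y)"]) auto
  qed
qed auto

text \<open>A pair inverted by \<open>w \<circ> \<beta>\<close> is either inverted by
  \<open>\<beta>\<close> already or carried in its order to a pair that \<open>w\<close>
  inverts.\<close>

lemma inversions_comp_le:
  assumes b: "preserving \<beta>"
  shows "card (inversions P (w \<circ> \<beta>)) \<le> card (inversions P \<beta>) + card (inversions P w)"
proof -
  let ?I = "{(x, y). (\<beta> x, \<beta> y) \<in> inversions P w}"
  have "inversions P (w \<circ> \<beta>) \<subseteq> inversions P \<beta> \<union> ?I"
  proof (rule subrelI)
    fix x y assume a: "(x, y) \<in> inversions P (w \<circ> \<beta>)"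
    have "\<beta> x \<noteq> \<beta> y" using a by (auto simp: inversions_def)
    then show "(x, y) \<in> inversions P \<beta> \<union> ?I"
      using a b by (auto simp: inversions_def preserving_def)
  qed
  then have "card (inversions P (w \<circ> \<beta>)) \<le> card (inversions P \<beta> \<union> ?I)"
    using finite_preimage_inversions[OF b] by (intro card_mono) auto
  also have "\<dots> \<le> card (inversions P \<beta>) + card ?I" by (rule card_Un_le)
  finally show ?thesis by (simp add: card_preimage_inversions[OF b])
qed

text \<open>By \<open>asc\<close>, \<open>w\<close> is increasing on every pair that
  \<open>\<beta>\<close> turns round, so no inversion of \<open>\<beta>\<close> is undone and the
  inclusion behind the subadditive bound is an equality.\<close>

lemma inversions_comp_eq:
  assumes b: "preserving \<beta>"
    and asc: "\<And>x y. (x, y) \<in> inversions P \<beta> \<Longrightarrow> w (\<beta> y) < w (\<beta> x)"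
  shows "card (inversions P (w \<circ> \<beta>)) = card (inversions P \<beta>) + card (inversions P w)"
proof -
  let ?I = "{(x, y). (\<beta> x, \<beta> y) \<in> inversions P w}"
  have bb: "\<beta> (\<beta> x) = x" and bP: "(x, y) \<in> P \<Longrightarrow> (\<beta> x, \<beta> y) \<in> P" for x y
    using b by (auto simp: preserving_def)
  have "inversions P (w \<circ> \<beta>) = inversions P \<beta> \<union> ?I"
  proof (intro equalityI subrelI)
    fix x y assume a: "(x, y) \<in> inversions P (w \<circ> \<beta>)"
    have "\<beta> x \<noteq> \<beta> y" using a by (auto simp: inversions_def)
    then show "(x, y) \<in> inversions P \<beta> \<union> ?I"
      using a bP by (auto simp: inversions_def)
  next
    fix x y assume a: "(x, y) \<in> inversions P \<beta> \<union> ?I"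
    show "(x, y) \<in> inversions P (w \<circ> \<beta>)"
    proof (cases "(x, y) \<in> inversions P \<beta>")
      case True
      then show ?thesis using asc[OF True] by (auto simp: inversions_def)
    next
      case False
      then have c: "(\<beta> x, \<beta> y) \<in> P" "\<beta> x < \<beta> y" "w (\<beta> y) < w (\<beta> x)"
        using a by (auto simp: inversions_def)
      have xy: "(x, y) \<in> P" using bP[OF c(1)] bb by simp
      \<comment> \<open>Otherwise \<open>\<beta>\<close> would invert \<open>(y, x)\<close>, and
        \<open>asc\<close> would make \<open>w\<close> increasing on a pair where it
        decreases.\<close>
      have "\<not> y < x"
        using asc[of y x] c P_sym[OF xy] by (auto simp: inversions_def)
      moreover have "x \<noteq> y" using c by auto
      ultimately show ?thesis using c xy by (auto simp: inversions_def)
    qed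
  qed
  moreover have "inversions P \<beta> \<inter> ?I = {}" by (auto simp: inversions_def)
  ultimately show ?thesis
    using finite_preimage_inversions[OF b] card_preimage_inversions[OF b]
    by (simp add: card_Un_disjoint)
qed

end

text \<open>The constant \<open>c\<close> is the number of inversions of a single generator: 1 in type A, and 2 in type D,
  where the mirrored pair is inverted as well.\<close>

locale cox_action = int_action P for P :: "(int \<times> int) set" +
  fixes X :: cox_data and \<sigma> :: "nat \<Rightarrow> int \<Rightarrow> int" and c :: nat
  assumes datum: "cox_datum X" and c_pos: "c > 0"
    and \<sigma>_pres: "\<And>i. i \<in> fst X \<Longrightarrow> preserving (\<sigma> i)"
    and \<sigma>_rel: "\<And>i j. i \<in> fst X \<Longrightarrow> j \<in> fst X \<Longrightarrow> (\<sigma> i \<circ> \<sigma> j) ^^ snd X i j = id"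
    and \<sigma>_inv: "\<And>i. i \<in> fst X \<Longrightarrow> card (inversions P (\<sigma> i)) \<le> c"
begin

lemma foldr_eq: "cox_eq X u v \<Longrightarrow> foldr \<sigma> u = foldr \<sigma> v"
  by (rule cox_eq_foldr[of X \<sigma>])
    (use \<sigma>_pres \<sigma>_rel in \<open>auto simp: fun_eq_iff preserving_def\<close>)

lemma inversions_append_le:
  "v \<in> lists (fst X) \<Longrightarrow>
    card (inversions P (foldr \<sigma> (u @ v))) \<le> card (inversions P (foldr \<sigma> u)) + c * length v"
proof (induction v rule: rev_induct)
  case Nil
  then show ?case by simp
next
  case (snoc i v)
  have "foldr \<sigma> (u @ v @ [i]) = foldr \<sigma> (u @ v) \<circ> \<sigma> i" by auto
  then have "card (inversions P (foldr \<sigma> (u @ v @ [i])))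
      \<le> card (inversions P (\<sigma> i)) + card (inversions P (foldr \<sigma> (u @ v)))"
    using snoc.prems by (simp only:) (rule inversions_comp_le[OF \<sigma>_pres], simp)
  also have "\<dots> \<le> c + (card (inversions P (foldr \<sigma> u)) + c * length v)"
    using snoc by (intro add_mono \<sigma>_inv) (auto simp del: foldr_append)
  finally show ?case by (simp del: foldr_append)
qed

lemma inversions_id [simp]: "inversions P id = {}"
  by (auto simp: inversions_def)

lemma inversions_le: "u \<in> lists (fst X) \<Longrightarrow> card (inversions P (foldr \<sigma> u)) \<le> c * length u"
  using inversions_append_le[of u "[]"] by simp

text \<open>Any other word for the same element acts in the same way, so it needs enough letters for
  the same number of inversions.\<close>

lemma cox_length_eq:
  assumes u: "u \<in> lists (fst X)" and i: "card (inversions P (foldr \<sigma> u)) = c * length u"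
  shows "cox_length X (cox_prod X u) = length u"
  unfolding cox_length_def
proof (rule Least_equality)
  show "\<exists>v\<in>lists (fst X). length v = length u \<and> cox_prod X v = cox_prod X u"
    using u by blast
  fix k assume "\<exists>v\<in>lists (fst X). length v = k \<and> cox_prod X v = cox_prod X u"
  then obtain v where v: "v \<in> lists (fst X)" "length v = k" "cox_prod X v = cox_prod X u" by blast
  then have "foldr \<sigma> v = foldr \<sigma> u" using foldr_eq u cox_prod_eq_iff by blast
  then have "c * length u \<le> c * k" using inversions_le[OF v(1)] i v(2) by simp
  then show "length u \<le> k" using c_pos by simp
qed

end

section \<open>Runs of consecutive generators\<close>

text \<open>The letters from \<open>a\<close> to \<open>b - 1\<close> form a diagram of type A.
  Types A and B share this part; in type B only the node \<open>n\<close> lies outside.\<close>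

definition linear_on :: "cox_data \<Rightarrow> nat \<Rightarrow> nat \<Rightarrow> bool" where
  "linear_on X a b \<longleftrightarrow> cox_datum X \<and> {a..<b} \<subseteq> fst X \<and>
    (\<forall>i\<in>{a..<b}. \<forall>j\<in>{a..<b}. i \<noteq> j \<longrightarrow> snd X i j = (if j = i + 1 \<or> i = j + 1 then 3 else 2))"

lemma linear_on_subset: "linear_on X a b \<Longrightarrow> a \<le> a' \<Longrightarrow> b' \<le> b \<Longrightarrow> linear_on X a' b'"
  by (auto simp: linear_on_def)

text \<open>The run acts as a cycle, and conjugation by a cycle shifts its letters. In words:
  \<open>i\<close> passes the larger letters, takes part in a braid move with
  \<open>i, i + 1\<close>, and leaves as \<open>i + 1\<close> past the smaller ones.\<close>

lemma up_run_shift: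
  assumes X: "linear_on X a b" and i: "a \<le> i" "i + 1 < b"
  shows "cox_eq X ([a..<b] @ [i]) ([i + 1] @ [a..<b])"
proof -
  have d: "cox_datum X" and S: "{a..<b} \<subseteq> fst X" using X by (auto simp: linear_on_def)
  have M: "snd X k j = (if j = k + 1 \<or> k = j + 1 then 3 else 2)"
    if "a \<le> k" "k < b" "a \<le> j" "j < b" "k \<noteq> j" for k j
    using X that by (auto simp: linear_on_def)
  have iS: "i \<in> fst X" "i + 1 \<in> fst X" using S i by auto
  have "[a..<b] = [a..<i] @ [i..<b]" using i upt_add_eq_append[of a i "b - i"] by simp
  also have "[i..<b] = [i, i + 1] @ [i + 2..<b]" using i by (simp add: upt_conv_Cons)
  finally have run: "[a..<b] = [a..<i] @ [i, i + 1] @ [i + 2..<b]" .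
  have "cox_eq X (([a..<i] @ [i, i + 1]) @ ([i + 2..<b] @ [i]))
      (([a..<i] @ [i, i + 1]) @ (i # [i + 2..<b]))"
    by (intro cox_eq_append cox_eq_refl cox_eq_sym[OF cox_eq_commute_word[OF d]])
      (use i S in \<open>auto simp: M\<close>)
  also have "cox_eq X (([a..<i] @ [i, i + 1]) @ (i # [i + 2..<b]))
      ([a..<i] @ [i + 1, i, i + 1] @ [i + 2..<b])"
    using i M[of i "i + 1"] cox_eq_subword[OF cox_eq_braid3[OF d iS], of "[a..<i]" "[i + 2..<b]"]
    by simp
  also have "cox_eq X ([a..<i] @ [i + 1, i, i + 1] @ [i + 2..<b])
      (((i + 1) # [a..<i]) @ ([i, i + 1] @ [i + 2..<b]))"
  proof -
    have "cox_eq X ((i + 1) # [a..<i]) ([a..<i] @ [i + 1])"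
      by (rule cox_eq_commute_word[OF d iS(2)]) (use i S in \<open>auto simp: M\<close>)
    from cox_eq_append[OF cox_eq_sym[OF this] cox_eq_refl[of X "[i, i + 1] @ [i + 2..<b]"]]
    show ?thesis by simp
  qed
  finally show ?thesis using run by simp
qed

text \<open>The inverse cycle shifts the other way: this is \<open>up_run_shift\<close>
  reversed.\<close>

lemma down_run_shift:
  assumes X: "linear_on X a b" and i: "a < i" "i < b"
  shows "cox_eq X (rev [a..<b] @ [i]) ([i - 1] @ rev [a..<b])"
proof -
  have S: "cox_datum X" "{a..<b} \<subseteq> fst X" using X by (auto simp: linear_on_def)
  moreover have "i - 1 \<in> {a..<b}" "i \<in> {a..<b}" using i by auto
  ultimately have "i - 1 \<in> fst X" "i \<in> fst X" by blast+
  then have "cox_eq X (rev ([a..<b] @ [i - 1])) (rev ([i - 1 + 1] @ [a..<b]))"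
    using S i by (intro cox_eq_rev up_run_shift[OF X]) auto
  then show ?thesis using i by (simp add: cox_eq_sym)
qed

text \<open>The new letter prolongs the run, cancels its last letter, commutes past it or is shifted
  through it. The complete run \<open>m = b\<close> is left to the callers, since in type B it has a
  continuation.\<close>

lemma up_run_step:
  assumes X: "linear_on X a b" and i: "a \<le> i" "i < b" and m: "a \<le> m" "m < b"
  shows "\<exists>v\<in>lists {a + 1..<b}. \<exists>m'\<in>{a..b}.
    cox_eq X ([a..<m] @ [i]) (v @ [a..<m'])"
proof -
  have d: "cox_datum X" and S: "{a..<b} \<subseteq> fst X" using X by (auto simp: linear_on_def)
  have M: "snd X k j = (if j = k + 1 \<or> k = j + 1 then 3 else 2)"
    if "a \<le> k" "k < b" "a \<le> j" "j < b" "k \<noteq> j" for k j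
    using X that by (auto simp: linear_on_def)
  consider "i = m" | "i + 1 = m" | "i > m" | "i + 1 < m" by linarith
  then show ?thesis
  proof cases
    case 1
    then show ?thesis using m by (intro bexI[of _ "[]"] bexI[of _ "m + 1"]) auto
  next
    case 2
    then have "[a..<m] = [a..<i] @ [i]" using i by auto
    moreover have "cox_eq X ([a..<i] @ [i, i] @ []) ([a..<i] @ [] @ [])"
      by (intro cox_eq_subword cox_eq_square d) (use S i in auto)
    ultimately show ?thesis using i by (intro bexI[of _ "[]"] bexI[of _ i]) (auto simp: 2[symmetric])
  next
    case 3
    have "cox_eq X ([a..<m] @ [i]) (i # [a..<m])"
      by (intro cox_eq_sym[OF cox_eq_commute_word[OF d]]) (use 3 i m S M in auto)
    then show ?thesis using 3 i m by (intro bexI[of _ "[i]"] bexI[of _ m]) auto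
  next
    case 4
    have "cox_eq X ([a..<m] @ [i]) ([i + 1] @ [a..<m])"
      by (intro up_run_shift[OF linear_on_subset[OF X]]) (use 4 i m in auto)
    then show ?thesis using 4 i m by (intro bexI[of _ "[i + 1]"] bexI[of _ m]) auto
  qed
qed

section \<open>The symmetric group\<close>

lemma transpose_braid:
  assumes "a \<noteq> b" "b \<noteq> c" "a \<noteq> c"
  shows "(transpose a b \<circ> transpose b c) ^^ 3 = id"
    and "(transpose b c \<circ> transpose a b) ^^ 3 = id"
proof -
  have "((transpose a b \<circ> transpose b c) ^^ 3) x = x \<and>
      ((transpose b c \<circ> transpose a b) ^^ 3) x = x" for x
  proof -
    consider "x = a" | "x = b" | "x = c" | "x \<noteq> a" "x \<noteq> b" "x \<noteq> c" by blast
    then show ?thesis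
      using assms assms[symmetric] by cases (simp_all add: numeral_eq_Suc transpose_def)
  qed
  then show "(transpose a b \<circ> transpose b c) ^^ 3 = id"
    and "(transpose b c \<circ> transpose a b) ^^ 3 = id" by (auto simp only: fun_eq_iff id_apply)
qed

lemma transpose_commute:
  assumes "a \<noteq> c" "a \<noteq> d" "b \<noteq> c" "b \<noteq> d"
  shows "(transpose a b \<circ> transpose c d) ^^ 2 = id"
proof
  fix x
  consider "x = a" | "x = b" | "x = c" | "x = d" | "x \<noteq> a" "x \<noteq> b" "x \<noteq> c" "x \<noteq> d" by blast
  then show "((transpose a b \<circ> transpose c d) ^^ 2) x = id x"
    using assms assms[symmetric] by cases (simp_all add: numeral_eq_Suc transpose_def)
qed

lemma transpose_chain_rel:
  fixes p :: "nat \<Rightarrow> 'b"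
  assumes p: "inj_on p {1..N + 1}" and ij: "i \<in> {1..N}" "j \<in> {1..N}"
  shows "(transpose (p i) (p (i + 1)) \<circ> transpose (p j) (p (j + 1))) ^^ snd (cox_A N) i j = id"
proof -
  have ne: "p k = p l \<longleftrightarrow> k = l" if "k \<in> {1..N + 1}" "l \<in> {1..N + 1}" for k l
    using p that by (auto dest: inj_onD)
  consider "i = j" | "j = i + 1" | "i = j + 1" | "i \<noteq> j" "j \<noteq> i + 1" "i \<noteq> j + 1" by blast
  then show ?thesis
  proof cases
    case 1
    then show ?thesis by (simp add: cox_A_def fun_eq_iff)
  next
    case 2
    then show ?thesis
      using ij transpose_braid(1)[of "p i" "p (i + 1)" "p (i + 2)"] by (simp add: cox_A_def ne)
  next
    case 3
    then show ?thesis
      using ij transpose_braid(2)[of "p j" "p (j + 1)" "p (j + 2)"] by (simp add: cox_A_def ne)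
  next
    case 4
    have "(transpose (p i) (p (i + 1)) \<circ> transpose (p j) (p (j + 1))) ^^ 2 = id"
      using 4 ij by (intro transpose_commute) (simp_all add: ne)
    then show ?thesis using 4 by (simp add: cox_A_def)
  qed
qed

lemma cox_A_datum: "cox_datum (cox_A N)"
  by (simp add: cox_datum_def cox_A_def)

lemma cox_A_set [simp]: "fst (cox_A N) = {1..N}"
  by (simp add: cox_A_def)

lemma cox_A_linear: "1 \<le> a \<Longrightarrow> b \<le> N + 1 \<Longrightarrow> linear_on (cox_A N) a b"
  by (auto simp: linear_on_def cox_A_datum) (auto simp: cox_A_def)

definition adj :: "nat \<Rightarrow> nat \<Rightarrow> nat" where
  "adj i = transpose i (i + 1)"

lemma cox_A_foldr_adj: "cox_eq (cox_A N) u v \<Longrightarrow> foldr adj u = foldr adj v"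
  by (rule cox_eq_foldr[of "cox_A N"])
    (auto simp: adj_def fun_eq_iff[of "_ \<circ> _" id] intro!: transpose_chain_rel[of id N, simplified])

lemma foldr_adj_fix: "u \<in> lists {L + 1..} \<Longrightarrow> foldr adj u L = L"
  by (induction u) (auto simp: adj_def transpose_def)

lemma foldr_adj_run: "a \<le> b \<Longrightarrow> foldr adj [a..<b] b = a"
  by (induction b rule: dec_induct) (auto simp: adj_def)

text \<open>Write the word as \<open>v\<close> followed by a run \<open>[L..<m]\<close>, with the
  letters of \<open>v\<close> above \<open>L\<close>. The run sends \<open>m\<close> to
  \<open>L\<close> and \<open>v\<close> fixes \<open>L\<close>, so a word acting trivially has
  \<open>m = L\<close> and hence an empty run; then continue with \<open>v\<close>.\<close>

lemma cox_A_faithful: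
  assumes "u \<in> lists {1..N}" and "\<And>k. k \<in> {1..N + 1} \<Longrightarrow> foldr adj u k = k"
  shows "cox_eq (cox_A N) u []"
proof -
  have "cox_eq (cox_A N) u []"
    if "1 \<le> L" "L + j = N + 1" "u \<in> lists {L..N}" "\<And>k. k \<in> {L..N + 1} \<Longrightarrow> foldr adj u k = k"
    for L j u
    using that
  proof (induction j arbitrary: L u)
    case 0
    then have "u = []" by (cases u) auto
    then show ?case by simp
  next
    case (Suc j)
    have N: "{L..N} = {L..<N + 1}" "L < N + 1" using Suc.prems by auto
    have "\<exists>v\<in>lists {L + 1..<N + 1}. \<exists>p\<in>(\<lambda>m. [L..<m]) ` {L..N + 1}. cox_eq (cox_A N) u (v @ p)"
    proof (rule coset_representatives[where T = "{L..<N + 1}"])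
      show "{L..<N + 1} \<subseteq> fst (cox_A N)" using Suc.prems by auto
      show "[] \<in> (\<lambda>m. [L..<m]) ` {L..N + 1}" using N by (intro image_eqI[of _ _ L]) auto
      show "u \<in> lists {L..<N + 1}" using Suc.prems N by simp
      fix p i assume p: "p \<in> (\<lambda>m. [L..<m]) ` {L..N + 1}" and i: "i \<in> {L..<N + 1}"
      then obtain m where m: "L \<le> m" "m \<le> N + 1" "p = [L..<m]" by (auto simp del: upt_Suc)
      show "\<exists>v\<in>lists {L + 1..<N + 1}. \<exists>p'\<in>(\<lambda>m. [L..<m]) ` {L..N + 1}.
          cox_eq (cox_A N) (p @ [i]) (v @ p')"
      \<comment> \<open>At the complete run \<open>N\<close> cancels the last letter, and every
        other letter is shifted through.\<close>
      proof (cases "m = N + 1")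
        case False
        have "linear_on (cox_A N) L (N + 1)" by (rule cox_A_linear[OF Suc.prems(1)]) simp
        moreover have "L \<le> i" "i < N + 1" "m < N + 1" using i m False by auto
        ultimately show ?thesis using up_run_step[of "cox_A N" L "N + 1" i m] m by blast
      next
        case mN: True
        show ?thesis
        proof (cases "i = N")
          case True
          have "p = [L..<N] @ [N]" using m mN N by (simp add: Suc_leI)
          then have "cox_eq (cox_A N) (p @ [i]) [L..<N]"
            using cox_eq_subword[OF cox_eq_square[OF cox_A_datum, of N N], of "[L..<N]" "[]"]
              True Suc.prems N by simp
          then show ?thesis
            using N by (intro bexI[of _ "[]"] bexI[of _ "[L..<N]"]) auto
        next
          case False
          have "cox_eq (cox_A N) (p @ [i]) ([i + 1] @ p)"
            unfolding m(3) by (intro up_run_shift cox_A_linear) (use False i m mN Suc.prems in auto)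
          then show ?thesis
            using False i p by (intro bexI[of _ "[i + 1]"] bexI[of _ p]) auto
        qed
      qed
    qed
    then obtain v m where v: "v \<in> lists {L + 1..<N + 1}" and "m \<in> {L..N + 1}"
      and e: "cox_eq (cox_A N) u (v @ [L..<m])" by blast
    then have m: "L \<le> m" "m \<le> N + 1" by auto
    have "foldr adj u m = L"
    proof -
      have "v \<in> lists {L + 1..}" using v by auto
      from foldr_adj_fix[OF this] show ?thesis
        using cox_A_foldr_adj[OF e] foldr_adj_run[OF m(1)] by simp
    qed
    then have "m = L" using Suc.prems(4)[of m] m by simp
    then have uv: "cox_eq (cox_A N) u v" using e by simp
    have "cox_eq (cox_A N) v []"
    proof (rule Suc.IH[of "L + 1"])
      show "v \<in> lists {L + 1..N}" using v by auto
      show "foldr adj v k = k" if "k \<in> {L + 1..N + 1}" for k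
        using that Suc.prems(4)[of k] cox_A_foldr_adj[OF uv] by simp
    qed (use Suc.prems in auto)
    with uv show ?case by (rule cox_eq_trans)
  qed
  from this[of 1 N u] assms show ?thesis by simp
qed

text \<open>Increasing labels \<open>p\<close> do not affect inversions. The foldings of B_n want
  labels symmetric about 0, the dihedral ones use \<open>int\<close>.\<close>

locale A_model =
  fixes N :: nat and p :: "nat \<Rightarrow> int"
  assumes p_less: "\<And>i j. 1 \<le> i \<Longrightarrow> i < j \<Longrightarrow> j \<le> N + 1 \<Longrightarrow> p i < p j"
begin

abbreviation P :: "(int \<times> int) set" where
  "P \<equiv> p ` {1..N + 1} \<times> p ` {1..N + 1}"

abbreviation \<sigma> :: "nat \<Rightarrow> int \<Rightarrow> int" where
  "\<sigma> i \<equiv> transpose (p i) (p (i + 1))"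

lemma p_less_iff:
  "i \<in> {1..N + 1} \<Longrightarrow> j \<in> {1..N + 1} \<Longrightarrow> p i < p j \<longleftrightarrow> i < j"
  using p_less[of i j] p_less[of j i] by (cases i j rule: linorder_cases) auto

lemma p_inj: "inj_on p {1..N + 1}"
proof (rule inj_onI)
  fix i j assume "i \<in> {1..N + 1}" "j \<in> {1..N + 1}" "p i = p j"
  then show "i = j" using p_less_iff[of i j] p_less_iff[of j i] by simp
qed

lemma adj_range: "i \<in> {1..N} \<Longrightarrow> k \<in> {1..N + 1} \<Longrightarrow> adj i k \<in> {1..N + 1}"
  by (auto simp: adj_def transpose_def)

lemma \<sigma>_p: "i \<in> {1..N} \<Longrightarrow> k \<in> {1..N + 1} \<Longrightarrow> \<sigma> i (p k) = p (adj i k)"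
  using inj_on_eq_iff[OF p_inj, of k i] inj_on_eq_iff[OF p_inj, of k "i + 1"]
  by (auto simp: adj_def transpose_def)

lemma foldr_range: "u \<in> lists {1..N} \<Longrightarrow> k \<in> {1..N + 1} \<Longrightarrow> foldr adj u k \<in> {1..N + 1}"
proof (induction u)
  case (Cons i u)
  then show ?case using adj_range[of i "foldr adj u k"] by auto
qed auto

lemma foldr_p:
  "u \<in> lists {1..N} \<Longrightarrow> k \<in> {1..N + 1} \<Longrightarrow> foldr \<sigma> u (p k) = p (foldr adj u k)"
proof (induction u)
  case (Cons i u)
  then show ?case using \<sigma>_p[of i "foldr adj u k"] foldr_range[of u k] by auto
qed auto

sublocale int_action P
  by unfold_locales auto

lemma inversions_\<sigma>: "i \<in> {1..N} \<Longrightarrow> inversions P (\<sigma> i) = {(p i, p (i + 1))}"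
proof (intro equalityI subrelI)
  fix x y assume i: "i \<in> {1..N}" and "(x, y) \<in> inversions P (\<sigma> i)"
  then obtain k l where kl: "k \<in> {1..N + 1}" "l \<in> {1..N + 1}" "x = p k" "y = p l"
    "p k < p l" "\<sigma> i (p l) < \<sigma> i (p k)" by (auto simp: inversions_def)
  then have "k < l" "adj i l < adj i k"
    using \<sigma>_p[OF i kl(1)] \<sigma>_p[OF i kl(2)] adj_range[OF i kl(1)] adj_range[OF i kl(2)]
    by (simp_all add: p_less_iff)
  then have "k = i \<and> l = i + 1" by (auto simp: adj_def transpose_def split: if_splits)
  then show "(x, y) \<in> {(p i, p (i + 1))}" using kl by simp
next
  fix x y assume i: "i \<in> {1..N}" and "(x, y) \<in> {(p i, p (i + 1))}"
  then show "(x, y) \<in> inversions P (\<sigma> i)"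
    using p_less[of i "i + 1"] by (auto simp: inversions_def)
qed

lemma \<sigma>_preserving:
  assumes i: "i \<in> {1..N}"
  shows "preserving (\<sigma> i)"
  unfolding preserving_def
proof (intro conjI allI impI)
  fix x y assume "(x, y) \<in> P"
  then obtain k l where kl: "k \<in> {1..N + 1}" "l \<in> {1..N + 1}" "x = p k" "y = p l" by auto
  then show "(\<sigma> i x, \<sigma> i y) \<in> P"
    using \<sigma>_p[OF i] adj_range[OF i] by (auto simp del: One_nat_def)
qed simp

sublocale cox_action P "cox_A N" \<sigma> 1
proof
  show "(\<sigma> i \<circ> \<sigma> j) ^^ snd (cox_A N) i j = id" if "i \<in> fst (cox_A N)" "j \<in> fst (cox_A N)" for i j
    using transpose_chain_rel[OF p_inj, of i j] that by simp
  show "preserving (\<sigma> i)" if "i \<in> fst (cox_A N)" for i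
    using \<sigma>_preserving that by simp
  show "card (inversions P (\<sigma> i)) \<le> 1" if "i \<in> fst (cox_A N)" for i
    using inversions_\<sigma>[of i] that by simp
qed (simp_all add: cox_A_datum)

lemma faithful:
  assumes u: "u \<in> lists {1..N}" and e: "foldr \<sigma> u = id"
  shows "cox_eq (cox_A N) u []"
proof (rule cox_A_faithful[OF u])
  fix k assume k: "k \<in> {1..N + 1}"
  have "p (foldr adj u k) = p k" using foldr_p[OF u k] e by simp
  then show "foldr adj u k = k" using inj_onD[OF p_inj] foldr_range[OF u k] k by blast
qed

end

section \<open>Normal forms in type B\<close>

definition up_run :: "nat \<Rightarrow> nat \<Rightarrow> nat list" where
  "up_run L m = [L..<m]"

definition round_run :: "nat \<Rightarrow> nat \<Rightarrow> nat \<Rightarrow> nat list" where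
  "round_run n L m = [L..<n] @ [n] @ rev [m..<n]"

text \<open>The prefixes of \<open>L, \<dots>, n, \<dots>, L\<close> represent the right cosets of the subgroup generated by
  the letters above \<open>L\<close>.\<close>

definition B_runs :: "nat \<Rightarrow> nat \<Rightarrow> nat list set" where
  "B_runs n L = up_run L ` {L..n} \<union> round_run n L ` {L..n}"

lemma cox_B_set [simp]: "fst (cox_B n) = {1..n}"
  by (simp add: cox_B_def)

lemma cox_B_datum: "cox_datum (cox_B n)"
  by (simp add: cox_datum_def cox_B_def)

lemma cox_B_linear: "1 \<le> a \<Longrightarrow> linear_on (cox_B n) a n"
  by (simp add: linear_on_def cox_B_datum) (auto simp: cox_B_def)

lemma cox_B_commute:
  "i + 2 \<le> j \<or> j + 2 \<le> i \<Longrightarrow> snd (cox_B n) i j = 2"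
  by (auto simp: cox_B_def)

lemma round_run_less: "L \<le> m \<Longrightarrow> m < n \<Longrightarrow> round_run n L m = round_run n L (m + 1) @ [m]"
  by (simp add: round_run_def upt_conv_Cons)

text \<open>Below \<open>n\<close> everything is as in type A. The letter \<open>n\<close> prolongs
  the complete ascending run, which makes it a round run, and commutes past the shorter
  ones.\<close>

lemma B_run_up_step:
  assumes L: "1 \<le> L" "L \<le> m" "m \<le> n" and i: "L \<le> i" "i \<le> n"
  shows "\<exists>v\<in>lists {L + 1..n}. \<exists>p'\<in>B_runs n L. cox_eq (cox_B n) (up_run L m @ [i]) (v @ p')"
proof -
  consider "m < n" "i < n" | "m = n" "i = n" | "m = n" "i + 1 = n" | "m = n" "i + 1 < n"
    | "m < n" "i = n" using L i by linarith
  then show ?thesis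
  proof cases
    case 1
    from up_run_step[OF cox_B_linear[OF L(1)] i(1) 1(2) L(2) 1(1)]
    obtain v m' where "v \<in> lists {L + 1..<n}" "m' \<in> {L..n}"
      "cox_eq (cox_B n) ([L..<m] @ [i]) (v @ [L..<m'])" by blast
    moreover from this have "v \<in> lists {L + 1..n}" "[L..<m'] \<in> B_runs n L"
      by (auto simp: B_runs_def up_run_def)
    ultimately show ?thesis unfolding up_run_def by blast
  next
    case 2
    then have "up_run L m @ [i] = [] @ round_run n L n" by (simp add: up_run_def round_run_def)
    moreover have "round_run n L n \<in> B_runs n L" using L by (simp add: B_runs_def)
    ultimately show ?thesis by (metis cox_eq_refl lists.Nil)
  next
    case 3
    have "cox_eq (cox_B n) ([L..<i] @ [i, i] @ []) ([L..<i] @ [] @ [])"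
      by (intro cox_eq_subword cox_eq_square cox_B_datum) (use L i in auto)
    moreover have "[L..<m] = [L..<i] @ [i]" using 3 i L by auto
    ultimately have "cox_eq (cox_B n) (up_run L m @ [i]) ([] @ up_run L i)"
      by (simp add: up_run_def)
    moreover have "up_run L i \<in> B_runs n L" using L i by (simp add: B_runs_def)
    ultimately show ?thesis by (metis lists.Nil)
  next
    case 4
    have "cox_eq (cox_B n) (up_run L m @ [i]) ([i + 1] @ up_run L m)"
      unfolding up_run_def 4(1) using 4 L i by (intro up_run_shift cox_B_linear) auto
    moreover have "up_run L m \<in> B_runs n L" using L by (simp add: B_runs_def)
    moreover have "[i + 1] \<in> lists {L + 1..n}" using 4 i by simp
    ultimately show ?thesis by blast
  next
    case 5
    have "cox_eq (cox_B n) (n # [L..<m]) ([L..<m] @ [n])"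
      by (rule cox_eq_commute_word[OF cox_B_datum]) (use 5 L in \<open>auto simp: cox_B_commute\<close>)
    then have "cox_eq (cox_B n) (up_run L m @ [i]) ([n] @ up_run L m)" if "m \<noteq> n"
      using 5 by (simp add: up_run_def cox_eq_sym)
    moreover have "up_run L m \<in> B_runs n L" using L by (simp add: B_runs_def)
    moreover have "[n] \<in> lists {L + 1..n}" using 5 L by simp
    ultimately show ?thesis using 5 by blast
  qed
qed

text \<open>The run ends in \<open>m\<close>, so \<open>m\<close> cancels and \<open>m - 1\<close>
  prolongs it. Every other letter passes through the whole run and comes out on the left as a letter
  above \<open>L\<close>.\<close>

lemma B_run_round_step:
  assumes L: "1 \<le> L" "L \<le> m" "m \<le> n" and i: "L \<le> i" "i \<le> n"
  shows "\<exists>v\<in>lists {L + 1..n}. \<exists>p'\<in>B_runs n L. cox_eq (cox_B n) (round_run n L m @ [i]) (v @ p')"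
proof -
  let ?E = "cox_eq (cox_B n)"
  note comm = cox_eq_commute_word[OF cox_B_datum]
  have through: "?thesis"
    if "L + 1 \<le> j" "j \<le> n" "?E (round_run n L m @ [i]) ([j] @ round_run n L m)" for j
  proof -
    have "[j] \<in> lists {L + 1..n}" "round_run n L m \<in> B_runs n L"
      using that L by (auto simp: B_runs_def)
    then show ?thesis using that(3) by blast
  qed
  consider "i = m" "m < n" | "i = m" "m = n" | "i + 1 = m" | "i > m" "i < n" | "m < n" "i = n"
    | "i + 1 < m" using L i by linarith
  then show ?thesis
  proof cases
    case 1
    have "?E (round_run n L (m + 1) @ [i, i] @ []) (round_run n L (m + 1) @ [] @ [])"
      by (intro cox_eq_subword cox_eq_square cox_B_datum) (use L i in auto)
    then have "?E (round_run n L m @ [i]) ([] @ round_run n L (m + 1))"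
      using round_run_less[OF L(2) 1(2)] 1 by simp
    moreover have "round_run n L (m + 1) \<in> B_runs n L" using L 1 by (simp add: B_runs_def)
    ultimately show ?thesis by (metis lists.Nil)
  next
    case 2
    have "?E ([L..<n] @ [i, i] @ []) ([L..<n] @ [] @ [])"
      by (intro cox_eq_subword cox_eq_square cox_B_datum) (use L i in auto)
    then have "?E (round_run n L m @ [i]) ([] @ up_run L n)"
      using 2 by (simp add: round_run_def up_run_def)
    moreover have "up_run L n \<in> B_runs n L" using L by (simp add: B_runs_def)
    ultimately show ?thesis by (metis lists.Nil)
  next
    case 3
    then have "round_run n L m @ [i] = [] @ round_run n L i"
      using round_run_less[of L i n] i L by simp
    moreover have "round_run n L i \<in> B_runs n L" using i by (simp add: B_runs_def)
    ultimately show ?thesis by (metis cox_eq_refl lists.Nil)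
  next
    case 4
    \<comment> \<open>The descending half lowers the letter to \<open>i - 1\<close>, which commutes
      with \<open>n\<close>; the ascending half raises it to \<open>i\<close> again.\<close>
    have "?E (([L..<n] @ [n]) @ (rev [m..<n] @ [i])) (([L..<n] @ [n]) @ ([i - 1] @ rev [m..<n]))"
      using 4 L by (intro cox_eq_append cox_eq_refl down_run_shift cox_B_linear) auto
    also have "?E (([L..<n] @ [n]) @ ([i - 1] @ rev [m..<n])) ([L..<n] @ ([i - 1, n] @ rev [m..<n]))"
    proof -
      have "?E [n, i - 1] [i - 1, n]"
        by (rule cox_eq_commute[OF cox_B_datum]) (use 4 L in \<open>auto simp: cox_B_commute\<close>)
      from cox_eq_subword[OF this, of "[L..<n]" "rev [m..<n]"] show ?thesis by simp
    qed
    also have "?E ([L..<n] @ ([i - 1, n] @ rev [m..<n])) (([i - 1 + 1] @ [L..<n]) @ ([n] @ rev [m..<n]))"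
      using cox_eq_append[OF up_run_shift[OF cox_B_linear[OF L(1)], of "i - 1" n]
          cox_eq_refl[of "cox_B n" "[n] @ rev [m..<n]"]] 4 L by simp
    finally show ?thesis using 4 L by (intro through[of i]) (auto simp: round_run_def)
  next
    case 5
    define k where "k = n - 1"
    have k: "n = k + 1" "L \<le> k" "m \<le> k" "1 \<le> k" using 5 L by (auto simp: k_def)
    have down: "rev [m..<n] = k # rev [m..<k]" and up: "[L..<n] = [L..<k] @ [k]" using k by simp_all
    \<comment> \<open>The new \<open>n\<close> moves left to the central \<open>k, n, k\<close>; the
      fourfold braid relation puts an \<open>n\<close> in front, which is free to leave past the
      letters below \<open>k\<close>.\<close>
    have 1: "?E (rev [m..<k] @ [n]) (n # rev [m..<k])"
      by (rule cox_eq_sym[OF comm]) (use k L in \<open>auto simp: cox_B_commute\<close>)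
    have 2: "?E ([L..<k] @ [n]) (n # [L..<k])"
      by (rule cox_eq_sym[OF comm]) (use k L in \<open>auto simp: cox_B_commute\<close>)
    have 3: "?E [k, n, k, n] [n, k, n, k]"
      by (rule cox_eq_braid4[OF cox_B_datum]) (use k in \<open>auto simp: cox_B_def\<close>)
    have "?E (round_run n L m @ [i]) (([L..<k] @ [k, n, k]) @ (n # rev [m..<k]))"
      using cox_eq_append[OF cox_eq_refl[of "cox_B n" "[L..<k] @ [k, n, k]"] 1] 5
      by (simp add: round_run_def down up)
    also have "?E (([L..<k] @ [k, n, k]) @ (n # rev [m..<k])) (([L..<k] @ [n]) @ ([k, n, k] @ rev [m..<k]))"
      using cox_eq_subword[OF 3, of "[L..<k]" "rev [m..<k]"] by simp
    also have "?E (([L..<k] @ [n]) @ ([k, n, k] @ rev [m..<k])) ([n] @ round_run n L m)"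
      using cox_eq_append[OF 2 cox_eq_refl[of "cox_B n" "[k, n, k] @ rev [m..<k]"]]
      by (simp add: round_run_def down up)
    finally show ?thesis using 5 L by (intro through[of n]) auto
  next
    case 6
    \<comment> \<open>Here \<open>i\<close> commutes with \<open>n\<close> and with the descending
      half, so only the ascending half shifts it.\<close>
    have "?E (([n] @ rev [m..<n]) @ [i]) (i # ([n] @ rev [m..<n]))"
      by (rule cox_eq_sym[OF comm]) (use 6 L i in \<open>auto simp: cox_B_commute\<close>)
    then have "?E (round_run n L m @ [i]) (([L..<n] @ [i]) @ ([n] @ rev [m..<n]))"
      using cox_eq_append[OF cox_eq_refl[of "cox_B n" "[L..<n]"], of "([n] @ rev [m..<n]) @ [i]"]
      by (simp add: round_run_def)
    also have "?E (([L..<n] @ [i]) @ ([n] @ rev [m..<n])) (([i + 1] @ [L..<n]) @ ([n] @ rev [m..<n]))"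
      using 6 L i by (intro cox_eq_append cox_eq_refl up_run_shift cox_B_linear) auto
    finally show ?thesis using 6 L i by (intro through[of "i + 1"]) (auto simp: round_run_def)
  qed
qed

lemma B_coset_step:
  assumes L: "1 \<le> L" "L \<le> n" and p: "p \<in> B_runs n L" and i: "i \<in> {L..n}"
  shows "\<exists>v\<in>lists {L + 1..n}. \<exists>p'\<in>B_runs n L. cox_eq (cox_B n) (p @ [i]) (v @ p')"
proof (rule UnE[OF p[unfolded B_runs_def]])
  assume "p \<in> up_run L ` {L..n}"
  then show ?thesis using B_run_up_step[of L _ n i] L i unfolding B_runs_def by auto
next
  assume "p \<in> round_run n L ` {L..n}"
  then show ?thesis using B_run_round_step[of L _ n i] L i unfolding B_runs_def by auto
qed

text \<open>Stage \<open>j\<close> enumerates the parabolic subgroup on the last \<open>j\<close>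
  letters. The next stage appends a run starting at \<open>n - j\<close>.\<close>

primrec B_forms :: "nat \<Rightarrow> nat \<Rightarrow> nat list set" where
  "B_forms n 0 = {[]}"
| "B_forms n (Suc j) = (\<lambda>(u, p). u @ p) ` (B_forms n j \<times> B_runs n (n - j))"

lemma B_runs_lists: "1 \<le> L \<Longrightarrow> L \<le> n \<Longrightarrow> B_runs n L \<subseteq> lists {L..n}"
  by (auto simp: B_runs_def up_run_def round_run_def)

lemma B_forms_lists: "j \<le> n \<Longrightarrow> B_forms n j \<subseteq> lists {n - j + 1..n}"
proof (induction j)
  case (Suc j)
  have "B_runs n (n - j) \<subseteq> lists {n - j..n}" using Suc.prems by (intro B_runs_lists) auto
  moreover have "n - Suc j + 1 = n - j" using Suc.prems by simp
  moreover have "lists {n - j + 1..n} \<subseteq> lists {n - j..n}" by (intro lists_mono) auto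
  ultimately show ?case using Suc by fastforce
qed simp

lemma B_forms_cover:
  "j \<le> n \<Longrightarrow> u \<in> lists {n - j + 1..n} \<Longrightarrow> \<exists>v\<in>B_forms n j. cox_eq (cox_B n) u v"
proof (induction j arbitrary: u)
  case 0
  then have "u = []" by (cases u) auto
  then show ?case by simp
next
  case (Suc j)
  define L where "L = n - j"
  have L: "1 \<le> L" "L \<le> n" "n - Suc j + 1 = L" using Suc.prems by (auto simp: L_def)
  have "\<exists>v\<in>lists {L + 1..n}. \<exists>p\<in>B_runs n L. cox_eq (cox_B n) u (v @ p)"
  proof (rule coset_representatives[of "{L..n}"])
    show "[] \<in> B_runs n L" using L by (auto simp: B_runs_def up_run_def intro!: image_eqI[of _ _ L])
    show "\<exists>v\<in>lists {L + 1..n}. \<exists>p'\<in>B_runs n L. cox_eq (cox_B n) (p @ [i]) (v @ p')"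
      if "p \<in> B_runs n L" "i \<in> {L..n}" for p i
      using B_coset_step[OF L(1,2) that] .
    show "u \<in> lists {L..n}" using Suc.prems L(3) by simp
  qed (use L in auto)
  then obtain v p where v: "v \<in> lists {L + 1..n}" and p: "p \<in> B_runs n L"
    and e: "cox_eq (cox_B n) u (v @ p)" by blast
  obtain w where w: "w \<in> B_forms n j" "cox_eq (cox_B n) v w"
    using Suc.IH[of v] Suc.prems(1) v by (auto simp: L_def)
  have "cox_eq (cox_B n) u (w @ p)"
    using e cox_eq_append[OF w(2) cox_eq_refl[of _ p]] by (rule cox_eq_trans)
  moreover have "w @ p \<in> B_forms n (Suc j)"
    using w(1) p by (auto simp: L_def intro!: image_eqI[of _ _ "(w, p)"])
  ultimately show ?case by blast
qed

section \<open>Foldings of type B\<close>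

text \<open>For nonzero entries of distinct absolute value this is a reflection of type D; entries
  of opposite sign are used for the extra generator of that type.\<close>

definition sswap :: "int \<Rightarrow> int \<Rightarrow> int \<Rightarrow> int" where
  "sswap a b x =
    (if x = a then b else if x = b then a else if x = - a then - b else if x = - b then - a else x)"

text \<open>The action of the images of the generators of type B. In type A one takes \<open>d = 0\<close>; in type D,
  \<open>d = 1\<close>, the points \<open>\<plusminus>1\<close> are permuted among themselves and \<open>\<plusminus>2, \<dots>, \<plusminus>(n + 1)\<close> carry the action of
  \<open>B\<^sub>n\<close>.\<close>

definition B_act :: "int \<Rightarrow> nat \<Rightarrow> nat \<Rightarrow> int \<Rightarrow> int" where
  "B_act d n i = (if i < n then sswap (d + int n - int i) (d + int n - int i + 1)
    else (\<lambda>x. if \<bar>x\<bar> \<le> d + 1 then - x else x))"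

lemma B_act_minus: "0 \<le> d \<Longrightarrow> B_act d n i (- x) = - B_act d n i x"
  by (auto simp: B_act_def sswap_def)

lemma B_act_invol: "0 \<le> d \<Longrightarrow> B_act d n i (B_act d n i x) = x"
  by (auto simp: B_act_def sswap_def)

lemma B_act_foldr_minus: "0 \<le> d \<Longrightarrow> foldr (B_act d n) u (- x) = - foldr (B_act d n) u x"
  by (induction u) (auto simp: B_act_minus)

lemma B_act_inj_iff: "0 \<le> d \<Longrightarrow> B_act d n i x = B_act d n i y \<longleftrightarrow> x = y"
  by (metis B_act_invol)

lemma B_act_foldr_inj: "0 \<le> d \<Longrightarrow> foldr (B_act d n) u x = foldr (B_act d n) u y \<longleftrightarrow> x = y"
  by (induction u) (auto simp: B_act_inj_iff)

text \<open>In type D the points 1 and -1 merely record the parity of the number of letters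
  \<open>n\<close>.\<close>

lemma B_act_one: "i \<le> n \<Longrightarrow> B_act 1 n i 1 = 1 \<or> B_act 1 n i 1 = - 1"
  by (auto simp: B_act_def sswap_def)

lemma B_act_foldr_one:
  "u \<in> lists {..n} \<Longrightarrow> foldr (B_act 1 n) u 1 = 1 \<or> foldr (B_act 1 n) u 1 = - 1"
proof (induction u)
  case (Cons i u)
  then show ?case using B_act_one[of i n] B_act_minus[of 1 n i 1] by auto
qed simp

text \<open>The bound is the largest value that the letters from \<open>L\<close> on can move,
  attained by the letter \<open>L\<close> itself.\<close>

lemma B_act_bound:
  "0 \<le> d \<Longrightarrow> L \<le> i \<Longrightarrow> i \<le> n \<Longrightarrow> \<bar>x\<bar> \<le> d + int n + 1 - int L \<Longrightarrow>
    \<bar>B_act d n i x\<bar> \<le> d + int n + 1 - int L"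
  by (auto simp: B_act_def sswap_def)

lemma B_act_fix:
  "0 \<le> d \<Longrightarrow> L \<le> i \<Longrightarrow> i \<le> n \<Longrightarrow> \<bar>x\<bar> > d + int n + 1 - int L \<Longrightarrow> B_act d n i x = x"
  by (auto simp: B_act_def sswap_def)

lemma B_act_foldr_bound:
  "0 \<le> d \<Longrightarrow> u \<in> lists {L..n} \<Longrightarrow> \<bar>x\<bar> \<le> d + int n + 1 - int L \<Longrightarrow>
    \<bar>foldr (B_act d n) u x\<bar> \<le> d + int n + 1 - int L"
proof (induction u)
  case (Cons i u)
  then show ?case using B_act_bound[of d L i n "foldr (B_act d n) u x"] by simp
qed simp

lemma B_act_foldr_fix:
  "0 \<le> d \<Longrightarrow> u \<in> lists {L..n} \<Longrightarrow> \<bar>x\<bar> > d + int n + 1 - int L \<Longrightarrow>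
    foldr (B_act d n) u x = x"
proof (induction u)
  case (Cons i u)
  then show ?case using B_act_fix[of d L i n x] by simp
qed simp

lemma B_act_up_run:
  assumes d: "0 \<le> d"
  shows "L \<le> m \<Longrightarrow> m \<le> n \<Longrightarrow>
    foldr (B_act d n) (up_run L m) (d + int n + 1 - int m) = d + int n + 1 - int L"
proof (induction m rule: dec_induct)
  case base
  then show ?case by (simp add: up_run_def)
next
  case (step m)
  have "B_act d n m (d + int n + 1 - int (Suc m)) = d + int n + 1 - int m"
    using step d by (auto simp: B_act_def sswap_def)
  then show ?case using step by (simp add: up_run_def)
qed

lemma B_act_round_run:
  assumes d: "0 \<le> d"
  shows "m \<le> n \<Longrightarrow> L \<le> m \<Longrightarrow>
    foldr (B_act d n) (round_run n L m) (- (d + int n + 1 - int m)) = d + int n + 1 - int L"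
proof (induction m rule: inc_induct)
  case base
  have "B_act d n n (- (d + 1)) = d + 1" using d by (simp add: B_act_def)
  then show ?case using B_act_up_run[OF d, of L n n] base by (simp add: round_run_def up_run_def)
next
  case (step m)
  have "B_act d n m (- (d + int n + 1 - int m)) = - (d + int n + 1 - int (Suc m))"
    using step d by (auto simp: B_act_def sswap_def)
  then show ?case using step round_run_less[of L m n] by simp
qed

text \<open>The words \<open>u\<close> and \<open>u'\<close> fix the top value
  \<open>d + n + 1 - L\<close>. Its preimage under \<open>u @ p\<close> is therefore its preimage
  under \<open>p\<close>, and this point determines the run.\<close>

lemma B_runs_separated:
  assumes d: "0 \<le> d" and u: "u \<in> lists {L + 1..n}" "u' \<in> lists {L + 1..n}"
    and p: "p \<in> B_runs n L" "p' \<in> B_runs n L"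
    and e: "foldr (B_act d n) (u @ p) = foldr (B_act d n) (u' @ p')"
  shows "p = p' \<and> foldr (B_act d n) u = foldr (B_act d n) u'"
proof -
  let ?T = "d + int n + 1 - int L"
  have T: "foldr (B_act d n) w ?T = ?T" if "w \<in> lists {L + 1..n}" "L \<le> n" for w
    using B_act_foldr_fix[OF d that(1), of ?T] that d by simp
  \<comment> \<open>Decodes the preimage of the top value: \<open>d + n + 1 - m\<close> belongs to
    the ascending run up to \<open>m\<close>, its negative to the round run back to
    \<open>m\<close>.\<close>
  define R where "R k =
    (if k > 0 then up_run L (nat (d + int n + 1 - k)) else round_run n L (nat (d + int n + 1 + k)))"
    for k
  have run: "\<exists>k. (\<forall>w\<in>lists {L + 1..n}. foldr (B_act d n) (w @ q) k = ?T) \<and> q = R k"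
    if q: "q \<in> B_runs n L" for q
    using q unfolding B_runs_def
  proof
    assume "q \<in> up_run L ` {L..n}"
    then obtain m where m: "L \<le> m" "m \<le> n" "q = up_run L m" by auto
    then show ?thesis
      using B_act_up_run[OF d m(1,2)] T d by (intro exI[of _ "d + int n + 1 - int m"]) (auto simp: R_def)
  next
    assume "q \<in> round_run n L ` {L..n}"
    then obtain m where m: "L \<le> m" "m \<le> n" "q = round_run n L m" by auto
    then show ?thesis
      using B_act_round_run[OF d m(2,1)] T d by (intro exI[of _ "- (d + int n + 1 - int m)"]) (auto simp: R_def)
  qed
  obtain k where k: "foldr (B_act d n) (u @ p) k = ?T" "p = R k" using run[OF p(1)] u by blast
  obtain k' where k': "foldr (B_act d n) (u' @ p') k' = ?T" "p' = R k'" using run[OF p(2)] u by blast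
  have "k = k'" using k(1) k'(1) e B_act_foldr_inj[OF d] by metis
  then have pp: "p = p'" using k k' by simp
  have "foldr (B_act d n) u x = foldr (B_act d n) u' x" for x
  proof -
    have "foldr (B_act d n) p (foldr (B_act d n) (rev p) y) = y" for y
      by (induction p arbitrary: y) (auto simp: B_act_invol[OF d])
    then show ?thesis using fun_cong[OF e, of "foldr (B_act d n) (rev p) x"] pp by simp
  qed
  with pp show ?thesis by blast
qed

section \<open>Reduced images of the normal forms and their generating polynomial\<close>

lemma B_act_small_inversion:
  assumes "0 \<le> d" "i < n" "(x, y) \<in> inversions P (B_act d n i)"
  defines "a \<equiv> d + int n - int i"
  shows "(x, y) = (a, a + 1) \<or> (x, y) = (- a - 1, - a)"
  using assms by (auto simp: inversions_def B_act_def sswap_def split: if_splits)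

lemma B_act_big_inversion:
  assumes "0 \<le> d" "(x, y) \<in> inversions P (B_act d n n)"
  shows "\<bar>x\<bar> \<le> d + 1" "\<bar>y\<bar> \<le> d + 1"
  using assms by (auto simp: inversions_def B_act_def split: if_splits)

text \<open>\<open>g\<close> spells the image of each generator, and \<open>g_inv\<close> says that
  these words attain the inversion bound. \<open>P1\<close> describes the pairs that count in type
  D.\<close>

locale B_folding = cox_action P X \<sigma> c for P X \<sigma> c +
  fixes n :: nat and d :: int and g :: "nat \<Rightarrow> nat list" and a b :: nat
  assumes n: "n \<ge> 1" and d: "d = 0 \<or> d = 1"
    and P1: "\<And>x y. d = 1 \<Longrightarrow> (x, y) \<in> P \<Longrightarrow> x \<noteq> 0 \<and> y \<noteq> 0 \<and> x \<noteq> - y"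
    and g_lists: "\<And>i. i \<in> {1..n} \<Longrightarrow> g i \<in> lists (fst X)"
    and g_act: "\<And>i. i \<in> {1..n} \<Longrightarrow> foldr \<sigma> (g i) = B_act d n i"
    and g_len: "\<And>i. i \<in> {1..n} \<Longrightarrow> length (g i) = (if i < n then a else b)"
    and g_inv: "\<And>i. i \<in> {1..n} \<Longrightarrow> card (inversions P (B_act d n i)) = c * length (g i)"
begin

abbreviation \<beta> :: "nat \<Rightarrow> int \<Rightarrow> int" where "\<beta> \<equiv> B_act d n"

abbreviation wt :: "nat list \<Rightarrow> nat" where "wt u \<equiv> length (concat (map g u))"

lemma d0: "0 \<le> d" using d by auto

lemma foldr_concat_g: "u \<in> lists {1..n} \<Longrightarrow> foldr \<sigma> (concat (map g u)) = foldr \<beta> u"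
  by (induction u) (auto simp: g_act fun_eq_iff)

lemma \<beta>_preserving:
  assumes i: "i \<in> {1..n}"
  shows "preserving (\<beta> i)"
proof -
  have "(foldr \<sigma> u x, foldr \<sigma> u y) \<in> P" if "u \<in> lists (fst X)" "(x, y) \<in> P" for u x y
    using that
  proof (induction u)
    case (Cons i u)
    then show ?case using \<sigma>_pres[of i] by (simp add: preserving_def)
  qed simp
  from this[OF g_lists[OF i]] show ?thesis
    by (simp add: preserving_def B_act_invol[OF d0] g_act[OF i])
qed

definition reduced :: "nat list \<Rightarrow> bool" where
  "reduced u \<longleftrightarrow> card (inversions P (foldr \<beta> u)) = c * wt u"

text \<open>All pairs inverted by \<open>\<beta> i\<close> must be ascents of the earlier word. As
  the maps are odd, this is decided by one comparison for \<open>i < n\<close> and by the sign of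
  one value for \<open>i = n\<close>.\<close>

lemma reduced_append:
  assumes u: "u \<in> lists {1..n}" "reduced u" and i: "i \<in> {1..n}"
    and less: "i < n \<Longrightarrow> foldr \<beta> u (d + int n - int i) < foldr \<beta> u (d + int n - int i + 1)"
    and eq: "i = n \<Longrightarrow> foldr \<beta> u (d + 1) > 0"
  shows "reduced (u @ [i])"
proof -
  let ?w = "foldr \<beta> u"
  have odd: "?w (- x) = - ?w x" for x by (rule B_act_foldr_minus[OF d0])
  have "card (inversions P (?w \<circ> \<beta> i)) = card (inversions P (\<beta> i)) + card (inversions P ?w)"
  proof (rule inversions_comp_eq[OF \<beta>_preserving[OF i]])
    fix x y assume xy: "(x, y) \<in> inversions P (\<beta> i)"
    show "?w (\<beta> i y) < ?w (\<beta> i x)"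
    proof (cases "i < n")
      case True
      let ?a = "d + int n - int i"
      have bb: "\<beta> i ?a = ?a + 1" "\<beta> i (?a + 1) = ?a"
        using True d0 by (auto simp: B_act_def sswap_def)
      then have "\<beta> i (- ?a) = - (?a + 1)" "\<beta> i (- ?a - 1) = - ?a"
        using B_act_minus[OF d0, of n i ?a] B_act_minus[OF d0, of n i "?a + 1"] by simp_all
      with bb B_act_small_inversion[OF d0 True xy] less[OF True] odd[of ?a] odd[of "?a + 1"]
      show ?thesis by auto
    next
      case False
      then have "i = n" using i by simp
      note bnd = B_act_big_inversion[OF d0 xy[unfolded \<open>i = n\<close>]]
      have neg: "\<beta> i x = - x" "\<beta> i y = - y" using bnd \<open>i = n\<close> by (auto simp: B_act_def)
      have lt: "x < y" and P: "(x, y) \<in> P" using xy by (auto simp: inversions_def)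
      have pos: "?w (d + 1) > 0" using eq \<open>i = n\<close> by simp
      have zero: "?w 0 = 0" using odd[of 0] by simp
      have "?w x < ?w y"
      proof (cases "d = 0")
        case True
        have m1: "?w (- 1) = - ?w 1" by (rule odd)
        have "x = -1 \<or> x = 0 \<or> x = 1" "y = -1 \<or> y = 0 \<or> y = 1" using bnd True by auto
        then show ?thesis using lt pos zero m1 True by auto
      next
        case False
        then have d1: "d = 1" using d by simp
        have one: "?w 1 = 1 \<or> ?w 1 = - 1"
        proof -
          have "u \<in> lists {..n}" using u(1) by auto
          from B_act_foldr_one[OF this] show ?thesis using d1 by simp
        qed
        have m: "?w (- 1) = - ?w 1" "?w (- 2) = - ?w 2" by (rule odd)+
        \<comment> \<open>The values at 1 and -1 are 1 and -1 in some order, so the positive value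
          at 2 is at least 2. The unknown order is harmless, as \<open>(-1, 1)\<close> is not in
          \<open>P\<close>.\<close>
        have "?w 2 \<noteq> ?w 1" "?w 2 \<noteq> ?w (- 1)" by (simp_all add: B_act_foldr_inj[OF d0])
        then have two: "?w 2 \<ge> 2" using one m pos d1 by auto
        have "x \<noteq> 0" "y \<noteq> 0" "x \<noteq> - y" using P1[OF d1 P] by auto
        moreover have "x \<in> {-2, -1, 0, 1, 2}" "y \<in> {-2, -1, 0, 1, 2}" using bnd d1 by auto
        ultimately show ?thesis using lt one two m by auto
      qed
      then show ?thesis using neg odd by simp
    qed
  qed
  moreover have "foldr \<beta> (u @ [i]) = ?w \<circ> \<beta> i" by auto
  ultimately show ?thesis
    using u(2) g_inv[OF i] unfolding reduced_def by (simp add: algebra_simps del: foldr_append)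
qed

text \<open>All values in play are at most \<open>?T\<close> in absolute value. On the way up
  \<open>?T\<close> stands at the larger of the two positions exchanged next, on the way back
  \<open>- ?T\<close> stands at the smaller one: an ascent for any \<open>u\<close>.\<close>

lemma reduced_append_run:
  assumes L: "1 \<le> L" and u: "u \<in> lists {L + 1..n}" "reduced u" and p: "p \<in> B_runs n L"
  shows "reduced (u @ p)"
proof -
  let ?T = "d + int n + 1 - int L"
  have L1: "up_run L m \<in> lists {L..n}" "round_run n L m \<in> lists {L..n}" if "L \<le> m" "m \<le> n" for m
    using that by (auto simp: up_run_def round_run_def)
  have u1: "u \<in> lists {L..n}" "u \<in> lists {1..n}" using u(1) L by auto
  have fixT: "foldr \<beta> u ?T = ?T" if "L \<le> n"
    using B_act_foldr_fix[OF d0 u(1), of ?T] that d0 by simp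
  have bound: "\<bar>foldr \<beta> (u @ q) x\<bar> \<le> ?T" if "q \<in> lists {L..n}" "\<bar>x\<bar> \<le> ?T" for q x
    using B_act_foldr_bound[OF d0, of "u @ q" L n x] that u1 by simp
  have up: "reduced (u @ up_run L m)" if "L \<le> m" "m \<le> n" for m
    using that
  proof (induction m rule: dec_induct)
    case base
    then show ?case using u by (simp add: up_run_def)
  next
    case (step m)
    let ?w = "foldr \<beta> (u @ up_run L m)"
    have arg: "d + int n - int m + 1 = d + int n + 1 - int m" by simp
    have "?w (d + int n - int m + 1) = ?T"
      unfolding arg using B_act_up_run[OF d0, of L m n] step fixT by simp
    moreover have "\<bar>?w (d + int n - int m)\<bar> \<le> ?T"
      using step d0 by (intro bound L1) auto
    moreover have "?w (d + int n - int m) \<noteq> ?w (d + int n - int m + 1)"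
      by (simp add: B_act_foldr_inj[OF d0] del: foldr_append)
    ultimately have "?w (d + int n - int m) < ?w (d + int n - int m + 1)"
      by linarith
    then have "reduced ((u @ up_run L m) @ [m])"
      using step L u1 L1[of m] by (intro reduced_append) auto
    then show ?case using step by (simp add: up_run_def)
  qed
  have round: "reduced (u @ round_run n L m)" if "L \<le> m" "m \<le> n" for m
    using that(2,1)
  proof (induction m rule: inc_induct)
    case base
    have "foldr \<beta> (u @ up_run L n) (d + 1) = ?T"
      using B_act_up_run[OF d0, of L n n] base fixT by simp
    then have "reduced ((u @ up_run L n) @ [n])"
      using base L u1 L1[of n] d0 n by (intro reduced_append up) auto
    then show ?case by (simp add: up_run_def round_run_def)
  next
    case (step m)
    let ?w = "foldr \<beta> (u @ round_run n L (Suc m))"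
    have arg: "d + int n + 1 - int (Suc m) = d + int n - int m" by simp
    have "?w (- (d + int n + 1 - int (Suc m))) = ?T"
      using B_act_round_run[OF d0, of "Suc m" n L] step fixT by simp
    then have "?w (d + int n - int m) = - ?T"
      using B_act_foldr_minus[OF d0, of n "u @ round_run n L (Suc m)" "d + int n - int m"]
      unfolding arg by linarith
    moreover have "\<bar>?w (d + int n - int m + 1)\<bar> \<le> ?T"
      using step d0 by (intro bound L1) auto
    moreover have "?w (d + int n - int m) \<noteq> ?w (d + int n - int m + 1)"
      by (simp add: B_act_foldr_inj[OF d0] del: foldr_append)
    ultimately have "?w (d + int n - int m) < ?w (d + int n - int m + 1)"
      by linarith
    then have "reduced ((u @ round_run n L (Suc m)) @ [m])"
      using step L u1 L1[of "Suc m"] by (intro reduced_append) auto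
    then show ?case using round_run_less[of L m n] step by simp
  qed
  show ?thesis using p up round by (auto simp: B_runs_def)
qed

lemma reduced_B_forms: "j \<le> n \<Longrightarrow> u \<in> B_forms n j \<Longrightarrow> reduced u"
proof (induction j arbitrary: u)
  case 0
  then show ?case by (simp add: reduced_def)
next
  case (Suc j)
  then obtain v p where v: "v \<in> B_forms n j" "p \<in> B_runs n (n - j)" "u = v @ p" by auto
  have "v \<in> lists {n - j + 1..n}" using B_forms_lists[of j n] v Suc.prems by auto
  then show ?case
    unfolding v(3) using Suc v by (intro reduced_append_run[of "n - j"]) auto
qed

lemma B_forms_separated:
  "j \<le> n \<Longrightarrow> u \<in> B_forms n j \<Longrightarrow> v \<in> B_forms n j \<Longrightarrow> foldr \<beta> u = foldr \<beta> v \<Longrightarrow> u = v"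
proof (induction j arbitrary: u v)
  case (Suc j)
  obtain u1 p where u: "u1 \<in> B_forms n j" "p \<in> B_runs n (n - j)" "u = u1 @ p"
    using Suc.prems by auto
  obtain v1 q where v: "v1 \<in> B_forms n j" "q \<in> B_runs n (n - j)" "v = v1 @ q"
    using Suc.prems by auto
  have "u1 \<in> lists {n - j + 1..n}" "v1 \<in> lists {n - j + 1..n}"
    using B_forms_lists[of j n] u v Suc.prems(1) by auto
  from B_runs_separated[OF d0 this u(2) v(2) Suc.prems(4)[unfolded u(3) v(3)]]
  have "p = q" "foldr \<beta> u1 = foldr \<beta> v1" by auto
  then show ?case using Suc.IH[of u1 v1] Suc.prems(1) u v by simp
qed simp

lemma length_concat_g: "u \<in> lists {1..<n} \<Longrightarrow> wt u = a * length u"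
  by (induction u) (auto simp: g_len)

text \<open>Ascending runs have the weights \<open>a * k\<close> with \<open>k \<le> j\<close>. A
  round run has weight \<open>a * j + b\<close> at its turn and \<open>a * k\<close> for the way
  back, so the two families differ by one power of \<open>x\<close>.\<close>

lemma sum_B_runs:
  fixes x :: "'r :: comm_semiring_1"
  assumes j: "j < n"
  shows "(\<Sum>p\<in>B_runs n (n - j). x ^ wt p) = (\<Sum>k<j + 1. (x ^ a) ^ k) * (1 + x ^ (a * j + b))"
proof -
  define L where "L = n - j"
  have L: "1 \<le> L" "L \<le> n" "n - L = j" using j by (auto simp: L_def)
  have wt_up: "wt (up_run L m) = a * (m - L)" if "m \<in> {L..n}" for m
  proof -
    have "up_run L m \<in> lists {1..<n}" using that L by (auto simp: up_run_def)
    from length_concat_g[OF this] show ?thesis by (simp add: up_run_def)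
  qed
  have wt_round: "wt (round_run n L m) = a * j + b + a * (n - m)" if "m \<in> {L..n}" for m
  proof -
    have "[L..<n] \<in> lists {1..<n}" "rev [m..<n] \<in> lists {1..<n}" using that L by auto
    from this[THEN length_concat_g] show ?thesis using L n g_len[of n] by (simp add: round_run_def)
  qed
  have inj: "inj_on (up_run L) {L..n}" "inj_on (round_run n L) {L..n}"
  proof (rule_tac [!] inj_onI)
    fix m m' assume m: "m \<in> {L..n}" "m' \<in> {L..n}"
    show "m = m'" if "up_run L m = up_run L m'"
      using arg_cong[OF that, of length] m by (simp add: up_run_def eq_diff_iff)
    show "m = m'" if "round_run n L m = round_run n L m'"
    proof -
      have "n - m = n - m'" using arg_cong[OF that, of length] by (simp add: round_run_def)
      then have "n - (n - m) = n - (n - m')" by simp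
      then show ?thesis using m by simp
    qed
  qed
  have disj: "up_run L ` {L..n} \<inter> round_run n L ` {L..n} = {}"
  proof -
    have "n \<notin> set p" if "p \<in> up_run L ` {L..n}" for p
      using that by (auto simp: up_run_def)
    moreover have "n \<in> set p" if "p \<in> round_run n L ` {L..n}" for p
      using that by (auto simp: round_run_def)
    ultimately show ?thesis by blast
  qed
  have "(\<Sum>p\<in>B_runs n L. x ^ wt p) =
      (\<Sum>m\<in>{L..n}. x ^ wt (up_run L m)) + (\<Sum>m\<in>{L..n}. x ^ wt (round_run n L m))"
    by (simp add: B_runs_def sum.union_disjoint[OF _ _ disj] sum.reindex[OF inj(1)]
        sum.reindex[OF inj(2)])
  also have "(\<Sum>m\<in>{L..n}. x ^ wt (up_run L m)) = (\<Sum>k<j + 1. (x ^ a) ^ k)"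
    by (rule sum.reindex_bij_witness[of _ "\<lambda>k. L + k" "\<lambda>m. m - L"])
      (use L in \<open>auto simp: wt_up power_mult\<close>)
  also have "(\<Sum>m\<in>{L..n}. x ^ wt (round_run n L m)) = (\<Sum>k<j + 1. x ^ (a * j + b) * (x ^ a) ^ k)"
    by (rule sum.reindex_bij_witness[of _ "\<lambda>k. n - k" "\<lambda>m. n - m"])
      (use L in \<open>auto simp: wt_round power_mult power_add\<close>)
  also have "\<dots> = (\<Sum>k<j + 1. (x ^ a) ^ k) * x ^ (a * j + b)"
    by (simp only: sum_distrib_left[symmetric]) (rule mult.commute)
  finally show ?thesis by (simp add: L_def distrib_left)
qed

text \<open>Unique factorisation into runs turns the sum over forms into a product of sums over
  runs.\<close>

lemma sum_B_forms:
  fixes x :: "'r :: comm_semiring_1"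
  shows "j \<le> n \<Longrightarrow>
    (\<Sum>u\<in>B_forms n j. x ^ wt u) = (\<Prod>i<j. (\<Sum>k<i + 1. (x ^ a) ^ k) * (1 + x ^ (a * i + b)))"
proof (induction j)
  case (Suc j)
  have inj: "inj_on (\<lambda>(u, p). u @ p) (B_forms n j \<times> B_runs n (n - j))"
  proof (rule inj_onI, clarify)
    fix u p v q assume uv: "u \<in> B_forms n j" "v \<in> B_forms n j" "p \<in> B_runs n (n - j)"
      "q \<in> B_runs n (n - j)" and e: "u @ p = v @ q"
    have "u \<in> lists {n - j + 1..n}" "v \<in> lists {n - j + 1..n}"
      using B_forms_lists[of j n] uv Suc.prems by auto
    from B_runs_separated[OF d0 this uv(3,4)] e have "p = q" by simp
    then show "u = v \<and> p = q" using e by simp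
  qed
  have "(\<Sum>u\<in>B_forms n (Suc j). x ^ wt u) =
      (\<Sum>(u, p)\<in>B_forms n j \<times> B_runs n (n - j). x ^ wt u * x ^ wt p)"
    unfolding B_forms.simps sum.reindex[OF inj] by (intro sum.cong) (auto simp: power_add)
  also have "\<dots> = (\<Sum>u\<in>B_forms n j. x ^ wt u) * (\<Sum>p\<in>B_runs n (n - j). x ^ wt p)"
    by (simp add: sum_product sum.cartesian_product)
  finally show ?case using Suc sum_B_runs[of j x] by simp
qed simp

text \<open>The forms are told apart in B_n after applying \<open>\<phi>\<close>: equal elements
  have equal images, hence equal actions, hence equal forms. So \<open>\<phi>\<close> is injective
  as well.\<close>

theorem U_poly_B:
  assumes e: "extends_gens (cox_B n) X f \<phi>"
    and f: "\<And>i. i \<in> {1..n} \<Longrightarrow> f i = cox_prod X (g i)"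
  shows "U_poly (cox_B n) X \<phi> =
    (\<Prod>j<n. q_num (j + 1) (q_var ^ a) * (1 + q_var ^ (a * j + b)))"
proof -
  have gl: "concat (map g u) \<in> lists (fst X)" if "u \<in> lists {1..n}" for u
    by (rule concat_map_in_lists[OF g_lists that])
  have \<phi>: "\<phi> (cox_prod (cox_B n) u) = cox_prod X (concat (map g u))" if "u \<in> lists {1..n}" for u
    by (rule extends_gens_prod[OF e]) (use g_lists f that in auto)
  have W: "B_forms n n \<subseteq> lists {1..n}" using B_forms_lists[of n n] by simp
  have "U_poly (cox_B n) X \<phi> =
      (\<Sum>u\<in>B_forms n n. q_var ^ cox_length X (cox_prod X (concat (map g u))))"
  proof (rule U_poly_eq_sum[OF cox_B_datum e])
    fix u v assume uv: "u \<in> B_forms n n" "v \<in> B_forms n n" "cox_eq (cox_B n) u v"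
    then have l: "u \<in> lists {1..n}" "v \<in> lists {1..n}" using W by auto
    then have "cox_prod (cox_B n) u = cox_prod (cox_B n) v" using uv(3) by (simp add: cox_prod_eq_iff)
    then have "cox_prod X (concat (map g u)) = cox_prod X (concat (map g v))"
      using l[THEN \<phi>] by simp
    then have "cox_eq X (concat (map g u)) (concat (map g v))"
      using cox_prod_eq_iff gl l by blast
    then have "foldr \<beta> u = foldr \<beta> v" using foldr_eq foldr_concat_g l by metis
    then show "u = v" using B_forms_separated[of n u v] uv by simp
  next
    show "\<exists>v\<in>B_forms n n. cox_eq (cox_B n) u v" if "u \<in> lists (fst (cox_B n))" for u
      using B_forms_cover[of n n u] that by simp
  qed (use W g_lists f in auto)
  also have "\<dots> = (\<Sum>u\<in>B_forms n n. q_var ^ wt u)"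
  proof (intro sum.cong refl)
    fix u assume u: "u \<in> B_forms n n"
    then have l: "u \<in> lists {1..n}" using W by auto
    have "cox_length X (cox_prod X (concat (map g u))) = wt u"
      using reduced_B_forms[OF _ u] foldr_concat_g[OF l]
      by (intro cox_length_eq gl[OF l]) (simp add: reduced_def)
    then show "q_var ^ cox_length X (cox_prod X (concat (map g u))) = q_var ^ wt u" by simp
  qed
  finally show ?thesis by (simp add: sum_B_forms q_num_def)
qed

end

section \<open>The foldings of type B into types A and D\<close>

lemma sswap_left: "sswap a b a = b"
  and sswap_right: "sswap a b b = a"
  and sswap_other: "\<bar>x\<bar> \<noteq> \<bar>a\<bar> \<Longrightarrow> \<bar>x\<bar> \<noteq> \<bar>b\<bar> \<Longrightarrow> sswap a b x = x"
  by (auto simp: sswap_def)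

lemma sswap_neg:
  "a \<noteq> 0 \<Longrightarrow> b \<noteq> 0 \<Longrightarrow> \<bar>a\<bar> \<noteq> \<bar>b\<bar> \<Longrightarrow> sswap a b (- x) = - sswap a b x"
  by (auto simp: sswap_def)

lemma sswap_invol: "a \<noteq> 0 \<Longrightarrow> b \<noteq> 0 \<Longrightarrow> \<bar>a\<bar> \<noteq> \<bar>b\<bar> \<Longrightarrow> sswap a b (sswap a b x) = x"
  by (auto simp: sswap_def)

text \<open>Oddness settles \<open>- y\<close> together with \<open>y\<close>, which halves the case
  distinctions over signed points.\<close>

lemma odd_eq_id:
  fixes F :: "int \<Rightarrow> int"
  assumes odd: "\<And>x. F (- x) = - F x" and A: "\<And>y. y \<in> A \<Longrightarrow> F y = y"
    and other: "\<And>x. \<forall>y\<in>A. \<bar>x\<bar> \<noteq> \<bar>y\<bar> \<Longrightarrow> F x = x"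
  shows "F = id"
proof
  fix x
  show "F x = id x"
  proof (cases "\<forall>y\<in>A. \<bar>x\<bar> \<noteq> \<bar>y\<bar>")
    case False
    then obtain y where "y \<in> A" "x = y \<or> x = - y" by (auto simp: abs_eq_iff)
    then show ?thesis using A[of y] odd[of y] by auto
  qed (simp add: other)
qed

lemma funpow_small: "(f ^^ 2) x = f (f x)" "(f ^^ 3) x = f (f (f x))" "(f ^^ 4) x = f (f (f (f x)))"
  by (simp_all add: numeral_eq_Suc)

lemma sswap_braid:
  assumes "a \<noteq> 0" "b \<noteq> 0" "c \<noteq> 0" "\<bar>a\<bar> \<noteq> \<bar>b\<bar>" "\<bar>b\<bar> \<noteq> \<bar>c\<bar>" "\<bar>a\<bar> \<noteq> \<bar>c\<bar>"
  shows "(sswap a b \<circ> sswap b c) ^^ 3 = id" "(sswap b c \<circ> sswap a b) ^^ 3 = id"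
proof -
  have neg: "sswap a b (- x) = - sswap a b x" "sswap b c (- x) = - sswap b c x" for x
    using assms by (simp_all only: sswap_neg not_False_eq_True)
  have val: "sswap a b a = b" "sswap a b b = a" "sswap a b c = c"
    "sswap b c a = a" "sswap b c b = c" "sswap b c c = b"
    using assms by (auto intro: sswap_left sswap_right sswap_other)
  have other: "sswap a b x = x" "sswap b c x = x" if "\<forall>y\<in>{a, b, c}. \<bar>x\<bar> \<noteq> \<bar>y\<bar>" for x
    using that by (auto intro: sswap_other)
  show "(sswap a b \<circ> sswap b c) ^^ 3 = id"
  proof (rule odd_eq_id[of _ "{a, b, c}"])
    fix y assume "y \<in> {a, b, c}"
    then consider "y = a" | "y = b" | "y = c" by blast
    then show "((sswap a b \<circ> sswap b c) ^^ 3) y = y"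
      by cases (simp_all only: funpow_small comp_apply val)
  qed (simp_all only: funpow_small comp_apply neg other)
  show "(sswap b c \<circ> sswap a b) ^^ 3 = id"
  proof (rule odd_eq_id[of _ "{a, b, c}"])
    fix y assume "y \<in> {a, b, c}"
    then consider "y = a" | "y = b" | "y = c" by blast
    then show "((sswap b c \<circ> sswap a b) ^^ 3) y = y"
      by cases (simp_all only: funpow_small comp_apply val)
  qed (simp_all only: funpow_small comp_apply neg other)
qed

lemma sswap_commute:
  assumes "a \<noteq> 0" "b \<noteq> 0" "c \<noteq> 0" "e \<noteq> 0" "\<bar>a\<bar> \<noteq> \<bar>b\<bar>" "\<bar>c\<bar> \<noteq> \<bar>e\<bar>"
    "\<bar>a\<bar> \<noteq> \<bar>c\<bar>" "\<bar>a\<bar> \<noteq> \<bar>e\<bar>" "\<bar>b\<bar> \<noteq> \<bar>c\<bar>" "\<bar>b\<bar> \<noteq> \<bar>e\<bar>"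
  shows "(sswap a b \<circ> sswap c e) ^^ 2 = id"
proof (rule odd_eq_id[of _ "{a, b, c, e}"])
  have neg: "sswap a b (- x) = - sswap a b x" "sswap c e (- x) = - sswap c e x" for x
    using assms by (simp_all only: sswap_neg not_False_eq_True)
  show "((sswap a b \<circ> sswap c e) ^^ 2) (- x) = - ((sswap a b \<circ> sswap c e) ^^ 2) x" for x
    by (simp only: funpow_small comp_apply neg)
  have val: "sswap a b a = b" "sswap a b b = a" "sswap a b c = c" "sswap a b e = e"
    "sswap c e a = a" "sswap c e b = b" "sswap c e c = e" "sswap c e e = c"
    using assms by (auto intro: sswap_left sswap_right sswap_other)
  fix y assume "y \<in> {a, b, c, e}"
  then consider "y = a" | "y = b" | "y = c" | "y = e" by blast
  then show "((sswap a b \<circ> sswap c e) ^^ 2) y = y"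
    by cases (simp_all only: funpow_small comp_apply val)
next
  fix x assume "\<forall>y\<in>{a, b, c, e}. \<bar>x\<bar> \<noteq> \<bar>y\<bar>"
  then have "sswap a b x = x" "sswap c e x = x" by (auto intro: sswap_other)
  then show "((sswap a b \<circ> sswap c e) ^^ 2) x = x" by (simp only: funpow_small comp_apply)
qed

text \<open>The index is shifted by one against \<open>B_act\<close>, so that the same statement
  serves \<open>D_act\<close> with \<open>n\<close> and \<open>B_act\<close> with
  \<open>n - 1\<close>.\<close>

lemma sswap_chain_rel:
  assumes d: "0 \<le> d" and ij: "i \<le> n" "j \<le> n"
  defines "s \<equiv> \<lambda>i. sswap (d + int n - int i + 1) (d + int n - int i + 2)"
  shows "j = i + 1 \<or> i = j + 1 \<Longrightarrow> (s i \<circ> s j) ^^ 3 = id"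
    and "i \<noteq> j \<Longrightarrow> j \<noteq> i + 1 \<Longrightarrow> i \<noteq> j + 1 \<Longrightarrow> (s i \<circ> s j) ^^ 2 = id"
proof -
  let ?a = "\<lambda>i. d + int n - int i + 1"
  show "(s i \<circ> s j) ^^ 3 = id" if "j = i + 1 \<or> i = j + 1"
    using that
  proof
    assume "j = i + 1"
    then show ?thesis
      using sswap_braid(2)[of "?a j" "?a j + 1" "?a j + 2"] d ij by (simp add: s_def algebra_simps)
  next
    assume "i = j + 1"
    then show ?thesis
      using sswap_braid(1)[of "?a i" "?a i + 1" "?a i + 2"] d ij by (simp add: s_def algebra_simps)
  qed
  show "(s i \<circ> s j) ^^ 2 = id" if "i \<noteq> j" "j \<noteq> i + 1" "i \<noteq> j + 1"
    unfolding s_def using that d ij by (intro sswap_commute) auto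
qed

text \<open>Together with faithfulness of the action of A_N this yields the homomorphisms into type
  A.\<close>

lemma B_act_rel:
  assumes i: "i \<in> {1..n}" and j: "j \<in> {1..n}"
  shows "(B_act 0 n i \<circ> B_act 0 n j) ^^ snd (cox_B n) i j = id"
proof -
  let ?s = "\<lambda>i. sswap (int n - int i) (int n - int i + 1)"
  define t :: "int \<Rightarrow> int" where "t = (\<lambda>x. if \<bar>x\<bar> \<le> 1 then - x else x)"
  have lt: "B_act 0 n k = ?s k" if "k < n" for k using that by (simp add: B_act_def)
  have eq: "B_act 0 n n = t" by (simp add: B_act_def t_def)
  have t4: "((?s k \<circ> t) ^^ 4) x = x \<and> ((t \<circ> ?s k) ^^ 4) x = x" if "n = k + 1" for k x
  proof -
    have k: "?s k = sswap 1 2" using that by simp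
    have tab: "sswap 1 2 1 = 2" "sswap 1 2 2 = 1" "sswap 1 2 0 = 0" "sswap 1 2 (- 1) = - 2"
      "sswap 1 2 (- 2) = - 1" "t 0 = 0" "t 1 = - 1" "t (- 1) = 1" "t 2 = 2" "t (- 2) = - 2"
      by (simp_all add: sswap_def t_def)
    consider "x = - 2" | "x = - 1" | "x = 0" | "x = 1" | "x = 2" | "\<bar>x\<bar> > 2" by linarith
    then show ?thesis
    proof cases
      case 6
      then have "sswap 1 2 x = x" "t x = x" by (auto simp: sswap_def t_def)
      then show ?thesis unfolding k funpow_small by simp
    qed (simp_all add: k funpow_small tab)
  qed
  have t2: "((?s k \<circ> t) ^^ 2) x = x \<and> ((t \<circ> ?s k) ^^ 2) x = x" if "k + 1 < n" for k x
  proof -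
    have s: "?s k y = y" if "\<bar>y\<bar> \<le> 1" for y
      using that \<open>k + 1 < n\<close> by (intro sswap_other) auto
    have s': "\<bar>?s k y\<bar> > 1" if "\<bar>y\<bar> > 1" for y
      using that \<open>k + 1 < n\<close> by (auto simp: sswap_def)
    have ss: "?s k (?s k y) = y" for y
      using \<open>k + 1 < n\<close> by (intro sswap_invol) auto
    show ?thesis
    proof (cases "\<bar>x\<bar> \<le> 1")
      case True
      then have "t x = - x" "t (- x) = x" "?s k x = x" "?s k (- x) = - x"
        using s[of x] s[of "- x"] by (auto simp: t_def)
      then show ?thesis by (simp add: funpow_small)
    next
      case False
      then have "t x = x" "t (?s k x) = ?s k x" using s'[of x] by (auto simp: t_def)
      then show ?thesis using ss[of x] by (simp add: funpow_small)
    qed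
  qed
  have t4_id: "(?s k \<circ> t) ^^ 4 = id" "(t \<circ> ?s k) ^^ 4 = id" if "n = k + 1" for k
    using t4[OF that] by (auto simp only: fun_eq_iff id_apply)
  have t2_id: "(?s k \<circ> t) ^^ 2 = id" "(t \<circ> ?s k) ^^ 2 = id" if "k + 1 < n" for k
    using t2[OF that] by (auto simp only: fun_eq_iff id_apply)
  consider "i = j" | "i < n" "j < n" "j = i + 1 \<or> i = j + 1"
    | "i < n" "j < n" "i \<noteq> j" "j \<noteq> i + 1" "i \<noteq> j + 1"
    | "i = n" "n = j + 1" | "j = n" "n = i + 1" | "i = n" "j + 1 < n" | "j = n" "i + 1 < n"
    using i j by (auto, linarith)
  then show ?thesis
  proof cases
    case 1
    then show ?thesis by (simp add: cox_B_def fun_eq_iff B_act_invol)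
  next
    case 2
    have "(?s i \<circ> ?s j) ^^ 3 = id"
      using sswap_chain_rel(1)[of 0 i "n - 1" j] 2 i j by (simp add: of_nat_diff algebra_simps)
    moreover have "snd (cox_B n) i j = 3" using 2 by (auto simp: cox_B_def)
    ultimately show ?thesis using 2 lt by simp
  next
    case 3
    have "(?s i \<circ> ?s j) ^^ 2 = id"
      using sswap_chain_rel(2)[of 0 i "n - 1" j] 3 i j by (simp add: of_nat_diff algebra_simps)
    moreover have "snd (cox_B n) i j = 2" using 3 by (auto simp: cox_B_def)
    ultimately show ?thesis using 3 lt by simp
  next
    case 4
    then have "snd (cox_B n) i j = 4" by (auto simp: cox_B_def)
    moreover have "j < n" using 4 by simp
    ultimately show ?thesis using t4_id(2)[OF 4(2)] lt[of j] eq 4(1) by (simp only:)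
  next
    case 5
    then have "snd (cox_B n) i j = 4" by (auto simp: cox_B_def)
    moreover have "i < n" using 5 by simp
    ultimately show ?thesis using t4_id(1)[OF 5(2)] lt[of i] eq 5(1) by (simp only:)
  next
    case 6
    then have "snd (cox_B n) i j = 2" by (auto simp: cox_B_def)
    moreover have "j < n" using 6 by simp
    ultimately show ?thesis using t2_id(2)[OF 6(2)] lt[of j] eq 6(1) by (simp only:)
  next
    case 7
    then have "snd (cox_B n) i j = 2" by (auto simp: cox_B_def)
    moreover have "i < n" using 7 by simp
    ultimately show ?thesis using t2_id(1)[OF 7(2)] lt[of i] eq 7(1) by (simp only:)
  qed
qed

section \<open>Verification of the folding data in types A and D\<close>

lemma card_inversions_B_act:
  assumes "0 \<le> d" "i \<in> {1..<n}"
  defines "a \<equiv> d + int n - int i"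
  assumes "(a, a + 1) \<in> P" "(- a - 1, - a) \<in> P"
  shows "card (inversions P (B_act d n i)) = 2"
proof -
  have "a > 0" using assms(1,2) by (auto simp: a_def)
  have "inversions P (B_act d n i) = {(a, a + 1), (- a - 1, - a)}"
  proof (intro equalityI subrelI)
    fix x y assume "(x, y) \<in> inversions P (B_act d n i)"
    then show "(x, y) \<in> {(a, a + 1), (- a - 1, - a)}"
      using B_act_small_inversion[of d i n x y P] assms(1,2) by (auto simp: a_def)
  next
    fix x y assume "(x, y) \<in> {(a, a + 1), (- a - 1, - a)}"
    then show "(x, y) \<in> inversions P (B_act d n i)"
      using \<open>a > 0\<close> assms(2,4,5) by (auto simp: inversions_def B_act_def sswap_def a_def[symmetric])
  qed
  then show ?thesis using \<open>a > 0\<close> by simp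
qed

lemma inversions_B_act_last:
  "0 \<le> d \<Longrightarrow> inversions P (B_act d n n) =
    {(x, y) \<in> P. x \<in> {- (d + 1)..d + 1} \<and> y \<in> {- (d + 1)..d + 1} \<and> x < y}"
  by (auto simp: inversions_def B_act_def split: if_splits)

text \<open>With the labels -n, ..., -1, 1, ..., n the product \<open>s_i s_(2n-i)\<close> exchanges
  two neighbouring labels and also their negatives, and \<open>s_n\<close> exchanges -1 and
  1.\<close>

lemma A_odd_folding:
  assumes n: "n \<ge> 1"
  defines "p \<equiv> \<lambda>k. if k \<le> n then int k - int n - 1 else int k - int n"
    and "g \<equiv> \<lambda>i. if i \<noteq> n then [i, 2 * n - i] else [n]"
  shows "A_model (2 * n - 1) p"
    and "B_folding (p ` {1..2 * n} \<times> p ` {1..2 * n}) (cox_A (2 * n - 1))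
      (\<lambda>i. transpose (p i) (p (i + 1))) 1 n 0 g 2 1"
proof -
  show A: "A_model (2 * n - 1) p" by unfold_locales (auto simp: p_def)
  interpret A_model "2 * n - 1" p by (rule A)
  have N: "2 * n - 1 + 1 = 2 * n" using n by simp
  have E: "p ` {1..2 * n} = {- int n..int n} - {0}"
  proof (intro equalityI subsetI)
    fix x assume x: "x \<in> {- int n..int n} - {0}"
    show "x \<in> p ` {1..2 * n}"
    proof (cases "x < 0")
      case True
      then show ?thesis using x by (intro image_eqI[of _ _ "nat (x + int n + 1)"]) (auto simp: p_def)
    next
      case False
      then show ?thesis using x by (intro image_eqI[of _ _ "nat (x + int n)"]) (auto simp: p_def)
    qed
  qed (auto simp: p_def)
  note ca = cox_action_axioms[unfolded N]
  show "B_folding (p ` {1..2 * n} \<times> p ` {1..2 * n}) (cox_A (2 * n - 1))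
      (\<lambda>i. transpose (p i) (p (i + 1))) 1 n 0 g 2 1"
  proof (rule B_folding.intro[OF ca], unfold_locales)
    fix i assume i: "i \<in> {1..n}"
    show "g i \<in> lists (fst (cox_A (2 * n - 1)))" using i by (auto simp: g_def)
    show "length (g i) = (if i < n then 2 else 1)" using i by (auto simp: g_def)
    show "foldr (\<lambda>i. transpose (p i) (p (i + 1))) (g i) = B_act 0 n i"
    proof (cases "i < n")
      case True
      have "p i = - (int n - int i + 1)" "p (i + 1) = - (int n - int i)"
        "p (2 * n - i) = int n - int i" "p (2 * n - i + 1) = int n - int i + 1"
        using True i by (auto simp: p_def)
      then show ?thesis using True by (auto simp: g_def B_act_def fun_eq_iff sswap_def transpose_def)
    next
      case False
      then have "i = n" "p n = - 1" "p (n + 1) = 1" using i by (auto simp: p_def)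
      then show ?thesis by (auto simp: g_def B_act_def fun_eq_iff transpose_def)
    qed
    show "card (inversions (p ` {1..2 * n} \<times> p ` {1..2 * n}) (B_act 0 n i)) = 1 * length (g i)"
    proof (cases "i < n")
      case True
      then show ?thesis using i unfolding E
        by (subst card_inversions_B_act) (auto simp: g_def)
    next
      case False
      then have "i = n" using i by simp
      have "inversions (({- int n..int n} - {0}) \<times> ({- int n..int n} - {0})) (B_act 0 n n) = {(-1, 1)}"
        using n by (subst inversions_B_act_last) auto
      then show ?thesis using \<open>i = n\<close> unfolding E by (simp add: g_def)
    qed
  qed (use n in auto)
qed

text \<open>The middle point now has label 0, and \<open>s_n s_(n+1) s_n\<close> exchanges -1 and 1
  around it. It inverts three pairs, as many as it has letters; hence the weight 3.\<close>

lemma A_even_folding: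
  assumes n: "n \<ge> 1"
  defines "p \<equiv> \<lambda>k. int k - int n - 1"
    and "g \<equiv> \<lambda>i. if i \<noteq> n then [i, 2 * n + 1 - i] else [n, n + 1, n]"
  shows "A_model (2 * n) p"
    and "B_folding (p ` {1..2 * n + 1} \<times> p ` {1..2 * n + 1}) (cox_A (2 * n))
      (\<lambda>i. transpose (p i) (p (i + 1))) 1 n 0 g 2 3"
proof -
  show A: "A_model (2 * n) p" by unfold_locales (auto simp: p_def)
  interpret A_model "2 * n" p by (rule A)
  have E: "p ` {1..2 * n + 1} = {- int n..int n}"
  proof (intro equalityI subsetI)
    fix x assume x: "x \<in> {- int n..int n}"
    then show "x \<in> p ` {1..2 * n + 1}"
      by (intro image_eqI[of _ _ "nat (x + int n + 1)"]) (auto simp: p_def)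
  qed (auto simp: p_def)
  show "B_folding (p ` {1..2 * n + 1} \<times> p ` {1..2 * n + 1}) (cox_A (2 * n))
      (\<lambda>i. transpose (p i) (p (i + 1))) 1 n 0 g 2 3"
  proof (rule B_folding.intro[OF cox_action_axioms], unfold_locales)
    fix i assume i: "i \<in> {1..n}"
    show "g i \<in> lists (fst (cox_A (2 * n)))" using i by (auto simp: g_def)
    show "length (g i) = (if i < n then 2 else 3)" using i by (auto simp: g_def)
    show "foldr (\<lambda>i. transpose (p i) (p (i + 1))) (g i) = B_act 0 n i"
    proof (cases "i < n")
      case True
      have "p i = - (int n - int i + 1)" "p (i + 1) = - (int n - int i)"
        "p (2 * n + 1 - i) = int n - int i" "p (2 * n + 1 - i + 1) = int n - int i + 1"
        using True i by (auto simp: p_def)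
      then show ?thesis using True by (auto simp: g_def B_act_def fun_eq_iff sswap_def transpose_def)
    next
      case False
      then have "i = n" "p n = - 1" "p (n + 1) = 0" "p (n + 1 + 1) = 1" using i by (auto simp: p_def)
      then show ?thesis by (auto simp: g_def B_act_def fun_eq_iff transpose_def)
    qed
    show "card (inversions (p ` {1..2 * n + 1} \<times> p ` {1..2 * n + 1}) (B_act 0 n i)) = 1 * length (g i)"
    proof (cases "i < n")
      case True
      then show ?thesis using i unfolding E
        by (subst card_inversions_B_act) (auto simp: g_def)
    next
      case False
      then have "i = n" using i by simp
      have "inversions ({- int n..int n} \<times> {- int n..int n}) (B_act 0 n n) = {(-1, 0), (-1, 1), (0, 1)}"
        using n by (subst inversions_B_act_last) auto
      then show ?thesis using \<open>i = n\<close> unfolding E by (simp add: g_def)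
    qed
  qed (use n in auto)
qed

text \<open>The relators of B_n become words acting as the identity, and faithfulness makes these
  words trivial in A_N.\<close>

lemma B_to_A_exists:
  assumes "A_model N p" and "B_folding P (cox_A N) (\<lambda>i. transpose (p i) (p (i + 1))) c n 0 g a b"
    and f: "\<And>i. i \<in> {1..n} \<Longrightarrow> f i = cox_prod (cox_A N) (g i)"
  shows "\<exists>\<phi>. extends_gens (cox_B n) (cox_A N) f \<phi>"
proof -
  interpret B: B_folding P "cox_A N" "\<lambda>i. transpose (p i) (p (i + 1))" c n 0 g a b by fact
  show ?thesis
  proof (rule extends_gens_exists[where g = g])
    fix i j assume "i \<in> fst (cox_B n)" "j \<in> fst (cox_B n)"
    then have ij: "i \<in> {1..n}" "j \<in> {1..n}" by simp_all
    then have l: "g i \<in> lists {1..N}" "g j \<in> lists {1..N}" using B.g_lists by auto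
    have "foldr (\<lambda>i. transpose (p i) (p (i + 1))) (g i @ g j) = B_act 0 n i \<circ> B_act 0 n j"
      using B.g_act ij by (simp add: fun_eq_iff)
    then have "foldr (\<lambda>i. transpose (p i) (p (i + 1)))
        (concat (replicate (snd (cox_B n) i j) (g i @ g j))) = id"
      using B_act_rel[OF ij] by (simp only: foldr_concat_replicate)
    then show "cox_eq (cox_A N) (concat (replicate (snd (cox_B n) i j) (g i @ g j))) []"
      using l by (intro A_model.faithful[OF assms(1)]) (auto simp: in_lists_conv_set)
  qed (use B.g_lists f cox_A_datum cox_B_datum in auto)
qed

lemma cox_D_set [simp]: "fst (cox_D N) = {1..N}"
  by (simp add: cox_D_def)

lemma cox_D_datum: "cox_datum (cox_D N)"
  by (simp add: cox_datum_def cox_D_def)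

text \<open>The pairs \<open>(x, - x)\<close> are left out because sign changes do not contribute to lengths in type D.\<close>

definition D_pairs :: "nat \<Rightarrow> (int \<times> int) set" where
  "D_pairs n = {(x, y) \<in> ({- int n..int n} - {0}) \<times> ({- int n..int n} - {0}). x \<noteq> - y}"

text \<open>The usual even-signed permutations with coordinates numbered backwards:
  \<open>s_n\<close> and \<open>s_(n+1)\<close> are the reflections in \<open>e_1 - e_2\<close> and
  \<open>e_1 + e_2\<close>.\<close>

definition D_act :: "nat \<Rightarrow> nat \<Rightarrow> int \<Rightarrow> int" where
  "D_act n i = (if i \<le> n then sswap (int n - int i + 1) (int n - int i + 2) else sswap 1 (- 2))"

lemma D_act_rel:
  assumes n: "n \<ge> 2" and ij: "i \<in> {1..n + 1}" "j \<in> {1..n + 1}"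
  shows "(D_act n i \<circ> D_act n j) ^^ snd (cox_D (n + 1)) i j = id"
proof -
  let ?t = "sswap 1 (- 2)"
  \<comment> \<open>In this form the last generator shares the entry 2 with \<open>s_(n-1)\<close>,
    which is \<open>sswap 2 3\<close>, as \<open>sswap_braid\<close> requires.\<close>
  have t: "?t = sswap (- 1) 2" by (auto simp: fun_eq_iff sswap_def)
  have lt: "D_act n k = sswap (int n - int k + 1) (int n - int k + 2)" if "k \<le> n" for k
    using that by (simp add: D_act_def)
  have last: "D_act n (n + 1) = ?t" by (simp add: D_act_def)
  have t3: "(D_act n k \<circ> ?t) ^^ 3 = id" "(?t \<circ> D_act n k) ^^ 3 = id" if "k + 1 = n" for k
  proof -
    have "D_act n k = sswap 2 3" using lt[of k] that[symmetric] by simp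
    then show "(D_act n k \<circ> ?t) ^^ 3 = id" "(?t \<circ> D_act n k) ^^ 3 = id"
      unfolding t using sswap_braid[of "- 1" 2 3] by simp_all
  qed
  have t2: "(D_act n k \<circ> ?t) ^^ 2 = id" "(?t \<circ> D_act n k) ^^ 2 = id" if "k \<le> n" "k + 1 \<noteq> n" for k
  proof -
    have "D_act n k (?t x) = ?t (D_act n k x)" for x
    proof (cases "k = n")
      case True
      then have "D_act n k = sswap 1 2" using lt[of k] by simp
      then show ?thesis by (simp add: sswap_def)
    next
      case False
      then have "((D_act n k \<circ> ?t) ^^ 2) x = x"
        unfolding lt[OF that(1)] using that by (subst sswap_commute) auto
      then have "D_act n k (D_act n k (?t (D_act n k (?t (?t x))))) = D_act n k (?t x)"
        using fun_cong[OF sswap_commute[of "int n - int k + 1" "int n - int k + 2" 1 "- 2"], of "?t x"]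
          that False unfolding lt[OF that(1)] by (simp add: funpow_small)
      moreover have "D_act n k (D_act n k y) = y" "?t (?t y) = y" for y
        using that(1) by (simp_all add: lt sswap_invol)
      ultimately show ?thesis by simp
    qed
    moreover have "D_act n k (D_act n k y) = y" "?t (?t y) = y" for y
      using that(1) by (simp_all add: lt sswap_invol)
    ultimately show "(D_act n k \<circ> ?t) ^^ 2 = id" "(?t \<circ> D_act n k) ^^ 2 = id"
      by (simp_all add: fun_eq_iff funpow_small)
  qed
  have m: "snd (cox_D (n + 1)) i j = (if i = j then 1
      else if max i j \<le> n \<and> (j = i + 1 \<or> i = j + 1) \<or> max i j = n + 1 \<and> n = min i j + 1 then 3 else 2)"
    by (auto simp: cox_D_def max_def min_def)
  consider "i = j" | "i \<le> n" "j \<le> n" "j = i + 1 \<or> i = j + 1"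
    | "i \<le> n" "j \<le> n" "i \<noteq> j" "j \<noteq> i + 1" "i \<noteq> j + 1"
    | "i = n + 1" "j + 1 = n" | "j = n + 1" "i + 1 = n"
    | "i = n + 1" "j \<le> n" "j + 1 \<noteq> n" | "j = n + 1" "i \<le> n" "i + 1 \<noteq> n"
    using ij by (auto simp: le_Suc_eq)
  then show ?thesis
  proof cases
    case 1
    have "D_act n j (D_act n j x) = x" for x
      by (auto simp: D_act_def intro!: sswap_invol)
    then show ?thesis using 1 m by (simp add: fun_eq_iff)
  next
    case 2
    then have "snd (cox_D (n + 1)) i j = 3" unfolding m by auto
    then show ?thesis
      using sswap_chain_rel(1)[of 0 i n j] 2 by (simp only: lt) simp
  next
    case 3
    then have "snd (cox_D (n + 1)) i j = 2" unfolding m by auto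
    then show ?thesis
      using sswap_chain_rel(2)[of 0 i n j] 3 by (simp only: lt) simp
  next
    case 4
    then have "snd (cox_D (n + 1)) i j = 3" unfolding m by (auto simp: max_def min_def)
    then show ?thesis using t3(2)[OF 4(2)] 4(1) last by (simp only:)
  next
    case 5
    then have "snd (cox_D (n + 1)) i j = 3" unfolding m by (auto simp: max_def min_def)
    then show ?thesis using t3(1)[OF 5(2)] 5(1) last by (simp only:)
  next
    case 6
    then have "snd (cox_D (n + 1)) i j = 2" unfolding m by (auto simp: max_def min_def)
    then show ?thesis using t2(2)[OF 6(2,3)] 6(1) last by (simp only:)
  next
    case 7
    then have "snd (cox_D (n + 1)) i j = 2" unfolding m by (auto simp: max_def min_def)
    then show ?thesis using t2(1)[OF 7(2,3)] 7(1) last by (simp only:)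
  qed
qed

lemma sswap_range:
  "a \<in> E \<Longrightarrow> b \<in> E \<Longrightarrow> x \<in> E \<Longrightarrow> (\<And>e. e \<in> E \<Longrightarrow> - e \<in> E) \<Longrightarrow> sswap a b x \<in> E"
  by (simp add: sswap_def)

lemma D_action:
  assumes n: "n \<ge> 2"
  shows "cox_action (D_pairs (n + 1)) (cox_D (n + 1)) (D_act n) 2"
proof -
  interpret int_action "D_pairs (n + 1)"
  proof
    show "finite (D_pairs (n + 1))"
      by (rule finite_subset[of _ "{- int (n + 1)..int (n + 1)} \<times> {- int (n + 1)..int (n + 1)}"])
        (auto simp: D_pairs_def)
  qed (auto simp: D_pairs_def)
  show ?thesis
  proof
    fix i assume "i \<in> fst (cox_D (n + 1))"
    then have i: "1 \<le> i" "i \<le> n + 1" by auto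
    have invol: "D_act n i (D_act n i x) = x" for x
      by (auto simp: D_act_def intro!: sswap_invol)
    have neg: "D_act n i (- x) = - D_act n i x" for x
      by (auto simp: D_act_def intro!: sswap_neg)
    have ran: "D_act n i x \<in> {- int (n + 1)..int (n + 1)} - {0}"
      if "x \<in> {- int (n + 1)..int (n + 1)} - {0}" for x
    proof -
      let ?E = "{- int (n + 1)..int (n + 1)} - {0 :: int}"
      have E: "- e \<in> ?E" if "e \<in> ?E" for e using that by auto
      show ?thesis
      proof (cases "i \<le> n")
        case True
        have "sswap (int n - int i + 1) (int n - int i + 2) x \<in> ?E"
          by (rule sswap_range[OF _ _ that E]) (use True i in auto)
        then show ?thesis using True by (simp add: D_act_def)
      next
        case False
        have "sswap 1 (- 2) x \<in> ?E"
          by (rule sswap_range[OF _ _ that E]) (use n in auto)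
        then show ?thesis using False by (simp add: D_act_def)
      qed
    qed
    show "preserving (D_act n i)"
      unfolding preserving_def
    proof (intro conjI allI impI)
      fix x y assume xy: "(x, y) \<in> D_pairs (n + 1)"
      have "D_act n i x \<noteq> - D_act n i y"
      proof
        assume "D_act n i x = - D_act n i y"
        then have "D_act n i (D_act n i x) = D_act n i (D_act n i (- y))" by (simp add: neg)
        then show False using xy by (simp add: invol D_pairs_def)
      qed
      then show "(D_act n i x, D_act n i y) \<in> D_pairs (n + 1)"
        using xy ran[of x] ran[of y] by (simp add: D_pairs_def)
    qed (rule invol)
    show "card (inversions (D_pairs (n + 1)) (D_act n i)) \<le> 2"
    proof (cases "i \<le> n")
      case True
      let ?a = "int n - int i + 1"
      have "D_act n i = B_act 0 (n + 1) i" using True by (simp add: D_act_def B_act_def algebra_simps)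
      then have sub: "inversions (D_pairs (n + 1)) (D_act n i) \<subseteq> {(?a, ?a + 1), (- ?a - 1, - ?a)}"
        using B_act_small_inversion[of 0 i "n + 1" _ _ "D_pairs (n + 1)"] True by fastforce
      have two: "card {u, v} \<le> 2" for u v :: "int \<times> int" by (simp add: card_insert_if)
      show ?thesis by (rule order_trans[OF card_mono[OF _ sub] two]) simp
    next
      case False
      have "inversions (D_pairs (n + 1)) (D_act n i) \<subseteq> {(- 1, 2), (- 2, 1)}"
      proof (rule subrelI)
        fix x y assume "(x, y) \<in> inversions (D_pairs (n + 1)) (D_act n i)"
        then have xy: "x < y" "sswap 1 (- 2) y < sswap 1 (- 2) x" "x \<noteq> 0" "y \<noteq> 0" "x \<noteq> - y"
          using False by (auto simp: inversions_def D_pairs_def D_act_def)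
        have val: "sswap 1 (- 2) 1 = - 2" "sswap 1 (- 2) 2 = - 1" "sswap 1 (- 2) (- 1) = 2"
          "sswap 1 (- 2) (- 2) = 1" by (simp_all add: sswap_def)
        have big: "sswap 1 (- 2) z = z" if "\<bar>z\<bar> > 2" for z
          using that by (intro sswap_other) auto
        have small: "z \<in> {- 2, - 1, 0, 1, 2}" if "\<bar>z\<bar> \<le> 2" for z :: int
          using that by auto
        have bound: "\<bar>sswap 1 (- 2) z\<bar> \<le> 2" if "\<bar>z\<bar> \<le> 2" for z
          using small[OF that] by (auto simp: sswap_def)
        have "\<bar>x\<bar> \<le> 2" using big[of x] big[of y] bound[of y] xy by linarith
        moreover have "\<bar>y\<bar> \<le> 2" using big[of x] big[of y] bound[of x] xy by linarith
        ultimately have "x \<in> {- 2, - 1, 1, 2}" "y \<in> {- 2, - 1, 1, 2}"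
          using small[of x] small[of y] xy by auto
        then show "(x, y) \<in> {(- 1, 2), (- 2, 1)}" using xy by (auto simp: val)
      qed
      from card_mono[OF _ this] show ?thesis by simp
    qed
  next
    show "(D_act n i \<circ> D_act n j) ^^ snd (cox_D (n + 1)) i j = id"
      if "i \<in> fst (cox_D (n + 1))" "j \<in> fst (cox_D (n + 1))" for i j
      using D_act_rel[OF n, of i j] that by simp
  qed (simp_all add: cox_D_datum)
qed

text \<open>The product of the two commuting reflections negates 1 and 2. Without the pairs
  \<open>(x, - x)\<close> this inverts four pairs, twice its number of letters.\<close>

lemma D_folding:
  assumes n: "n \<ge> 2"
  shows "B_folding (D_pairs (n + 1)) (cox_D (n + 1)) (D_act n) 2 n 1
    (\<lambda>i. if i \<noteq> n then [i] else [n, n + 1]) 1 2"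
proof (rule B_folding.intro[OF D_action[OF n]], unfold_locales)
  fix i assume i: "i \<in> {1..n}"
  let ?g = "if i \<noteq> n then [i] else [n, n + 1]"
  show "?g \<in> lists (fst (cox_D (n + 1)))" using i by auto
  show "length ?g = (if i < n then 1 else 2)" using i by auto
  show "foldr (D_act n) ?g = B_act 1 n i"
  proof (cases "i < n")
    case True
    then show ?thesis by (auto simp: D_act_def B_act_def fun_eq_iff algebra_simps)
  next
    case False
    then have "i = n" using i by simp
    then show ?thesis by (auto simp: D_act_def B_act_def fun_eq_iff sswap_def)
  qed
  show "card (inversions (D_pairs (n + 1)) (B_act 1 n i)) = 2 * length ?g"
  proof (cases "i < n")
    case True
    then show ?thesis using i
      by (subst card_inversions_B_act) (auto simp: D_pairs_def)
  next
    case False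
    then have "i = n" using i by simp
    have "inversions (D_pairs (n + 1)) (B_act 1 n n) = {(-2, -1), (-2, 1), (-1, 2), (1, 2)}"
      using n by (subst inversions_B_act_last) (auto simp: D_pairs_def)
    then show ?thesis using \<open>i = n\<close> by simp
  qed
qed (use n in \<open>auto simp: D_pairs_def\<close>)

text \<open>With \<open>x\<close> the middle node of a diagram of type A_3, \<open>x y z\<close> is
  a Coxeter element. Its square equals its own reversal, that is, its own inverse.\<close>

lemma cox_eq_pow4:
  assumes X: "cox_datum X" and S: "x \<in> fst X" "y \<in> fst X" "z \<in> fst X"
    and M: "snd X x y = 3" "snd X x z = 3" "snd X y z = 2"
  shows "cox_eq X (concat (replicate 4 [x, y, z])) []"
    and "cox_eq X (concat (replicate 4 [y, z, x])) []"
proof -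
  let ?E = "cox_eq X"
  note sub = cox_eq_subword[where X = X]
  have yz: "?E [y, z] [z, y]" by (rule cox_eq_commute[OF X S(2,3) M(3)])
  have xy: "?E [x, y, x] [y, x, y]" by (rule cox_eq_braid3[OF X S(1,2) M(1)])
  have xz: "?E [x, z, x] [z, x, z]" by (rule cox_eq_braid3[OF X S(1,3) M(2)])
  have "?E [x, y, z, x, y, z] [x, y, z, x, z, y]" using sub[OF yz, of "[x, y, z, x]" "[]"] by simp
  also have "?E [x, y, z, x, z, y] [x, y, x, z, x, y]"
    using sub[OF cox_eq_sym[OF xz], of "[x, y]" "[y]"] by simp
  also have "?E [x, y, x, z, x, y] [y, x, y, z, x, y]" using sub[OF xy, of "[]" "[z, x, y]"] by simp
  also have "?E [y, x, y, z, x, y] [y, x, z, y, x, y]" using sub[OF yz, of "[y, x]" "[x, y]"] by simp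
  also have "?E [y, x, z, y, x, y] [y, x, z, x, y, x]"
    using sub[OF cox_eq_sym[OF xy], of "[y, x, z]" "[]"] by simp
  also have "?E [y, x, z, x, y, x] [y, z, x, z, y, x]" using sub[OF xz, of "[y]" "[y, x]"] by simp
  finally have half: "?E [x, y, z, x, y, z] [y, z, x, z, y, x]" .
  also have "?E [y, z, x, z, y, x] [y, z, x, y, z, x]"
    using sub[OF cox_eq_sym[OF yz], of "[y, z, x]" "[x]"] by simp
  finally have half': "?E [x, y, z, x, y, z] [y, z, x, y, z, x]" .
  have "?E [y, z, x, y, z, x] [z, y, x, y, z, x]" using sub[OF yz, of "[]" "[x, y, z, x]"] by simp
  also have "?E [z, y, x, y, z, x] [z, y, x, z, y, x]" using sub[OF yz, of "[z, y, x]" "[x]"] by simp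
  finally have rv: "?E [x, y, z, x, y, z] (rev [x, y, z, x, y, z])"
    using cox_eq_trans[OF half'] by simp
  have "?E ([x, y, z, x, y, z] @ [x, y, z, x, y, z]) ([x, y, z, x, y, z] @ rev [x, y, z, x, y, z])"
    by (intro cox_eq_append cox_eq_refl rv)
  also have "?E ([x, y, z, x, y, z] @ rev [x, y, z, x, y, z]) []"
    by (rule cox_eq_inverse[OF X]) (use S in auto)
  finally have one: "?E ([x, y, z, x, y, z] @ [x, y, z, x, y, z]) []" .
  then show "cox_eq X (concat (replicate 4 [x, y, z])) []" by (simp add: numeral_eq_Suc)
  \<comment> \<open>By \<open>half'\<close> the squares of \<open>x y z\<close> and
    \<open>y z x\<close> agree, so the second claim follows from the first.\<close>
  have "?E ([y, z, x, y, z, x] @ [y, z, x, y, z, x]) ([x, y, z, x, y, z] @ [x, y, z, x, y, z])"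
    by (intro cox_eq_append cox_eq_sym[OF half'])
  from cox_eq_trans[OF this one]
  show "cox_eq X (concat (replicate 4 [y, z, x])) []" by (simp add: numeral_eq_Suc)
qed

text \<open>Relators without \<open>r_n\<close> are relators of D_(n+1). The square of
  \<open>r_n\<close> becomes the commutation relator of \<open>s_n\<close> and
  \<open>s_(n+1)\<close>, its relator with \<open>r_(n-1)\<close> is \<open>cox_eq_pow4\<close>, and
  the remaining ones are commutations.\<close>

lemma B_to_D_exists:
  assumes n: "n \<ge> 2"
    and f: "\<And>i. i \<in> {1..n} \<Longrightarrow> f i = cox_prod (cox_D (n + 1)) (if i \<noteq> n then [i] else [n, n + 1])"
  shows "\<exists>\<phi>. extends_gens (cox_B n) (cox_D (n + 1)) f \<phi>"
proof (rule extends_gens_exists[where g = "\<lambda>i. if i \<noteq> n then [i] else [n, n + 1]"])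
  let ?X = "cox_D (n + 1)"
  note X = cox_D_datum[of "n + 1"]
  fix i j assume "i \<in> fst (cox_B n)" "j \<in> fst (cox_B n)"
  then have ij: "1 \<le> i" "i \<le> n" "1 \<le> j" "j \<le> n" by simp_all
  have comm: "cox_eq ?X (concat (replicate 2 [k, n, n + 1])) []"
    "cox_eq ?X (concat (replicate 2 [n, n + 1, k])) []" if k: "1 \<le> k" "k + 1 < n" for k
  proof -
    have c: "cox_eq ?X (k # [n, n + 1]) ([n, n + 1] @ [k])"
      by (rule cox_eq_commute_word[OF X]) (use k in \<open>auto simp: cox_D_def\<close>)
    have c': "cox_eq ?X [n, n + 1] [n + 1, n]"
      by (rule cox_eq_commute[OF X]) (use n in \<open>auto simp: cox_D_def\<close>)
    have r: "cox_eq ?X ([n + 1, n] @ [n, n + 1]) []"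
      using cox_eq_inverse[OF X, of "[n + 1, n]"] n by simp
    have r': "cox_eq ?X ([n, n + 1] @ [n, n + 1]) []"
      using cox_eq_trans[OF cox_eq_append[OF c' cox_eq_refl] r] .
    have kk: "cox_eq ?X [k, k] []" using k by (intro cox_eq_square X) auto
    have "cox_eq ?X ((k # [n, n + 1]) @ [k, n, n + 1]) (([n, n + 1] @ [k]) @ [k, n, n + 1])"
      by (intro cox_eq_append c cox_eq_refl)
    also have "cox_eq ?X (([n, n + 1] @ [k]) @ [k, n, n + 1]) ([n, n + 1] @ [n, n + 1])"
      using cox_eq_subword[OF kk, of "[n, n + 1]" "[n, n + 1]"] by simp
    also note r'
    finally show "cox_eq ?X (concat (replicate 2 [k, n, n + 1])) []" by (simp add: numeral_eq_Suc)
    have "cox_eq ?X ([n, n + 1, k] @ ([n, n + 1] @ [k])) ([n, n + 1, k] @ (k # [n, n + 1]))"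
      by (intro cox_eq_append cox_eq_sym[OF c] cox_eq_refl)
    also have "cox_eq ?X ([n, n + 1, k] @ (k # [n, n + 1])) ([n, n + 1] @ [n, n + 1])"
      using cox_eq_subword[OF kk, of "[n, n + 1]" "[n, n + 1]"] by simp
    also note r'
    finally show "cox_eq ?X (concat (replicate 2 [n, n + 1, k])) []" by (simp add: numeral_eq_Suc)
  qed
  consider "i = n" "j = n" | "i < n" "j < n" | "i + 1 = n" "j = n" | "i = n" "j + 1 = n"
    | "i + 1 < n" "j = n" | "i = n" "j + 1 < n" using ij by linarith
  then show "cox_eq ?X (concat (replicate (snd (cox_B n) i j)
      ((if i \<noteq> n then [i] else [n, n + 1]) @ (if j \<noteq> n then [j] else [n, n + 1])))) []"
  proof cases
    case 1
    have "cox_eq ?X (concat (replicate (snd ?X n (n + 1)) [n, n + 1])) []"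
      using n by (intro cox_eq_relator) auto
    moreover have "snd ?X n (n + 1) = 2" by (simp add: cox_D_def)
    ultimately show ?thesis using 1 by (simp add: cox_B_def numeral_eq_Suc)
  next
    case 2
    have "cox_eq ?X (concat (replicate (snd ?X i j) [i, j])) []"
      using ij by (intro cox_eq_relator) auto
    moreover have "snd ?X i j = snd (cox_B n) i j" using 2 by (auto simp: cox_D_def cox_B_def max_def min_def)
    ultimately show ?thesis using 2 by simp
  next
    case 3
    have "cox_eq ?X (concat (replicate 4 [i, n, n + 1])) []"
      by (rule cox_eq_pow4(1)[OF X]) (use 3 ij in \<open>auto simp: cox_D_def max_def min_def\<close>)
    moreover have "snd (cox_B n) i j = 4" using 3 by (auto simp: cox_B_def)
    ultimately show ?thesis using 3 by simp
  next
    case 4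
    have "cox_eq ?X (concat (replicate 4 [n, n + 1, j])) []"
      by (rule cox_eq_pow4(2)[OF X]) (use 4 ij in \<open>auto simp: cox_D_def max_def min_def\<close>)
    moreover have "snd (cox_B n) i j = 4" using 4 by (auto simp: cox_B_def)
    ultimately show ?thesis using 4 by simp
  next
    case 5
    moreover have "snd (cox_B n) i j = 2" using 5 by (auto simp: cox_B_def)
    ultimately show ?thesis using comm(1)[of i] ij by simp
  next
    case 6
    moreover have "snd (cox_B n) i j = 2" using 6 by (auto simp: cox_B_def)
    ultimately show ?thesis using comm(2)[of j] ij by simp
  qed
qed (use f cox_D_datum cox_B_datum in auto)

section \<open>Identities between q-numbers\<close>

lemma q_num_Suc: "q_num (Suc k) x = q_num k x + x ^ k"
  by (simp add: q_num_def)

lemma q_num_0 [simp]: "q_num 0 x = 0"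
  by (simp add: q_num_def)

lemma q_num_double: "q_num (2 * m) x = (1 + x) * q_num m (x ^ 2)"
  by (induction m) (simp_all add: q_num_Suc algebra_simps power_mult[symmetric] mult.commute)

lemma q_num_odd_minus: "(1 + x) * q_num (2 * j + 1) (- x) = 1 + x ^ (2 * j + 1)"
  by (induction j) (simp_all add: q_num_Suc algebra_simps)

text \<open>The factor \<open>1 + x\<close> taken out of the even q-number is what completes the odd
  one at \<open>- x\<close> to \<open>1 + x ^ (2 * j + 1)\<close>.\<close>

lemma q_num_pair:
  "q_num (2 * m) x * q_num (2 * j + 1) (- x) = q_num m (x ^ 2) * (1 + x ^ (2 * j + 1))"
  unfolding q_num_odd_minus[symmetric] q_num_double by (simp only: ac_simps)

text \<open>Factor \<open>j\<close> on the left accounts for \<open>k = 2 * j + 1\<close> and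
  \<open>k = 2 * j + 2\<close> on the right.\<close>

lemma prod_q_num_even:
  "(\<Prod>j<n. q_num (j + 1) (x ^ 2) * (1 + x ^ (2 * j + 1))) =
    (\<Prod>k=1..2 * n. q_num k ((- 1) ^ k * x))"
proof (induction n)
  case (Suc n)
  have "(\<Prod>k=1..2 * Suc n. q_num k ((- 1) ^ k * x)) =
      (\<Prod>k=1..2 * n. q_num k ((- 1) ^ k * x)) *
      (q_num (2 * (n + 1)) x * q_num (2 * n + 1) (- x))"
    by (simp add: mult.assoc mult.commute)
  also have "\<dots> = (\<Prod>k=1..2 * n. q_num k ((- 1) ^ k * x)) *
      (q_num (n + 1) (x ^ 2) * (1 + x ^ (2 * n + 1)))"
    by (simp only: q_num_pair)
  finally show ?case unfolding prod.lessThan_Suc Suc.IH by (rule sym)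
qed simp

text \<open>Here factor \<open>j\<close> accounts for \<open>k = 2 * j + 2\<close> and
  \<open>k = 2 * j + 3\<close>, while \<open>k = 1\<close> contributes 1.\<close>

lemma prod_q_num_odd:
  "(\<Prod>j<n. q_num (j + 1) (x ^ 2) * (1 + x ^ (2 * j + 3))) =
    (\<Prod>k=1..2 * n + 1. q_num k ((- 1) ^ k * x))"
proof (induction n)
  case 0
  show ?case by (simp add: q_num_def)
next
  case (Suc n)
  have "(\<Prod>k=1..2 * Suc n + 1. q_num k ((- 1) ^ k * x)) =
      (\<Prod>k=1..2 * n + 1. q_num k ((- 1) ^ k * x)) *
      (q_num (2 * (n + 1)) x * q_num (2 * (n + 1) + 1) (- x))"
    by (simp add: mult.assoc mult.commute)
  also have "\<dots> = (\<Prod>k=1..2 * n + 1. q_num k ((- 1) ^ k * x)) *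
      (q_num (n + 1) (x ^ 2) * (1 + x ^ (2 * n + 3)))"
  proof -
    have "2 * (n + 1) + 1 = 2 * n + 3" by simp
    then show ?thesis using q_num_pair[of "n + 1" x "n + 1"] by (simp only:)
  qed
  finally show ?case unfolding prod.lessThan_Suc Suc.IH by (rule sym)
qed

text \<open>The powers in \<open>q_num (2 * k + 1) x\<close> are those below \<open>k\<close>, the
  power \<open>k\<close> itself, and those above, which form
  \<open>x ^ (k + 1) * q_num k x\<close>.\<close>

lemma q_num_gap: "q_num k x * (1 + x ^ (k + 1)) = q_num (2 * k + 1) x - x ^ k"
proof -
  have "q_num (k + m) x = q_num k x + x ^ k * q_num m x" for m
    by (induction m) (simp_all add: q_num_Suc algebra_simps power_add)
  note add = this[of "k + 1"]
  have "q_num (k + 1) x = 1 + x * q_num k x"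
  proof (induction k)
    case (Suc k)
    have "q_num (Suc k + 1) x = q_num (k + 1) x + x ^ Suc k" by (simp add: q_num_Suc)
    also have "\<dots> = 1 + x * (q_num k x + x ^ k)" by (simp only: Suc) (simp add: algebra_simps)
    finally show ?case by (simp only: q_num_Suc)
  qed (simp add: q_num_Suc)
  moreover have "2 * k + 1 = k + (k + 1)" by simp
  ultimately have "q_num (2 * k + 1) x = q_num k x + x ^ k * (1 + x * q_num k x)"
    using add by (simp only:)
  then show ?thesis by (simp add: algebra_simps)
qed

text \<open>For \<open>j \<ge> 2\<close> each factor is \<open>q_num_gap\<close> with
  \<open>k = j + 1\<close>. The first two combine to the q-numbers 2, 3, 4, since
  \<open>1 + x ^ 3\<close> is divisible by \<open>1 + x\<close>.\<close>

lemma prod_q_num_gap: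
  assumes "n \<ge> 2"
  shows "(\<Prod>j<n. q_num (j + 1) x * (1 + x ^ (j + 2))) =
    q_num 2 x * q_num 3 (- x) * q_num 4 x *
      (\<Prod>k=3..n. q_num (2 * k + 1) x - x ^ k)"
  using assms
proof (induction n rule: dec_induct)
  case base
  have "q_num 1 x = 1" "q_num 2 x = 1 + x" "q_num 3 (- x) = 1 - x + x ^ 2"
    "q_num 4 x = (1 + x) * (1 + x ^ 2)"
    by (simp_all add: numeral_eq_Suc q_num_Suc algebra_simps)
  moreover have "1 + x ^ 3 = (1 + x) * (1 - x + x ^ 2)"
    by (simp add: numeral_eq_Suc algebra_simps)
  moreover have "(\<Prod>j<2. q_num (j + 1) x * (1 + x ^ (j + 2))) =
      q_num 1 x * (1 + x ^ 2) * (q_num 2 x * (1 + x ^ 3))"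
    by (simp add: numeral_eq_Suc)
  ultimately show ?case by (simp add: mult.assoc mult.commute mult.left_commute)
next
  case (step n)
  have "(\<Prod>k=3..Suc n. q_num (2 * k + 1) x - x ^ k) =
      (\<Prod>k=3..n. q_num (2 * k + 1) x - x ^ k) * (q_num (2 * Suc n + 1) x - x ^ Suc n)"
    using step by (simp add: atLeastAtMostSuc_conv)
  then show ?case using step q_num_gap[of "Suc n" x] by (simp add: mult.assoc)
qed

section \<open>Generating polynomials of the three foldings of B_n\<close>

lemma U_poly_B_A_odd:
  assumes n: "n \<ge> 1"
    and f: "\<And>i. f i = cox_prod (cox_A (2 * n - 1)) (if i \<noteq> n then [i, 2 * n - i] else [n])"
  shows "\<exists>\<phi>. extends_gens (cox_B n) (cox_A (2 * n - 1)) f \<phi>"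
    and "extends_gens (cox_B n) (cox_A (2 * n - 1)) f \<phi> \<Longrightarrow>
      U_poly (cox_B n) (cox_A (2 * n - 1)) \<phi> = (\<Prod>k=1..2 * n. q_num k ((- 1) ^ k * q_var))"
proof -
  note F = A_odd_folding[OF n]
  show "\<exists>\<phi>. extends_gens (cox_B n) (cox_A (2 * n - 1)) f \<phi>"
    by (rule B_to_A_exists[OF F f])
  show "U_poly (cox_B n) (cox_A (2 * n - 1)) \<phi> = (\<Prod>k=1..2 * n. q_num k ((- 1) ^ k * q_var))"
    if "extends_gens (cox_B n) (cox_A (2 * n - 1)) f \<phi>"
    by (simp only: B_folding.U_poly_B[OF F(2) that f] prod_q_num_even)
qed

lemma U_poly_B_A_even:
  assumes n: "n \<ge> 1"
    and f: "\<And>i. f i = cox_prod (cox_A (2 * n)) (if i \<noteq> n then [i, 2 * n + 1 - i] else [n, n + 1, n])"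
  shows "\<exists>\<phi>. extends_gens (cox_B n) (cox_A (2 * n)) f \<phi>"
    and "extends_gens (cox_B n) (cox_A (2 * n)) f \<phi> \<Longrightarrow>
      U_poly (cox_B n) (cox_A (2 * n)) \<phi> = (\<Prod>k=1..2 * n + 1. q_num k ((- 1) ^ k * q_var))"
proof -
  note F = A_even_folding[OF n]
  show "\<exists>\<phi>. extends_gens (cox_B n) (cox_A (2 * n)) f \<phi>"
    by (rule B_to_A_exists[OF F f])
  show "U_poly (cox_B n) (cox_A (2 * n)) \<phi> = (\<Prod>k=1..2 * n + 1. q_num k ((- 1) ^ k * q_var))"
    if "extends_gens (cox_B n) (cox_A (2 * n)) f \<phi>"
    by (simp only: B_folding.U_poly_B[OF F(2) that f] prod_q_num_odd)
qed

lemma U_poly_B_D: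
  assumes n: "n \<ge> 2"
    and f: "\<And>i. f i = cox_prod (cox_D (n + 1)) (if i \<noteq> n then [i] else [n, n + 1])"
  shows "\<exists>\<phi>. extends_gens (cox_B n) (cox_D (n + 1)) f \<phi>"
    and "extends_gens (cox_B n) (cox_D (n + 1)) f \<phi> \<Longrightarrow>
      U_poly (cox_B n) (cox_D (n + 1)) \<phi> = q_num 2 q_var * q_num 3 (- q_var) * q_num 4 q_var *
        (\<Prod>k=3..n. q_num (2 * k + 1) q_var - q_var ^ k)"
proof -
  show "\<exists>\<phi>. extends_gens (cox_B n) (cox_D (n + 1)) f \<phi>"
    by (rule B_to_D_exists[OF n f])
  show "U_poly (cox_B n) (cox_D (n + 1)) \<phi> = q_num 2 q_var * q_num 3 (- q_var) * q_num 4 q_var *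
      (\<Prod>k=3..n. q_num (2 * k + 1) q_var - q_var ^ k)"
    if "extends_gens (cox_B n) (cox_D (n + 1)) f \<phi>"
    by (simp only: B_folding.U_poly_B[OF D_folding[OF n] that f] power_one_right mult_1
        prod_q_num_gap[OF n])
qed

section \<open>Dihedral foldings\<close>

primrec alt :: "nat \<Rightarrow> nat \<Rightarrow> nat list" where
  "alt i 0 = []"
| "alt i (Suc k) = i # alt (3 - i) k"

lemma cox_I2_set [simp]: "fst (cox_I2 N) = {1, 2}"
  by (simp add: cox_I2_def)

lemma cox_I2_datum: "cox_datum (cox_I2 N)"
  by (auto simp: cox_datum_def cox_I2_def)

lemma alt_lists: "i \<in> {1, 2} \<Longrightarrow> alt i k \<in> lists {1, 2}"
proof (induction k arbitrary: i)
  case (Suc k)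
  have "3 - i \<in> {1, 2}" using Suc.prems by auto
  from Suc.IH[OF this] show ?case using Suc.prems by simp
qed simp

lemma alt_append: "\<exists>j. alt i (k + l) = alt i k @ alt j l"
  by (induction k arbitrary: i) auto

text \<open>The two sides go round the relator of length \<open>2 * N\<close> in opposite
  directions. Moving one letter across shortens one side and lengthens the other.\<close>

lemma alt_reflect:
  "i \<in> {1, 2} \<Longrightarrow> k \<le> 2 * N \<Longrightarrow> cox_eq (cox_I2 N) (alt i k) (alt (3 - i) (2 * N - k))"
proof (induction k arbitrary: i)
  case 0
  define j where "j = 3 - i"
  have j: "j \<in> {1, 2}" "3 - j \<in> {1, 2}" "3 - (3 - j) = j" "j \<noteq> 3 - j"
    using 0 by (auto simp: j_def)
  have "alt j (2 * m) = concat (replicate m [j, 3 - j])" for m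
    by (induction m) (simp_all add: j)
  then have "alt j (2 * N) = concat (replicate (snd (cox_I2 N) j (3 - j)) [j, 3 - j])"
    using j by (simp add: cox_I2_def)
  then have "cox_eq (cox_I2 N) (alt j (2 * N)) []"
    using cox_eq_relator[of j "cox_I2 N" "3 - j"] j by simp
  then show ?case by (simp add: j_def cox_eq_sym)
next
  case (Suc k)
  have i: "3 - i \<in> {1, 2}" "3 - (3 - i) = i" using Suc.prems by auto
  have e: "2 * N - k = Suc (2 * N - Suc k)" using Suc.prems by simp
  have "cox_eq (cox_I2 N) ([i] @ alt (3 - i) k) ([i] @ alt i (2 * N - k))"
    using Suc.IH[OF i(1)] Suc.prems i(2) by (intro cox_eq_append cox_eq_refl) simp
  also have "cox_eq (cox_I2 N) ([i] @ alt i (2 * N - k)) (alt (3 - i) (2 * N - Suc k))"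
    using cox_eq_subword[OF cox_eq_square[OF cox_I2_datum], of i N "[]" "alt (3 - i) (2 * N - Suc k)"]
      Suc.prems(1) unfolding e by simp
  finally show ?case by simp
qed

text \<open>The identity is listed only as \<open>alt 1 0\<close> and the longest element only as
  \<open>alt 2 N\<close>, which makes \<open>2 * N\<close> words.\<close>

definition I2_forms :: "nat \<Rightarrow> nat list set" where
  "I2_forms N = alt 1 ` {..<N} \<union> alt 2 ` {1..N}"

lemma I2_forms_alt:
  assumes "i \<in> {1, 2}" "k \<le> 2 * N" "N > 0"
  shows "\<exists>v\<in>I2_forms N. cox_eq (cox_I2 N) (alt i k) v"
proof -
  consider "i = 1" "k < N" | "i = 2" "1 \<le> k" "k \<le> N" | "i = 2" "k = 0"
    | "i = 1" "N \<le> k" "k < 2 * N" | "i = 2" "N < k" | "i = 1" "k = 2 * N"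
    using assms by force
  then show ?thesis
  proof cases
    case 4
    then have "alt 2 (2 * N - k) \<in> I2_forms N"
      unfolding I2_forms_def by (intro UnI2 imageI) auto
    then show ?thesis using alt_reflect[OF assms(1,2)] 4 by (auto simp: numeral_eq_Suc)
  next
    case 5
    then have "alt 1 (2 * N - k) \<in> I2_forms N"
      unfolding I2_forms_def using assms by (intro UnI1 imageI) auto
    then show ?thesis using alt_reflect[OF assms(1,2)] 5 by (auto simp: numeral_eq_Suc)
  next
    case 3
    then have "alt 2 k = alt 1 0" by simp
    moreover have "alt 1 0 \<in> I2_forms N" using assms unfolding I2_forms_def by blast
    ultimately show ?thesis using 3 cox_eq_refl by metis
  next
    case 6
    have "cox_eq (cox_I2 N) (alt 1 k) (alt 1 0)" using alt_reflect[OF assms(1,2)] 6 by simp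
    moreover have "alt 1 0 \<in> I2_forms N" using assms unfolding I2_forms_def by blast
    ultimately show ?thesis using 6 by blast
  next
    case 1
    then have "alt i k \<in> I2_forms N" unfolding I2_forms_def by simp
    then show ?thesis using cox_eq_refl by blast
  next
    case 2
    then have "alt i k \<in> I2_forms N" unfolding I2_forms_def by simp
    then show ?thesis using cox_eq_refl by blast
  qed
qed

lemma I2_forms_cover:
  assumes N: "N \<ge> 2"
  shows "u \<in> lists {1, 2} \<Longrightarrow> \<exists>v\<in>I2_forms N. cox_eq (cox_I2 N) u v"
proof (induction u)
  case Nil
  show ?case using I2_forms_alt[of 1 0 N] N by simp
next
  case (Cons x u)
  then obtain v where v: "v \<in> I2_forms N" "cox_eq (cox_I2 N) u v" by auto
  then obtain i k where v': "v = alt i k" "i \<in> {1, 2}" "k \<le> N" by (auto simp: I2_forms_def)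
  \<comment> \<open>Prepending a letter gives an alternating word of length at most
    \<open>N + 1\<close>, which is at most \<open>2 * N\<close>, so \<open>I2_forms_alt\<close>
    applies.\<close>
  have "\<exists>j l. j \<in> {1, 2} \<and> l \<le> 2 * N \<and> cox_eq (cox_I2 N) (x # v) (alt j l)"
  proof (cases "x = i \<and> k \<noteq> 0")
    case True
    then obtain l where "k = Suc l" by (cases k) auto
    then have "cox_eq (cox_I2 N) (x # v) (alt (3 - i) l)"
      using cox_eq_subword[OF cox_eq_square[OF cox_I2_datum], of i N "[]" "alt (3 - i) l"] True v'
      by simp
    then show ?thesis using v' \<open>k = Suc l\<close> by (intro exI[of _ "3 - i"] exI[of _ l]) auto
  next
    case False
    then have "x # v = alt x (k + 1)" using v' Cons.prems by (cases k) auto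
    then show ?thesis using v' Cons.prems N by (intro exI[of _ x] exI[of _ "k + 1"]) auto
  qed
  then obtain w where w: "w \<in> I2_forms N" "cox_eq (cox_I2 N) (x # v) w"
    using I2_forms_alt[of _ _ N] N cox_eq_trans by (metis less_le_trans pos2)
  have "cox_eq (cox_I2 N) ([x] @ u) ([x] @ v)" using v(2) by (intro cox_eq_append cox_eq_refl)
  then show ?case using w cox_eq_trans by fastforce
qed

text \<open>The group \<open>I\<^sub>2(N)\<close> acts on \<open>\<int>/2N\<close> by the reflections \<open>z \<mapsto> -z\<close> and \<open>z \<mapsto> 2 - z\<close>;
  the maps below are their lifts to the integers.\<close>

definition reflect :: "nat \<Rightarrow> int \<Rightarrow> int" where
  "reflect i z = (if i = 1 then - z else 2 - z)"

lemma foldr_refl_alt: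
  "foldr reflect (alt 1 k) z = (- 1) ^ k * z - 2 * int (k div 2) \<and>
   foldr reflect (alt 2 k) z = (- 1) ^ k * z + 2 * int ((k + 1) div 2)"
  by (induction k) (auto simp: reflect_def)

text \<open>The relations hold only modulo \<open>2 * N\<close>, whereas \<open>cox_eq_foldr\<close>
  asks for equal maps. Residues are therefore represented in one interval, and all other integers
  are fixed.\<close>

definition refl_mod :: "nat \<Rightarrow> nat \<Rightarrow> int \<Rightarrow> int" where
  "refl_mod N i z = (if 0 \<le> z \<and> z < 2 * int N then reflect i z mod (2 * int N) else z)"

lemma foldr_refl_mod:
  assumes "0 \<le> z" "z < 2 * int N"
  shows "foldr (refl_mod N) u z = foldr reflect u z mod (2 * int N)"
proof (induction u)
  case (Cons i u)
  have "reflect i (a mod m) mod m = reflect i a mod m" for a m :: int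
    by (simp add: reflect_def mod_minus_eq mod_diff_right_eq)
  then show ?case using Cons assms by (simp add: refl_mod_def)
qed (use assms in simp)

text \<open>Serves twice: for the action of the dihedral group itself and for checking its relators
  on permutations in type A.\<close>

lemma foldr_refl_relator:
  assumes "i \<in> {1, 2}" "j \<in> {1, 2}"
  shows "\<exists>c. foldr reflect (concat (replicate (snd (cox_I2 N) i j) [i, j])) z = z + c * (2 * int N)"
proof -
  have "foldr reflect (concat (replicate m [1, 2])) z = z - 2 * int m"
    "foldr reflect (concat (replicate m [2, 1])) z = z + 2 * int m" for m
    by (induction m) (auto simp: reflect_def)
  then have "foldr reflect (concat (replicate N [1, 2])) z = z + (- 1) * (2 * int N)"
    "foldr reflect (concat (replicate N [2, 1])) z = z + 1 * (2 * int N)" by simp_all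
  moreover have "foldr reflect [k, k] z = z + 0 * (2 * int N)" for k by (simp add: reflect_def)
  ultimately show ?thesis
  proof -
    assume a: "foldr reflect (concat (replicate N [1, 2])) z = z + (- 1) * (2 * int N)"
      "foldr reflect (concat (replicate N [2, 1])) z = z + 1 * (2 * int N)"
      and b: "\<And>k. foldr reflect [k, k] z = z + 0 * (2 * int N)"
    consider "i = j" | "i = 1" "j = 2" | "i = 2" "j = 1" using assms by blast
    then show ?thesis
    proof cases
      case 1
      have "concat (replicate (snd (cox_I2 N) i j) [i, j]) = [j, j]" using 1 by (simp add: cox_I2_def)
      then show ?thesis using b[of j] by metis
    next
      case 2
      have "concat (replicate (snd (cox_I2 N) i j) [i, j]) = concat (replicate N [1, 2])"
        using 2 by (simp add: cox_I2_def)
      then show ?thesis using a(1) by metis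
    next
      case 3
      have "concat (replicate (snd (cox_I2 N) i j) [i, j]) = concat (replicate N [2, 1])"
        using 3 by (simp add: cox_I2_def)
      then show ?thesis using a(2) by metis
    qed
  qed
qed

lemma cox_I2_foldr_refl:
  assumes e: "cox_eq (cox_I2 N) u v" and z: "0 \<le> z" "z < 2 * int N"
  shows "2 * int N dvd foldr reflect u z - foldr reflect v z"
proof -
  have rel: "foldr (refl_mod N) (concat (replicate (snd (cox_I2 N) x y) [x, y])) = id"
    if xy: "x \<in> {1, 2}" "y \<in> {1, 2}" for x y
  proof
    fix z
    show "foldr (refl_mod N) (concat (replicate (snd (cox_I2 N) x y) [x, y])) z = id z"
    proof (cases "0 \<le> z \<and> z < 2 * int N")
      case True
      obtain c where "foldr reflect (concat (replicate (snd (cox_I2 N) x y) [x, y])) z = z + c * (2 * int N)"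
        using foldr_refl_relator[OF xy] by blast
      then show ?thesis using True by (simp add: foldr_refl_mod)
    next
      case False
      then have "foldr (refl_mod N) u z = z" for u by (induction u) (auto simp: refl_mod_def)
      then show ?thesis by simp
    qed
  qed
  have "foldr (refl_mod N) u = foldr (refl_mod N) v"
  proof (rule cox_eq_foldr[OF _ _ e])
    fix x y assume xy: "x \<in> fst (cox_I2 N)" "y \<in> fst (cox_I2 N)"
    show "(refl_mod N x \<circ> refl_mod N y) ^^ snd (cox_I2 N) x y = id"
      using rel[of x y] xy unfolding foldr_concat_replicate by (simp add: comp_def)
    show "refl_mod N x \<circ> refl_mod N x = id"
      using rel[of x x] xy unfolding foldr_concat_replicate by (simp add: comp_def cox_I2_def)
  qed
  then show ?thesis using foldr_refl_mod[OF z] by (metis mod_eq_dvd_iff)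
qed

text \<open>A word acts as \<open>z + 2 * c\<close> or \<open>- z + 2 * c\<close>. The sign gives
  the parity of its length, and for a fixed parity the values of \<open>c\<close> lie less than
  \<open>N\<close> apart, so their residues modulo \<open>N\<close> separate the words.\<close>

lemma I2_forms_separated:
  assumes N: "N \<ge> 2" and u: "u \<in> I2_forms N" and v: "v \<in> I2_forms N"
    and e: "cox_eq (cox_I2 N) u v"
  shows "u = v"
proof -
  have form: "\<exists>k c. foldr reflect w = (\<lambda>z. (- 1) ^ k * z + 2 * c) \<and>
      (w = alt 1 k \<and> k < N \<and> c = - int (k div 2) \<or> w = alt 2 k \<and> 1 \<le> k \<and> k \<le> N \<and> c = int ((k + 1) div 2))"
    if "w \<in> I2_forms N" for w
  proof -
    from that consider k where "k < N" "w = alt 1 k" | k where "1 \<le> k" "k \<le> N" "w = alt 2 k"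
      by (auto simp: I2_forms_def)
    then show ?thesis
    proof cases
      case 1
      then show ?thesis using foldr_refl_alt[of k]
        by (intro exI[of _ k] exI[of _ "- int (k div 2)"]) (simp add: fun_eq_iff)
    next
      case 2
      then show ?thesis using foldr_refl_alt[of k]
        by (intro exI[of _ k] exI[of _ "int ((k + 1) div 2)"]) (simp add: fun_eq_iff)
    qed
  qed
  obtain k c where k: "foldr reflect u = (\<lambda>z. (- 1) ^ k * z + 2 * c)"
    "u = alt 1 k \<and> k < N \<and> c = - int (k div 2) \<or> u = alt 2 k \<and> 1 \<le> k \<and> k \<le> N \<and> c = int ((k + 1) div 2)"
    using form[OF u] by blast
  obtain l b where l: "foldr reflect v = (\<lambda>z. (- 1) ^ l * z + 2 * b)"
    "v = alt 1 l \<and> l < N \<and> b = - int (l div 2) \<or> v = alt 2 l \<and> 1 \<le> l \<and> l \<le> N \<and> b = int ((l + 1) div 2)"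
    using form[OF v] by blast
  \<comment> \<open>Evaluation at 0 isolates the translation; evaluation at 1 then yields the
    sign.\<close>
  have d0: "2 * int N dvd 2 * c - 2 * b"
    using cox_I2_foldr_refl[OF e, of 0] N by (simp add: k(1) l(1))
  have "2 * int N dvd (- 1) ^ k + 2 * c - ((- 1) ^ l + 2 * b)"
    using cox_I2_foldr_refl[OF e, of 1] N by (simp add: k(1) l(1))
  from dvd_diff[OF this d0] have d1: "2 * int N dvd (- 1) ^ k - (- 1) ^ l" by simp
  have par: "even k = even l"
  proof (rule ccontr)
    assume "even k \<noteq> even l"
    then have "(- 1) ^ k - (- 1) ^ l = (2 :: int) \<or> (- 1) ^ k - (- 1) ^ l = (- 2 :: int)" by auto
    then have "2 * int N dvd 2" using d1 by auto
    then have "2 * int N \<le> 2" by (rule zdvd_imp_le) simp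
    then show False using N by simp
  qed
  obtain t where "2 * c - 2 * b = 2 * int N * t" using d0 by (rule dvdE)
  then have t: "c - b = int N * t" by simp
  \<comment> \<open>Words starting with 1 have \<open>c \<le> 0\<close>, those starting with 2 have
    \<open>c > 0\<close>. So \<open>c\<close> gives the first letter and, with the parity, the
    length.\<close>
  have small: "\<bar>c - b\<bar> < int N \<and> (c = b \<longrightarrow> u = v)"
  proof (cases "even k")
    case True
    then obtain r s where rs: "k = 2 * r" "l = 2 * s" using par by (auto elim!: evenE)
    have "u = alt 1 k \<and> 2 * r < N \<and> c = - int r \<or> u = alt 2 k \<and> 1 \<le> r \<and> 2 * r \<le> N \<and> c = int r"
      using k(2) by (simp add: rs(1))
    moreover have "v = alt 1 l \<and> 2 * s < N \<and> b = - int s \<or> v = alt 2 l \<and> 1 \<le> s \<and> 2 * s \<le> N \<and> b = int s"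
      using l(2) by (simp add: rs(2))
    ultimately show ?thesis by (elim disjE conjE) (simp_all add: rs)
  next
    case False
    then obtain r s where rs: "k = 2 * r + 1" "l = 2 * s + 1" using par by (auto elim!: oddE)
    have "u = alt 1 k \<and> 2 * r + 1 < N \<and> c = - int r \<or> u = alt 2 k \<and> 2 * r + 1 \<le> N \<and> c = int r + 1"
      using k(2) by (simp add: rs(1)) linarith
    moreover have "v = alt 1 l \<and> 2 * s + 1 < N \<and> b = - int s \<or> v = alt 2 l \<and> 2 * s + 1 \<le> N \<and> b = int s + 1"
      using l(2) by (simp add: rs(2)) linarith
    ultimately show ?thesis by (elim disjE conjE) (simp_all add: rs)
  qed
  have "t = 0"
  proof (rule ccontr)
    assume "t \<noteq> 0"
    then have "int N * 1 \<le> int N * \<bar>t\<bar>" by (intro mult_left_mono) auto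
    then show False using small t by (simp add: abs_mult)
  qed
  then show ?thesis using small t by simp
qed

text \<open>The points \<open>1, \<dots>, N\<close> correspond to the odd residues modulo \<open>2N\<close> in such a way that the product of
  the transpositions \<open>(k k+1)\<close> with \<open>k\<close> odd becomes \<open>z \<mapsto> -z\<close>, and that with \<open>k\<close> even becomes
  \<open>z \<mapsto> 2 - z\<close>.\<close>

definition unfold_pos :: "nat \<Rightarrow> nat \<Rightarrow> int" where
  "unfold_pos N k = (if odd k then int k else 2 * int N + 1 - int k)"

text \<open>All labels lie between 1 and \<open>2 * N\<close>, so congruent labels are equal; odd
  points have labels up to \<open>N\<close>, even points larger ones.\<close>

lemma unfold_pos_inj:
  assumes "k \<in> {1..N}" "l \<in> {1..N}" "2 * int N dvd unfold_pos N k - unfold_pos N l"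
  shows "k = l"
proof -
  obtain t where t: "unfold_pos N k - unfold_pos N l = 2 * int N * t" using assms(3) by (auto elim: dvdE)
  have b: "\<bar>unfold_pos N k - unfold_pos N l\<bar> < 2 * int N"
    using assms(1,2) by (auto simp: unfold_pos_def)
  have "t = 0"
  proof (rule ccontr)
    assume "t \<noteq> 0"
    then have "2 * int N * 1 \<le> 2 * int N * \<bar>t\<bar>" by (intro mult_left_mono) auto
    then show False using b t by (simp add: abs_mult)
  qed
  then have "unfold_pos N k = unfold_pos N l" using t by simp
  then show ?thesis using assms(1,2) by (auto simp: unfold_pos_def split: if_splits)
qed

section \<open>The two bipartite products of generators in type A\<close>

lemma foldr_adj_odd:
  "foldr adj (filter odd [1..<n + 1]) k =
    (if odd k \<and> k \<le> n then k + 1 else if even k \<and> 1 \<le> k \<and> k \<le> n + 1 then k - 1 else k)"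
proof (induction n arbitrary: k)
  case (Suc n)
  have step: "foldr adj (filter odd [1..<Suc n + 1]) k =
      foldr adj (filter odd [1..<n + 1]) (if odd (n + 1) then adj (n + 1) k else k)" by simp
  consider "k = n + 1" | "k = n + 2" | "k \<noteq> n + 1" "k \<noteq> n + 2" by blast
  then show ?case
  proof cases
    case 1
    then have "adj (n + 1) k = n + 2" by (simp add: adj_def)
    then show ?thesis using 1 step[unfolded Suc] by auto
  next
    case 2
    then have "adj (n + 1) k = n + 1" by (simp add: adj_def)
    then show ?thesis using 2 step[unfolded Suc] odd_pos[of n] by (auto simp: Suc_le_eq)
  next
    case 3
    then have "adj (n + 1) k = k" by (simp add: adj_def transpose_def)
    then have "foldr adj (filter odd [1..<Suc n + 1]) k = foldr adj (filter odd [1..<n + 1]) k"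
      using step by simp
    also note Suc
    finally show ?thesis using 3 by auto
  qed
qed (auto simp: Suc_le_eq)

lemma foldr_adj_even:
  "foldr adj (filter even [1..<n + 1]) k =
    (if even k \<and> 1 \<le> k \<and> k \<le> n then k + 1 else if odd k \<and> 3 \<le> k \<and> k \<le> n + 1 then k - 1 else k)"
proof (induction n arbitrary: k)
  case (Suc n)
  have step: "foldr adj (filter even [1..<Suc n + 1]) k =
      foldr adj (filter even [1..<n + 1]) (if even (n + 1) then adj (n + 1) k else k)" by simp
  consider "k = n + 1" | "k = n + 2" | "k \<noteq> n + 1" "k \<noteq> n + 2" by blast
  then show ?case
  proof cases
    case 1
    then have "adj (n + 1) k = n + 2" by (simp add: adj_def)
    then show ?thesis using 1 step[unfolded Suc] by auto
  next
    case 2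
    then have "adj (n + 1) k = n + 1" by (simp add: adj_def)
    then show ?thesis using 2 step[unfolded Suc] odd_pos[of n] by (auto simp: Suc_le_eq)
  next
    case 3
    then have "adj (n + 1) k = k" by (simp add: adj_def transpose_def)
    then have "foldr adj (filter even [1..<Suc n + 1]) k = foldr adj (filter even [1..<n + 1]) k"
      using step by simp
    also note Suc
    finally show ?thesis using 3 by auto
  qed
qed (auto simp: Suc_le_eq)

definition bip :: "nat \<Rightarrow> nat \<Rightarrow> nat list" where
  "bip n i = (if i = 1 then filter odd [1..<n + 1] else filter even [1..<n + 1])"

lemma bip_lists: "bip n i \<in> lists {1..n}"
  by (auto simp: bip_def)

lemma concat_bip_lists: "concat (map (bip n) u) \<in> lists {1..n}"
  by (induction u) (use bip_lists in auto)

text \<open>Paired points are checked directly. An end point without a partner must have a label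
  fixed by the reflection modulo \<open>2 * (n + 1)\<close>: this is 1 or \<open>n + 2\<close> for
  \<open>2 - z\<close>, and \<open>n + 1\<close> for \<open>- z\<close>.\<close>

lemma bip_act:
  assumes "k \<in> {1..n + 1}" "i \<in> {1, 2}"
  shows "2 * int (n + 1) dvd unfold_pos (n + 1) (foldr adj (bip n i) k) - reflect i (unfold_pos (n + 1) k)"
proof -
  let ?m = "2 * int (n + 1)" and ?h = "unfold_pos (n + 1)"
  let ?d = "?h (foldr adj (bip n i) k) - reflect i (?h k)"
  have "?d = 0 \<or> ?d = ?m"
  proof (cases "i = 1")
    case True
    then have bip: "bip n i = filter odd [1..<n + 1]" by (simp add: bip_def)
    consider "odd k" "k \<le> n" | "odd k" "k = n + 1" | "even k" "1 \<le> k" "k \<le> n + 1"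
    proof -
      have "k = n + 1 \<or> k \<le> n" "1 \<le> k" "k \<le> n + 1" using assms(1) by auto
      then show thesis using that by blast
    qed
    then show ?thesis
      unfolding bip foldr_adj_odd by cases (simp_all add: True unfold_pos_def reflect_def of_nat_diff)
  next
    case False
    then have i: "i = 2" using assms(2) by simp
    then have bip: "bip n i = filter even [1..<n + 1]" by (simp add: bip_def)
    consider "even k" "1 \<le> k" "k \<le> n" | "even k" "k = n + 1" | "k = 1" | "odd k" "3 \<le> k" "k \<le> n + 1"
    proof -
      have "k = n + 1 \<or> k \<le> n" "odd k \<Longrightarrow> k \<noteq> 1 \<Longrightarrow> k \<ge> 3" "1 \<le> k" "k \<le> n + 1"
        using assms(1) by (auto elim!: oddE)
      then show thesis using that by blast
    qed
    then show ?thesis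
      unfolding bip foldr_adj_even by cases (simp_all add: i unfold_pos_def reflect_def of_nat_diff)
  qed
  then show ?thesis by auto
qed

lemma adj_foldr_range: "u \<in> lists {1..n} \<Longrightarrow> k \<in> {1..n + 1} \<Longrightarrow> foldr adj u k \<in> {1..n + 1}"
proof -
  interpret A_model n int by unfold_locales auto
  show "u \<in> lists {1..n} \<Longrightarrow> k \<in> {1..n + 1} \<Longrightarrow> foldr adj u k \<in> {1..n + 1}" by (rule foldr_range)
qed

lemma bip_word_act:
  assumes k: "k \<in> {1..n + 1}"
  shows "u \<in> lists {1, 2} \<Longrightarrow> 2 * int (n + 1) dvd
    unfold_pos (n + 1) (foldr adj (concat (map (bip n) u)) k) - foldr reflect u (unfold_pos (n + 1) k)"
proof (induction u)
  case (Cons i u)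
  let ?m = "2 * int (n + 1)" and ?h = "unfold_pos (n + 1)" and ?k = "foldr adj (concat (map (bip n) u)) k"
  have "?k \<in> {1..n + 1}" by (rule adj_foldr_range[OF concat_bip_lists k])
  then have 1: "?m dvd ?h (foldr adj (bip n i) ?k) - reflect i (?h ?k)"
    using Cons.prems by (intro bip_act) auto
  have "?m dvd ?h ?k - foldr reflect u (?h k)" using Cons by simp
  then have 2: "?m dvd reflect i (?h ?k) - reflect i (foldr reflect u (?h k))"
    by (auto simp: reflect_def dvd_diff_commute)
  from dvd_add[OF 1 2] show ?case by simp
qed simp

text \<open>A relator moves labels by multiples of \<open>2 * (n + 1)\<close>, hence fixes all
  points, and \<open>cox_A_faithful\<close> makes its image trivial.\<close>

lemma bip_extends:
  assumes n: "n \<ge> 1" and f: "\<And>i. i \<in> {1, 2} \<Longrightarrow> f i = cox_prod (cox_A n) (bip n i)"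
  shows "\<exists>\<phi>. extends_gens (cox_I2 (n + 1)) (cox_A n) f \<phi>"
proof (rule extends_gens_exists[where g = "bip n"])
  fix i j assume "i \<in> fst (cox_I2 (n + 1))" "j \<in> fst (cox_I2 (n + 1))"
  then have ij: "i \<in> {1, 2}" "j \<in> {1, 2}" by simp_all
  let ?u = "concat (replicate (snd (cox_I2 (n + 1)) i j) [i, j])"
  have u: "?u \<in> lists {1, 2}" using ij by (auto simp: in_lists_conv_set)
  have c: "concat (map (bip n) ?u) = concat (replicate (snd (cox_I2 (n + 1)) i j) (bip n i @ bip n j))"
  proof -
    have "concat (map (bip n) (concat (replicate m [i, j]))) = concat (replicate m (bip n i @ bip n j))" for m
      by (induction m) auto
    then show ?thesis .
  qed
  have "cox_eq (cox_A n) (concat (map (bip n) ?u)) []"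
  proof (rule cox_A_faithful[OF concat_bip_lists])
    fix k assume k: "k \<in> {1..n + 1}"
    obtain c where "foldr reflect ?u (unfold_pos (n + 1) k) = unfold_pos (n + 1) k + c * (2 * int (n + 1))"
      using foldr_refl_relator[OF ij] by blast
    then have c: "foldr reflect ?u (unfold_pos (n + 1) k) - unfold_pos (n + 1) k = 2 * int (n + 1) * c" by simp
    have "2 * int (n + 1) dvd
        unfold_pos (n + 1) (foldr adj (concat (map (bip n) ?u)) k) - unfold_pos (n + 1) k"
      using dvd_add[OF bip_word_act[OF k u] dvdI[OF c]] by simp
    then show "foldr adj (concat (map (bip n) ?u)) k = k"
      by (intro unfold_pos_inj[of _ "n + 1"] adj_foldr_range[OF concat_bip_lists k] k)
  qed
  then show "cox_eq (cox_A n) (concat (replicate (snd (cox_I2 (n + 1)) i j) (bip n i @ bip n j))) []"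
    unfolding c .
qed (use f bip_lists cox_A_datum cox_I2_datum in auto)

text \<open>Modulo \<open>2 * (n + 1)\<close> and for either first letter, the word acts on labels
  as the half turn \<open>z + n + 1\<close> for odd \<open>n\<close> and as the reflection
  \<open>- z - n\<close> for even \<open>n\<close>. Under \<open>unfold_pos\<close> both reverse the
  order of the points.\<close>

lemma bip_longest:
  assumes k: "k \<in> {1..n + 1}" and i: "i \<in> {1, 2}"
  shows "foldr adj (concat (map (bip n) (alt i (n + 1)))) k = n + 2 - k"
proof (rule unfold_pos_inj[of _ "n + 1"])
  let ?h = "unfold_pos (n + 1)" and ?m = "2 * int (n + 1)"
  let ?d = "foldr reflect (alt i (n + 1)) (?h k) - ?h (n + 2 - k)"
  have "?d = 0 \<or> ?d = ?m \<or> ?d = - ?m \<or> ?d = - 2 * ?m"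
  proof (cases "even n")
    case True
    then obtain m where m: "n = 2 * m" by (auto elim: evenE)
    have "foldr reflect (alt 1 (n + 1)) z = - z - 2 * int m"
      "foldr reflect (alt 2 (n + 1)) z = - z + 2 * int m + 2" for z
      using foldr_refl_alt[of "n + 1" z] unfolding m by (simp_all del: alt.simps)
    then show ?thesis
      using i k by (auto simp: unfold_pos_def of_nat_diff m simp del: alt.simps One_nat_def)
  next
    case False
    then obtain m where m: "n = 2 * m + 1" by (auto elim: oddE)
    have "foldr reflect (alt 1 (n + 1)) z = z - 2 * int m - 2"
      "foldr reflect (alt 2 (n + 1)) z = z + 2 * int m + 2" for z
      using foldr_refl_alt[of "n + 1" z] unfolding m by (simp_all del: alt.simps)
    then show ?thesis
      using i k by (auto simp: unfold_pos_def of_nat_diff m simp del: alt.simps One_nat_def)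
  qed
  then have "?m dvd ?d" by (elim disjE) (simp_all only: dvd_0_right dvd_refl dvd_minus_iff dvd_triv_right)
  moreover have "x - y + (y - z) = x - z" for x y z :: int by simp
  ultimately show "?m dvd ?h (foldr adj (concat (map (bip n) (alt i (n + 1)))) k) - ?h (n + 2 - k)"
    using dvd_add[OF bip_word_act[OF k alt_lists[OF i, of "n + 1"]], of ?d] by (simp only:)
qed (rule adj_foldr_range[OF concat_bip_lists k], use k in auto)

section \<open>Lengths of the images of alternating words\<close>

lemma length_bip: "length (bip n 1) = (n + 1) div 2" "length (bip n 2) = n div 2"
proof -
  have "length (filter odd [1..<n + 1]) = (n + 1) div 2 \<and> length (filter even [1..<n + 1]) = n div 2"
    by (induction n) auto
  then show "length (bip n 1) = (n + 1) div 2" "length (bip n 2) = n div 2" by (simp_all add: bip_def)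
qed

lemma length_bip_alt:
  "length (concat (map (bip n) (alt 1 k))) = (n + 1) div 2 * ((k + 1) div 2) + n div 2 * (k div 2) \<and>
   length (concat (map (bip n) (alt 2 k))) = n div 2 * ((k + 1) div 2) + (n + 1) div 2 * (k div 2)"
proof (induction k)
  case (Suc k)
  have "alt 1 (Suc k) = 1 # alt 2 k" "alt 2 (Suc k) = 2 # alt 1 k" by simp_all
  moreover have "(Suc k + 1) div 2 = k div 2 + 1" "Suc k div 2 = (k + 1) div 2" by simp_all
  ultimately show ?case using Suc length_bip by (simp add: algebra_simps)
qed simp

lemma length_bip_longest:
  assumes "i \<in> {1, 2}"
  shows "2 * length (concat (map (bip n) (alt i (n + 1)))) = (n + 1) * n"
proof (cases "even n")
  case True
  then obtain m where m: "n = 2 * m" by (auto elim: evenE)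
  have "(n + 1) div 2 = m" "n div 2 = m" "(n + 1 + 1) div 2 = m + 1" by (simp_all add: m)
  then show ?thesis
    using assms length_bip_alt[of n "n + 1"] m
    by (auto simp: algebra_simps simp del: alt.simps length_concat One_nat_def)
next
  case False
  then obtain m where m: "n = 2 * m + 1" by (auto elim: oddE)
  have "(n + 1) div 2 = m + 1" "n div 2 = m" "(n + 1 + 1) div 2 = m + 1" by (simp_all add: m)
  then show ?thesis
    using assms length_bip_alt[of n "n + 1"] m
    by (auto simp: algebra_simps simp del: alt.simps length_concat One_nat_def)
qed

lemma card_increasing_pairs:
  "2 * card {(x, y). (x, y) \<in> int ` {1..N} \<times> int ` {1..N} \<and> x < y} = N * (N - 1)"
proof -
  let ?f = "\<lambda>(j, i). (int i, int j)"
  have "{(x, y). (x, y) \<in> int ` {1..N} \<times> int ` {1..N} \<and> x < y} = ?f ` (SIGMA j:{1..N}. {1..<j})"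
    by (auto simp: image_iff)
  moreover have "inj_on ?f (SIGMA j:{1..N}. {1..<j})" by (auto simp: inj_on_def)
  ultimately have "card {(x, y). (x, y) \<in> int ` {1..N} \<times> int ` {1..N} \<and> x < y} = (\<Sum>j=1..N. j - 1)"
    by (simp add: card_image)
  moreover have "2 * (\<Sum>j=1..N. j - 1) = N * (N - 1)"
  proof (induction N)
    case (Suc N)
    then show ?case by (cases N) (simp_all add: algebra_simps)
  qed simp
  ultimately show ?thesis by simp
qed

text \<open>The remainder of the longest alternating word after \<open>alt i k\<close> adds at most
  as many inversions as its image has letters. As the whole attains the bound, the prefix must
  attain it too.\<close>

lemma bip_length:
  assumes n: "n \<ge> 1" and i: "i \<in> {1, 2}" and k: "k \<le> n + 1"
  shows "cox_length (cox_A n) (cox_prod (cox_A n) (concat (map (bip n) (alt i k)))) =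
    length (concat (map (bip n) (alt i k)))"
proof -
  interpret A_model n int by unfold_locales auto
  obtain j where j: "alt i (n + 1) = alt i k @ alt j (n + 1 - k)"
    using alt_append[of i k "n + 1 - k"] k by auto
  let ?w = "\<lambda>u. concat (map (bip n) u)"
  have "inversions P (foldr \<sigma> (?w (alt i (n + 1)))) = {(x, y). (x, y) \<in> P \<and> x < y}"
  proof -
    have val: "foldr \<sigma> (?w (alt i (n + 1))) (int l) = int (n + 2 - l)" if "l \<in> {1..n + 1}" for l
      by (simp only: foldr_p[OF concat_bip_lists that] bip_longest[OF that i])
    show ?thesis
    proof (intro equalityI subrelI)
      fix x y assume "(x, y) \<in> {(x, y). (x, y) \<in> P \<and> x < y}"
      then obtain l m where lm: "l \<in> {1..n + 1}" "m \<in> {1..n + 1}" "x = int l" "y = int m" "l < m" by auto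
      then show "(x, y) \<in> inversions P (foldr \<sigma> (?w (alt i (n + 1))))"
        using val[OF lm(1)] val[OF lm(2)] by (auto simp: inversions_def)
    qed (auto simp: inversions_def)
  qed
  then have "2 * card (inversions P (foldr \<sigma> (?w (alt i (n + 1))))) = (n + 1) * n"
    using card_increasing_pairs[of "n + 1"] by simp
  then have "card (inversions P (foldr \<sigma> (?w (alt i (n + 1))))) = length (?w (alt i (n + 1)))"
    using length_bip_longest[OF i, of n] by linarith
  moreover have "?w (alt i (n + 1)) = ?w (alt i k) @ ?w (alt j (n + 1 - k))"
    by (simp only: j map_append concat_append)
  ultimately have "card (inversions P (foldr \<sigma> (?w (alt i k) @ ?w (alt j (n + 1 - k))))) =
      length (?w (alt i k)) + length (?w (alt j (n + 1 - k)))" by (simp only: length_append)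
  moreover have "card (inversions P (foldr \<sigma> (?w (alt i k) @ ?w (alt j (n + 1 - k))))) \<le>
      card (inversions P (foldr \<sigma> (?w (alt i k)))) + 1 * length (?w (alt j (n + 1 - k)))"
    by (rule inversions_append_le) (simp only: cox_A_set concat_bip_lists)
  ultimately have "length (?w (alt i k)) \<le> card (inversions P (foldr \<sigma> (?w (alt i k))))" by linarith
  moreover have "card (inversions P (foldr \<sigma> (?w (alt i k)))) \<le> 1 * length (?w (alt i k))"
    using concat_bip_lists by (intro inversions_le) simp
  ultimately show ?thesis
    using concat_bip_lists by (intro cox_length_eq) (simp_all del: length_concat)
qed

lemma length_alt [simp]: "length (alt i k) = k"
  by (induction k arbitrary: i) auto

lemma U_poly_I2:
  assumes n: "n \<ge> 1" and e: "extends_gens (cox_I2 (n + 1)) (cox_A n) f \<phi>"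
    and f: "\<And>i. i \<in> {1, 2} \<Longrightarrow> f i = cox_prod (cox_A n) (bip n i)"
  shows "U_poly (cox_I2 (n + 1)) (cox_A n) \<phi> =
    (\<Sum>k<n + 1. q_var ^ length (concat (map (bip n) (alt 1 k)))) +
    (\<Sum>k<n + 1. q_var ^ length (concat (map (bip n) (alt 2 (k + 1)))))"
proof -
  let ?w = "\<lambda>u. concat (map (bip n) u)"
  have "U_poly (cox_I2 (n + 1)) (cox_A n) \<phi> =
      (\<Sum>u\<in>I2_forms (n + 1). q_var ^ cox_length (cox_A n) (cox_prod (cox_A n) (?w u)))"
  proof (rule U_poly_eq_sum[OF cox_I2_datum e])
    show "I2_forms (n + 1) \<subseteq> lists (fst (cox_I2 (n + 1)))"
      using alt_lists[of 1] alt_lists[of 2] by (auto simp: I2_forms_def simp del: One_nat_def)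
    show "\<exists>v\<in>I2_forms (n + 1). cox_eq (cox_I2 (n + 1)) u v" if "u \<in> lists (fst (cox_I2 (n + 1)))" for u
      using I2_forms_cover[of "n + 1" u] that n by simp
    show "u = v" if "u \<in> I2_forms (n + 1)" "v \<in> I2_forms (n + 1)" "cox_eq (cox_I2 (n + 1)) u v" for u v
      using I2_forms_separated[of "n + 1" u v] that n by simp
  qed (use f bip_lists in auto)
  also have "\<dots> = (\<Sum>u\<in>I2_forms (n + 1). q_var ^ length (?w u))"
  proof (intro sum.cong refl)
    fix u assume "u \<in> I2_forms (n + 1)"
    then obtain i k where "u = alt i k" "i \<in> {1, 2}" "k \<le> n + 1" by (auto simp: I2_forms_def)
    then show "q_var ^ cox_length (cox_A n) (cox_prod (cox_A n) (?w u)) = q_var ^ length (?w u)"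
      using bip_length[OF n] by simp
  qed
  also have "\<dots> = (\<Sum>u\<in>alt 1 ` {..<n + 1}. q_var ^ length (?w u)) +
      (\<Sum>u\<in>alt 2 ` {1..n + 1}. q_var ^ length (?w u))"
  proof -
    have "alt 1 k \<noteq> alt 2 l" if "l \<ge> 1" for k l
      using that by (cases k; cases l) auto
    then have "alt 1 ` {..<n + 1} \<inter> alt 2 ` {1..n + 1} = {}" by auto
    then show ?thesis unfolding I2_forms_def by (intro sum.union_disjoint) auto
  qed
  also have "(\<Sum>u\<in>alt 1 ` {..<n + 1}. q_var ^ length (?w u)) = (\<Sum>k<n + 1. q_var ^ length (?w (alt 1 k)))"
    by (rule sum.reindex[unfolded comp_def]) (auto intro!: inj_onI dest: arg_cong[of _ _ length])
  also have "(\<Sum>u\<in>alt 2 ` {1..n + 1}. q_var ^ length (?w u)) =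
      (\<Sum>k\<in>{1..n + 1}. q_var ^ length (?w (alt 2 k)))"
    by (rule sum.reindex[unfolded comp_def]) (auto intro!: inj_onI dest: arg_cong[of _ _ length])
  also have "\<dots> = (\<Sum>k<n + 1. q_var ^ length (?w (alt 2 (k + 1))))"
    by (rule sum.reindex_bij_witness[of _ "\<lambda>k. k + 1" "\<lambda>k. k - 1"]) auto
  finally show ?thesis .
qed

lemma q_num_2: "q_num 2 x = 1 + x"
  by (simp add: numeral_eq_Suc q_num_def)

text \<open>Both generators have images of \<open>m\<close> letters. Pairing \<open>alt 1 k\<close>
  with \<open>alt 2 (k + 1)\<close> takes out the factor \<open>1 + x ^ m\<close>.\<close>

lemma sum_bip_even:
  assumes "n = 2 * m"
  shows "(\<Sum>k<n + 1. x ^ length (concat (map (bip n) (alt 1 k)))) +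
    (\<Sum>k<n + 1. x ^ length (concat (map (bip n) (alt 2 (k + 1))))) = q_num 2 (x ^ m) * q_num (n + 1) (x ^ m)"
proof -
  have half: "(k + 1) div 2 + k div 2 = k" for k :: nat by presburger
  have len: "length (concat (map (bip n) (alt 1 k))) = m * k" "length (concat (map (bip n) (alt 2 k))) = m * k"
    for k using length_bip_alt[of n k] half[of k] assms by (simp_all add: distrib_left[symmetric])
  have pow: "x ^ (m * k) = (x ^ m) ^ k" "x ^ (m * (k + 1)) = x ^ m * (x ^ m) ^ k" for k
    by (simp_all add: power_mult[symmetric] power_add[symmetric])
  have "(\<Sum>k<n + 1. x ^ (m * k)) + (\<Sum>k<n + 1. x ^ (m * (k + 1))) =
      (\<Sum>k<n + 1. (1 + x ^ m) * (x ^ m) ^ k)"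
    unfolding sum.distrib[symmetric] pow(2) unfolding pow(1) by (simp only: distrib_right mult_1)
  then show ?thesis unfolding len q_num_2 by (simp only: q_num_def sum_distrib_left)
qed

lemma sum_pairs:
  fixes F :: "nat \<Rightarrow> 'a :: comm_monoid_add"
  shows "(\<Sum>k<2 * m. F k) = (\<Sum>j<m. F (2 * j) + F (2 * j + 1))"
  by (induction m) (simp_all add: add.assoc)

text \<open>The images have \<open>m\<close> and \<open>m - 1\<close> letters, together
  \<open>n\<close>. Besides \<open>j\<close> full pairs, the four words for each \<open>j\<close>
  contain nothing, either one of the images, or both, which gives the two factors
  \<open>1 + x ^ m\<close> and \<open>1 + x ^ (m - 1)\<close>.\<close>

lemma sum_bip_odd:
  assumes n: "n = 2 * m - 1" "m \<ge> 1"
  shows "(\<Sum>k<n + 1. x ^ length (concat (map (bip n) (alt 1 k)))) +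
    (\<Sum>k<n + 1. x ^ length (concat (map (bip n) (alt 2 (k + 1))))) =
    q_num 2 (x ^ (m - 1)) * q_num 2 (x ^ m) * q_num m (x ^ n)"
proof -
  obtain e where e: "m = Suc e" using n by (cases m) auto
  have ne: "n = 2 * e + 1" "n + 1 = 2 * m" using n e by auto
  have "length (concat (map (bip n) (alt 1 (2 * j)))) = n * j"
    "length (concat (map (bip n) (alt 1 (2 * j + 1)))) = n * j + m"
    "length (concat (map (bip n) (alt 2 (2 * j + 1)))) = n * j + (m - 1)"
    "length (concat (map (bip n) (alt 2 (2 * j + 1 + 1)))) = n * j + (m + (m - 1))" for j
    using length_bip_alt[of n "2 * j"] length_bip_alt[of n "2 * j + 1"] length_bip_alt[of n "2 * j + 1 + 1"] ne(1) e
    by (simp_all add: algebra_simps)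
  note len = this
  have "(\<Sum>j<m. x ^ (n * j) + x ^ (n * j + m)) + (\<Sum>j<m. x ^ (n * j + (m - 1)) + x ^ (n * j + (m + (m - 1)))) =
      (\<Sum>j<m. (1 + x ^ (m - 1)) * (1 + x ^ m) * (x ^ n) ^ j)"
    unfolding sum.distrib[symmetric] by (intro sum.cong refl)
      (simp only: power_add power_mult distrib_left distrib_right mult_1 mult_1_right,
        simp only: ac_simps)
  then show ?thesis
    unfolding ne(2) sum_pairs len q_num_2 by (simp only: q_num_def sum_distrib_left)
qed

theorem theorem1p3:
  shows
    "(\<forall>n\<ge>1.
        let f = (\<lambda>i. if i \<noteq> n then cox_prod (cox_A (2*n-1)) [i, 2*n-i]
                     else cox_prod (cox_A (2*n-1)) [n])
        in (\<exists>\<phi>. extends_gens (cox_B n) (cox_A (2*n-1)) f \<phi>) \<and>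
           (\<forall>\<phi>. extends_gens (cox_B n) (cox_A (2*n-1)) f \<phi> \<longrightarrow>
              U_poly (cox_B n) (cox_A (2*n-1)) \<phi> = (\<Prod>k=1..2*n. q_num k ((-1)^k * q_var))))
   \<and> (\<forall>n\<ge>1.
        let f = (\<lambda>i. if i \<noteq> n then cox_prod (cox_A (2*n)) [i, 2*n+1-i]
                     else cox_prod (cox_A (2*n)) [n, n+1, n])
        in (\<exists>\<phi>. extends_gens (cox_B n) (cox_A (2*n)) f \<phi>) \<and>
           (\<forall>\<phi>. extends_gens (cox_B n) (cox_A (2*n)) f \<phi> \<longrightarrow>
              U_poly (cox_B n) (cox_A (2*n)) \<phi> = (\<Prod>k=1..2*n+1. q_num k ((-1)^k * q_var))))
   \<and> (\<forall>n\<ge>2.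
        let f = (\<lambda>i. if i \<noteq> n then cox_prod (cox_D (n+1)) [i]
                     else cox_prod (cox_D (n+1)) [n, n+1])
        in (\<exists>\<phi>. extends_gens (cox_B n) (cox_D (n+1)) f \<phi>) \<and>
           (\<forall>\<phi>. extends_gens (cox_B n) (cox_D (n+1)) f \<phi> \<longrightarrow>
              U_poly (cox_B n) (cox_D (n+1)) \<phi> =
                q_num 2 q_var * q_num 3 (- q_var) * q_num 4 q_var *
                (\<Prod>k=3..n. q_num (2*k+1) q_var - q_var ^ k)))
   \<and> (\<forall>n\<ge>1.
        let f = (\<lambda>i. if i = 1 then cox_prod (cox_A n) (filter odd [1..<n+1])
                     else cox_prod (cox_A n) (filter even [1..<n+1]))
        in (\<exists>\<phi>. extends_gens (cox_I2 (n+1)) (cox_A n) f \<phi>) \<and>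
           (\<forall>\<phi>. extends_gens (cox_I2 (n+1)) (cox_A n) f \<phi> \<longrightarrow>
              (\<forall>m. n = 2*m \<longrightarrow>
                 U_poly (cox_I2 (n+1)) (cox_A n) \<phi> =
                   q_num 2 (q_var ^ m) * q_num (n+1) (q_var ^ m)) \<and>
              (\<forall>m. n = 2*m-1 \<longrightarrow>
                 U_poly (cox_I2 (n+1)) (cox_A n) \<phi> =
                   q_num 2 (q_var ^ (m-1)) * q_num 2 (q_var ^ m) * q_num m (q_var ^ n))))"
proof (intro conjI allI impI)
  fix n :: nat assume n: "n \<ge> 1"
  let ?f = "\<lambda>i. if i \<noteq> n then cox_prod (cox_A (2*n-1)) [i, 2*n-i] else cox_prod (cox_A (2*n-1)) [n]"
  have f: "?f i = cox_prod (cox_A (2 * n - 1)) (if i \<noteq> n then [i, 2 * n - i] else [n])" for i by simp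
  show "let f = ?f
      in (\<exists>\<phi>. extends_gens (cox_B n) (cox_A (2*n-1)) f \<phi>) \<and>
         (\<forall>\<phi>. extends_gens (cox_B n) (cox_A (2*n-1)) f \<phi> \<longrightarrow>
            U_poly (cox_B n) (cox_A (2*n-1)) \<phi> = (\<Prod>k=1..2*n. q_num k ((-1)^k * q_var)))"
    unfolding Let_def using U_poly_B_A_odd[OF n f] by blast
next
  fix n :: nat assume n: "n \<ge> 1"
  let ?f = "\<lambda>i. if i \<noteq> n then cox_prod (cox_A (2*n)) [i, 2*n+1-i] else cox_prod (cox_A (2*n)) [n, n+1, n]"
  have f: "?f i = cox_prod (cox_A (2 * n)) (if i \<noteq> n then [i, 2 * n + 1 - i] else [n, n + 1, n])" for i
    by simp
  show "let f = ?f
      in (\<exists>\<phi>. extends_gens (cox_B n) (cox_A (2*n)) f \<phi>) \<and>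
         (\<forall>\<phi>. extends_gens (cox_B n) (cox_A (2*n)) f \<phi> \<longrightarrow>
            U_poly (cox_B n) (cox_A (2*n)) \<phi> = (\<Prod>k=1..2*n+1. q_num k ((-1)^k * q_var)))"
    unfolding Let_def using U_poly_B_A_even[OF n f] by blast
next
  fix n :: nat assume n: "n \<ge> 2"
  let ?f = "\<lambda>i. if i \<noteq> n then cox_prod (cox_D (n+1)) [i] else cox_prod (cox_D (n+1)) [n, n+1]"
  have f: "?f i = cox_prod (cox_D (n + 1)) (if i \<noteq> n then [i] else [n, n + 1])" for i by simp
  show "let f = ?f
      in (\<exists>\<phi>. extends_gens (cox_B n) (cox_D (n+1)) f \<phi>) \<and>
         (\<forall>\<phi>. extends_gens (cox_B n) (cox_D (n+1)) f \<phi> \<longrightarrow>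
            U_poly (cox_B n) (cox_D (n+1)) \<phi> =
              q_num 2 q_var * q_num 3 (- q_var) * q_num 4 q_var *
              (\<Prod>k=3..n. q_num (2*k+1) q_var - q_var ^ k))"
    unfolding Let_def using U_poly_B_D[OF n f] by blast
next
  fix n :: nat assume n: "n \<ge> 1"
  let ?f = "\<lambda>i. if i = 1 then cox_prod (cox_A n) (filter odd [1..<n+1])
    else cox_prod (cox_A n) (filter even [1..<n+1])"
  have f: "?f i = cox_prod (cox_A n) (bip n i)" for i :: nat by (simp add: bip_def)
  have U: "U_poly (cox_I2 (n+1)) (cox_A n) \<phi> = q_num 2 (q_var ^ m) * q_num (n+1) (q_var ^ m)"
    if "extends_gens (cox_I2 (n+1)) (cox_A n) ?f \<phi>" "n = 2 * m" for \<phi> m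
    unfolding U_poly_I2[OF n that(1) f] by (rule sum_bip_even[OF that(2)])
  have U': "U_poly (cox_I2 (n+1)) (cox_A n) \<phi> =
      q_num 2 (q_var ^ (m-1)) * q_num 2 (q_var ^ m) * q_num m (q_var ^ n)"
    if "extends_gens (cox_I2 (n+1)) (cox_A n) ?f \<phi>" "n = 2 * m - 1" for \<phi> m
    \<comment> \<open>The difference \<open>2 * m - 1\<close> is truncated, but
      \<open>n \<ge> 1\<close> excludes \<open>m = 0\<close>.\<close>
    unfolding U_poly_I2[OF n that(1) f] by (rule sum_bip_odd[OF that(2)]) (use n that(2) in auto)
  show "let f = ?f
      in (\<exists>\<phi>. extends_gens (cox_I2 (n+1)) (cox_A n) f \<phi>) \<and>
         (\<forall>\<phi>. extends_gens (cox_I2 (n+1)) (cox_A n) f \<phi> \<longrightarrow>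
            (\<forall>m. n = 2*m \<longrightarrow>
               U_poly (cox_I2 (n+1)) (cox_A n) \<phi> =
                 q_num 2 (q_var ^ m) * q_num (n+1) (q_var ^ m)) \<and>
            (\<forall>m. n = 2*m-1 \<longrightarrow>
               U_poly (cox_I2 (n+1)) (cox_A n) \<phi> =
                 q_num 2 (q_var ^ (m-1)) * q_num 2 (q_var ^ m) * q_num m (q_var ^ n)))"
    unfolding Let_def using bip_extends[OF n f] U U' by blast
qed

end
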